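(* The set $\{f_w\}_{w\in W}$, where $f_w=\frac{1}{|W_{I(w)}|}C_w'(\exp(\varpi_{\overline{I(w)}}))$, is a basis of $\mathbb{Z}[T]$ as a module over $\mathbb{Z}[T]^W$.
   Context: $G$ is an almost simple simply connected algebraic group with maximal torus $T$, character lattice $X^*(T)$ (the full weight lattice), Weyl group $W$ with simple roots $\Pi$, simple reflections $s_i$ ($i\in\Pi$), length function $\ell$, fundamental weights $\varpi_i$. $\mathbb{Z}[T]$ is the group ring of $X^*(T)$ with basis $\exp(\lambda)$, on which $\mathbb{Z}[W]$ acts linearly by $w\exp(\lambda)=\exp(w\lambda)$. For $I\subseteq\Pi$: $\overline{I}=\Pi\setminus I$, $\varpi_I=\sum_{i\in I}\varpi_i$, $W_I=\langle s_i: i\in I\rangle$. For $w\in W$: $I(w)=\{i\in\Pi:\ell(ws_i)<\ell(w)\}$, and $C_w'=\sum_{y\le w}P_{y,w}(1)\,y\in\mathbb{Z}[W]$, with $P_{y,w}$ the Kazhdan-Lusztig polynomials. (Each $f_w$ lies in $\mathbb{Z}[T]$.) *)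

theory Defs
  imports "HOL-Analysis.Analysis" "HOL-Library.Poly_Mapping"
    "HOL-Computational_Algebra.Polynomial"
begin

text \<open>
  An almost simple simply connected algebraic group with maximal torus \<open>T\<close> enters only
  through its root system \<open>\<Phi>\<close>: this is a reduced irreducible crystallographic root system in
  the real vector space spanned by the characters of \<open>T\<close>, which carries a Weyl group
  invariant inner product, and simple connectedness says that the character lattice is the
  full weight lattice of \<open>\<Phi>\<close>.
\<close>

section \<open>Root systems, weights and Weyl groups\<close>

definition reflect :: "'a::euclidean_space \<Rightarrow> 'a \<Rightarrow> 'a" where
  "reflect \<alpha> x = x - (2 * (x \<bullet> \<alpha>) / (\<alpha> \<bullet> \<alpha>)) *\<^sub>R \<alpha>"

definition coroot_pairing :: "'a::euclidean_space \<Rightarrow> 'a \<Rightarrow> real" where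
  "coroot_pairing x \<alpha> = 2 * (x \<bullet> \<alpha>) / (\<alpha> \<bullet> \<alpha>)"

definition root_system :: "'a::euclidean_space set \<Rightarrow> bool" where
  "root_system \<Phi> \<longleftrightarrow>
     finite \<Phi> \<and> 0 \<notin> \<Phi> \<and> span \<Phi> = UNIV \<and>
     (\<forall>\<alpha>\<in>\<Phi>. reflect \<alpha> ` \<Phi> = \<Phi>) \<and>
     (\<forall>\<alpha>\<in>\<Phi>. \<forall>\<beta>\<in>\<Phi>. coroot_pairing \<beta> \<alpha> \<in> \<int>) \<and>
     (\<forall>\<alpha>\<in>\<Phi>. \<forall>c. c *\<^sub>R \<alpha> \<in> \<Phi> \<longrightarrow> c = 1 \<or> c = - 1)"

definition irreducible_root_system :: "'a::euclidean_space set \<Rightarrow> bool" where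
  "irreducible_root_system \<Phi> \<longleftrightarrow>
     root_system \<Phi> \<and> \<Phi> \<noteq> {} \<and>
     \<not> (\<exists>\<Phi>1 \<Phi>2. \<Phi> = \<Phi>1 \<union> \<Phi>2 \<and> \<Phi>1 \<noteq> {} \<and> \<Phi>2 \<noteq> {} \<and> (\<forall>\<alpha>\<in>\<Phi>1. \<forall>\<beta>\<in>\<Phi>2. \<alpha> \<bullet> \<beta> = 0))"

text \<open>
  Simple roots; the set is called \<open>\<Delta>\<close> here because \<open>\<Pi>\<close> is reserved for dependent products.
  A simple root serves as its own index.
\<close>

definition simple_roots :: "'a::euclidean_space set \<Rightarrow> 'a set \<Rightarrow> bool" where
  "simple_roots \<Phi> \<Delta> \<longleftrightarrow>
     \<Delta> \<subseteq> \<Phi> \<and> independent \<Delta> \<and>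
     (\<forall>\<alpha>\<in>\<Phi>. \<exists>c :: 'a \<Rightarrow> int. \<alpha> = (\<Sum>\<beta>\<in>\<Delta>. of_int (c \<beta>) *\<^sub>R \<beta>) \<and>
        ((\<forall>\<beta>\<in>\<Delta>. c \<beta> \<ge> 0) \<or> (\<forall>\<beta>\<in>\<Delta>. c \<beta> \<le> 0)))"

definition weight_lattice :: "'a::euclidean_space set \<Rightarrow> 'a set" where
  "weight_lattice \<Phi> = {x. \<forall>\<alpha>\<in>\<Phi>. coroot_pairing x \<alpha> \<in> \<int>}"

definition fundamental_weight :: "'a::euclidean_space set \<Rightarrow> 'a \<Rightarrow> 'a" where
  "fundamental_weight \<Delta> \<alpha> =
     (THE x. \<forall>\<beta>\<in>\<Delta>. coroot_pairing x \<beta> = (if \<beta> = \<alpha> then 1 else 0))"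

definition weight_sum :: "'a::euclidean_space set \<Rightarrow> 'a set \<Rightarrow> 'a" where
  "weight_sum \<Delta> I = (\<Sum>\<alpha>\<in>I. fundamental_weight \<Delta> \<alpha>)"

text \<open>
  The group generated by the reflections in the vectors of \<open>S\<close>; no clause for inverses is
  needed, as reflections are involutions. Group elements are maps on the ambient space, and
  the product is composition.
\<close>

inductive_set reflection_group :: "'a::euclidean_space set \<Rightarrow> ('a \<Rightarrow> 'a) set"
  for S :: "'a set" where
  id: "id \<in> reflection_group S"
| step: "\<alpha> \<in> S \<Longrightarrow> w \<in> reflection_group S \<Longrightarrow> reflect \<alpha> \<circ> w \<in> reflection_group S"

abbreviation weyl_group :: "'a::euclidean_space set \<Rightarrow> ('a \<Rightarrow> 'a) set" where
  "weyl_group \<Phi> \<equiv> reflection_group \<Phi>"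

definition word_prod :: "'a::euclidean_space list \<Rightarrow> 'a \<Rightarrow> 'a" where
  "word_prod \<alpha>s = foldr (\<lambda>\<alpha> w. reflect \<alpha> \<circ> w) \<alpha>s id"

definition len :: "'a::euclidean_space set \<Rightarrow> ('a \<Rightarrow> 'a) \<Rightarrow> nat" where
  "len \<Delta> w = (LEAST n. \<exists>\<alpha>s. set \<alpha>s \<subseteq> \<Delta> \<and> length \<alpha>s = n \<and> word_prod \<alpha>s = w)"

definition descents :: "'a::euclidean_space set \<Rightarrow> ('a \<Rightarrow> 'a) \<Rightarrow> 'a set" where
  "descents \<Delta> w = {\<alpha> \<in> \<Delta>. len \<Delta> (w \<circ> reflect \<alpha>) < len \<Delta> w}"

definition bruhat_le ::
    "'a::euclidean_space set \<Rightarrow> 'a set \<Rightarrow> ('a \<Rightarrow> 'a) \<Rightarrow> ('a \<Rightarrow> 'a) \<Rightarrow> bool" where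
  "bruhat_le \<Phi> \<Delta> y w \<longleftrightarrow> y \<in> weyl_group \<Phi> \<and> w \<in> weyl_group \<Phi> \<and>
     (y, w) \<in> {(u, u \<circ> reflect \<beta>) | u \<beta>.
                 u \<in> weyl_group \<Phi> \<and> \<beta> \<in> \<Phi> \<and> len \<Delta> u < len \<Delta> (u \<circ> reflect \<beta>)}\<^sup>*"

section \<open>The Hecke algebra and Kazhdan-Lusztig polynomials\<close>

text \<open>
  Laurent polynomials over the integers in \<open>v = q\<^bsup>1/2\<^esup>\<close>, as the group ring of the integers.
\<close>

type_synonym laurent = "int \<Rightarrow>\<^sub>0 int"

definition vpow :: "int \<Rightarrow> laurent" where
  "vpow n = Poly_Mapping.single n 1"

definition qv :: laurent where
  "qv = vpow 2"

definition laurent_bar :: "laurent \<Rightarrow> laurent" where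
  "laurent_bar a = Poly_Mapping.map_key uminus a"

text \<open>
  An element \<open>\<Sum>w. h w T\<^sub>w\<close> of the Hecke algebra is represented by its coefficient function
  \<open>h\<close>, which is zero outside the Weyl group.
\<close>

type_synonym 'a hecke = "('a \<Rightarrow> 'a) \<Rightarrow> laurent"

definition hecke_carrier :: "'a::euclidean_space set \<Rightarrow> 'a hecke set" where
  "hecke_carrier \<Phi> = {h. \<forall>w. w \<notin> weyl_group \<Phi> \<longrightarrow> h w = 0}"

definition Tb :: "('a \<Rightarrow> 'a) \<Rightarrow> 'a hecke" where
  "Tb w = (\<lambda>x. if x = w then 1 else 0)"

text \<open>
  Left multiplication by \<open>T\<^sub>s\<close> for the simple reflection \<open>s\<close> in \<open>\<alpha>\<close>: \<open>T\<^sub>s T\<^sub>w = T\<^bsub>sw\<^esub>\<close> if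
  \<open>sw\<close> is longer than \<open>w\<close>, and \<open>T\<^sub>s T\<^sub>w = (q - 1) T\<^sub>w + q T\<^bsub>sw\<^esub>\<close> otherwise.
\<close>

definition T_simple_mult ::
    "'a::euclidean_space set \<Rightarrow> 'a set \<Rightarrow> 'a \<Rightarrow> 'a hecke \<Rightarrow> 'a hecke" where
  "T_simple_mult \<Phi> \<Delta> \<alpha> h = (\<lambda>x. \<Sum>w\<in>weyl_group \<Phi>.
     h w * (if len \<Delta> w < len \<Delta> (reflect \<alpha> \<circ> w) then Tb (reflect \<alpha> \<circ> w) x
            else (qv - 1) * Tb w x + qv * Tb (reflect \<alpha> \<circ> w) x))"

definition reduced_word :: "'a::euclidean_space set \<Rightarrow> ('a \<Rightarrow> 'a) \<Rightarrow> 'a list" where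
  "reduced_word \<Delta> w =
     (SOME \<alpha>s. set \<alpha>s \<subseteq> \<Delta> \<and> length \<alpha>s = len \<Delta> w \<and> word_prod \<alpha>s = w)"

text \<open>
  The product uses \<open>T\<^sub>w = T\<^bsub>s\<^esub> \<dots> T\<^bsub>t\<^esub>\<close> for a reduced expression \<open>w = s \<dots> t\<close>; by Matsumoto's
  theorem the choice of the reduced expression does not matter.
\<close>

definition hecke_mult ::
    "'a::euclidean_space set \<Rightarrow> 'a set \<Rightarrow> 'a hecke \<Rightarrow> 'a hecke \<Rightarrow> 'a hecke" where
  "hecke_mult \<Phi> \<Delta> h k = (\<lambda>x. \<Sum>w\<in>weyl_group \<Phi>.
     h w * foldr (T_simple_mult \<Phi> \<Delta>) (reduced_word \<Delta> w) k x)"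

definition hecke_inverse ::
    "'a::euclidean_space set \<Rightarrow> 'a set \<Rightarrow> 'a hecke \<Rightarrow> 'a hecke" where
  "hecke_inverse \<Phi> \<Delta> h = (THE k. k \<in> hecke_carrier \<Phi> \<and>
     hecke_mult \<Phi> \<Delta> h k = Tb id \<and> hecke_mult \<Phi> \<Delta> k h = Tb id)"

text \<open>The bar involution is semilinear and maps \<open>T\<^sub>w\<close> to the inverse of \<open>T\<^bsub>u\<^esub>\<close>, where \<open>u\<close> is the inverse of \<open>w\<close>.\<close>

definition hecke_bar ::
    "'a::euclidean_space set \<Rightarrow> 'a set \<Rightarrow> 'a hecke \<Rightarrow> 'a hecke" where
  "hecke_bar \<Phi> \<Delta> h = (\<lambda>x. \<Sum>w\<in>weyl_group \<Phi>.
     laurent_bar (h w) * hecke_inverse \<Phi> \<Delta> (Tb (inv w)) x)"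

text \<open>The Hecke algebra element \<open>q\<^bsup>-l(w)/2\<^esup> \<Sum>y\<le>w. P\<^sub>y(q) T\<^sub>y\<close> for a family of polynomials \<open>P\<close>.\<close>

definition hecke_kl_element ::
    "'a::euclidean_space set \<Rightarrow> 'a set \<Rightarrow> ('a \<Rightarrow> 'a) \<Rightarrow> (('a \<Rightarrow> 'a) \<Rightarrow> int poly) \<Rightarrow> 'a hecke" where
  "hecke_kl_element \<Phi> \<Delta> w P = (\<lambda>y. if bruhat_le \<Phi> \<Delta> y w
     then vpow (- int (len \<Delta> w)) * poly (map_poly of_int (P y)) qv else 0)"

text \<open>
  The family of Kazhdan-Lusztig polynomials \<open>P\<^bsub>y,w\<^esub>\<close> for fixed \<open>w\<close>. The third condition says
  that the degree of \<open>P\<^bsub>y,w\<^esub>\<close> is at most \<open>(l(w) - l(y) - 1)/2\<close> for \<open>y < w\<close>; by convention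
  \<open>P\<^bsub>y,w\<^esub> = 0\<close> unless \<open>y \<le> w\<close>.
\<close>

definition is_kl_family ::
    "'a::euclidean_space set \<Rightarrow> 'a set \<Rightarrow> ('a \<Rightarrow> 'a) \<Rightarrow> (('a \<Rightarrow> 'a) \<Rightarrow> int poly) \<Rightarrow> bool" where
  "is_kl_family \<Phi> \<Delta> w P \<longleftrightarrow>
     P w = 1 \<and>
     (\<forall>y. \<not> bruhat_le \<Phi> \<Delta> y w \<longrightarrow> P y = 0) \<and>
     (\<forall>y. bruhat_le \<Phi> \<Delta> y w \<and> y \<noteq> w \<longrightarrow> 2 * degree (P y) + len \<Delta> y + 1 \<le> len \<Delta> w) \<and>
     hecke_bar \<Phi> \<Delta> (hecke_kl_element \<Phi> \<Delta> w P) = hecke_kl_element \<Phi> \<Delta> w P"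

definition kl_poly ::
    "'a::euclidean_space set \<Rightarrow> 'a set \<Rightarrow> ('a \<Rightarrow> 'a) \<Rightarrow> ('a \<Rightarrow> 'a) \<Rightarrow> int poly" where
  "kl_poly \<Phi> \<Delta> y w = (THE P. is_kl_family \<Phi> \<Delta> w P) y"

text \<open>The element \<open>C'\<^sub>w\<close> of the integral group ring of the Weyl group.\<close>

definition kl_element ::
    "'a::euclidean_space set \<Rightarrow> 'a set \<Rightarrow> ('a \<Rightarrow> 'a) \<Rightarrow> (('a \<Rightarrow> 'a) \<Rightarrow>\<^sub>0 int)" where
  "kl_element \<Phi> \<Delta> w =
     (\<Sum>y\<in>{y. bruhat_le \<Phi> \<Delta> y w}. Poly_Mapping.single y (poly (kl_poly \<Phi> \<Delta> y w) 1))"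

section \<open>The group ring of the character lattice\<close>

text \<open>
  Everything takes place in the rational group ring of the ambient space, so that division by
  the order of a parabolic subgroup makes sense; the integral group ring of the weight lattice
  is a subring of it.
\<close>

definition char_ring :: "'a::euclidean_space set \<Rightarrow> ('a \<Rightarrow>\<^sub>0 rat) set" where
  "char_ring \<Phi> = {f. Poly_Mapping.keys f \<subseteq> weight_lattice \<Phi> \<and>
                      (\<forall>x. Poly_Mapping.lookup f x \<in> \<int>)}"

definition chexp :: "'a::euclidean_space \<Rightarrow> ('a \<Rightarrow>\<^sub>0 rat)" where
  "chexp x = Poly_Mapping.single x 1"

definition weyl_act :: "('a::euclidean_space \<Rightarrow> 'a) \<Rightarrow> ('a \<Rightarrow>\<^sub>0 rat) \<Rightarrow> ('a \<Rightarrow>\<^sub>0 rat)" where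
  "weyl_act w f =
     (\<Sum>x\<in>Poly_Mapping.keys f. Poly_Mapping.single (w x) (Poly_Mapping.lookup f x))"

definition group_ring_act ::
    "(('a::euclidean_space \<Rightarrow> 'a) \<Rightarrow>\<^sub>0 int) \<Rightarrow> ('a \<Rightarrow>\<^sub>0 rat) \<Rightarrow> ('a \<Rightarrow>\<^sub>0 rat)" where
  "group_ring_act c f =
     (\<Sum>w\<in>Poly_Mapping.keys c. of_int (Poly_Mapping.lookup c w) * weyl_act w f)"

definition char_ring_invariants :: "'a::euclidean_space set \<Rightarrow> ('a \<Rightarrow>\<^sub>0 rat) set" where
  "char_ring_invariants \<Phi> = {f \<in> char_ring \<Phi>. \<forall>w\<in>weyl_group \<Phi>. weyl_act w f = f}"

definition kl_basis_element ::
    "'a::euclidean_space set \<Rightarrow> 'a set \<Rightarrow> ('a \<Rightarrow> 'a) \<Rightarrow> ('a \<Rightarrow>\<^sub>0 rat)" where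
  "kl_basis_element \<Phi> \<Delta> w =
     Poly_Mapping.map (\<lambda>c. 1 / of_nat (card (reflection_group (descents \<Delta> w))) * c)
       (group_ring_act (kl_element \<Phi> \<Delta> w) (chexp (weight_sum \<Delta> (\<Delta> - descents \<Delta> w))))"

text \<open>
  A finite family \<open>b\<close>, indexed by \<open>I\<close>, of elements of an ambient commutative ring is a basis
  of \<open>M\<close> as a module over the subring \<open>R\<close>. Linear independence of the family makes \<open>b\<close>
  injective on \<open>I\<close> as soon as \<open>1 \<in> R\<close> and \<open>1 \<noteq> 0\<close>.
\<close>

definition is_module_basis ::
    "'r::comm_ring_1 set \<Rightarrow> 'r set \<Rightarrow> ('i \<Rightarrow> 'r) \<Rightarrow> 'i set \<Rightarrow> bool" where
  "is_module_basis R M b I \<longleftrightarrow>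
     finite I \<and> b ` I \<subseteq> M \<and>
     (\<forall>m\<in>M. \<exists>c. c ` I \<subseteq> R \<and> m = (\<Sum>i\<in>I. c i * b i)) \<and>
     (\<forall>c. c ` I \<subseteq> R \<and> (\<Sum>i\<in>I. c i * b i) = 0 \<longrightarrow> (\<forall>i\<in>I. c i = 0))"

end

theory Submission
  imports Defs
begin

text \<open>
  Since \<open>C'\<^sub>w\<close> is invariant under \<open>W\<^sub>I\<close>, \<open>I = I(w)\<close>, from the right, and \<open>W\<^sub>I\<close> is the stabilizer of the
  dominant weight \<open>\<varpi>\<^sub>w\<close> indexed by the complement of \<open>I\<close>, the coefficient of \<open>exp(x \<varpi>\<^sub>w)\<close> in \<open>f\<^sub>w\<close> is
  \<open>P\<^bsub>x,w\<^esub>(1)\<close>. Let \<open>m\<^sub>\<nu>\<close> be the orbit sum of a dominant weight \<open>\<nu>\<close> and put \<open>\<mu> = \<nu> + \<varpi>\<^sub>w\<close>. The weights of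
  \<open>m\<^sub>\<nu> f\<^sub>w\<close> are conjugate to dominant weights of height at most that of \<open>\<mu>\<close>; the only ones of the same
  height lie in the orbit of \<open>\<mu>\<close>, and \<open>exp(x \<mu>)\<close> has coefficient \<open>P\<^bsub>x,w\<^esub>(1)\<close>. Every weight is uniquely of
  the form \<open>w \<mu>\<close> with \<open>\<mu>\<close> dominant and \<open>w\<close> of maximal length in its coset modulo the stabilizer of \<open>\<mu>\<close>,
  which says exactly that \<open>\<mu> - \<varpi>\<^sub>w\<close> is dominant. Hence the \<open>m\<^sub>\<nu> f\<^sub>w\<close> are unitriangular with respect to the
  \<open>exp(w \<mu>)\<close>, ordered by the height of \<open>\<mu>\<close> and then by the length of \<open>w\<close>.
\<close>

section \<open>Reflections and root systems\<close>

text \<open>The polynomials P_{y,w} enter through descriptions: \<open>kl_poly\<close> takes the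
  unique family, \<open>hecke_inverse\<close> the unique inverse, \<open>hecke_mult\<close> a chosen
  reduced word. Nothing about C'_w can be read off before existence and uniqueness are proved, and
  this is a large part of the work. Independence of the chosen word comes from commuting operators:
  left multiplications commute with the right multiplications by the T_s, which are given directly
  by coefficients, and a linear map commuting with the latter is determined by its value on the
  unit. Right invariance of C'_w, on which the division by the order of W_I rests, is read off from
  the inductive construction at one descent and transported to every descent by uniqueness. The
  height is the pairing with the sum of the positive coroots. It is additive, so it controls
  products; on a W-orbit it is largest exactly at the dominant member; and it is a nonnegative
  integer on dominant weights, so it can drive an induction.\<close>

lemma reflect_eq: "reflect \<alpha> x = x - coroot_pairing x \<alpha> *\<^sub>R \<alpha>"
  by (simp add: reflect_def coroot_pairing_def)

lemma linear_reflect: "linear (reflect \<alpha>)"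
  unfolding reflect_def
  by (rule linearI) (simp_all add: inner_simps algebra_simps add_divide_distrib)

lemma reflect_self: "\<alpha> \<noteq> 0 \<Longrightarrow> reflect \<alpha> \<alpha> = - \<alpha>"
  by (simp add: reflect_def scaleR_2 algebra_simps)

lemma coroot_pairing_self: "\<alpha> \<noteq> 0 \<Longrightarrow> coroot_pairing \<alpha> \<alpha> = 2"
  by (simp add: coroot_pairing_def)

lemma coroot_pairing_linear:
  "coroot_pairing (x + y) \<alpha> = coroot_pairing x \<alpha> + coroot_pairing y \<alpha>"
  "coroot_pairing (x - y) \<alpha> = coroot_pairing x \<alpha> - coroot_pairing y \<alpha>"
  "coroot_pairing (c *\<^sub>R x) \<alpha> = c * coroot_pairing x \<alpha>"
  "coroot_pairing (- x) \<alpha> = - coroot_pairing x \<alpha>"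
  "coroot_pairing 0 \<alpha> = 0"
  by (simp_all add: coroot_pairing_def inner_simps algebra_simps add_divide_distrib diff_divide_distrib)

lemma coroot_pairing_uminus_right: "coroot_pairing x (- \<alpha>) = - coroot_pairing x \<alpha>"
  by (simp add: coroot_pairing_def)

lemma coroot_pairing_sum: "coroot_pairing (\<Sum>i\<in>I. f i) \<alpha> = (\<Sum>i\<in>I. coroot_pairing (f i) \<alpha>)"
  by (simp add: coroot_pairing_def inner_sum_left sum_distrib_left sum_divide_distrib)

lemma reflect_reflect [simp]: "reflect \<alpha> (reflect \<alpha> x) = x"
  by (cases "\<alpha> = 0") (simp_all add: reflect_eq coroot_pairing_linear coroot_pairing_self)

lemma reflect_comp_self [simp]: "reflect \<alpha> \<circ> reflect \<alpha> = id" "reflect \<alpha> \<circ> (reflect \<alpha> \<circ> w) = w"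
  "w \<circ> reflect \<alpha> \<circ> reflect \<alpha> = w"
  by auto

lemma reflect_uminus: "reflect (- \<alpha>) = reflect \<alpha>"
  by (auto simp: reflect_def)

lemma inner_reflect: "reflect \<alpha> x \<bullet> reflect \<alpha> y = x \<bullet> y"
  by (cases "\<alpha> = 0") (simp_all add: reflect_def inner_simps algebra_simps inner_commute)

lemma orthogonal_reflect: "orthogonal_transformation (reflect \<alpha>)"
  by (simp add: orthogonal_transformation_def linear_reflect inner_reflect)

lemma coroot_pairing_orthogonal:
  "orthogonal_transformation w \<Longrightarrow> coroot_pairing (w x) (w \<beta>) = coroot_pairing x \<beta>"
  by (simp add: orthogonal_transformation_def coroot_pairing_def)

lemma reflect_orthogonal:
  assumes "orthogonal_transformation w"
  shows "reflect (w \<beta>) (w x) = w (reflect \<beta> x)"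
  using assms linear_diff[of w] linear_scale[of w]
  by (simp add: reflect_eq coroot_pairing_orthogonal orthogonal_transformation_linear)

lemma comp_reflect:
  "orthogonal_transformation w \<Longrightarrow> w \<circ> reflect \<beta> = reflect (w \<beta>) \<circ> w"
  by (auto simp: reflect_orthogonal)

lemma word_prod_simps [simp]:
  "word_prod [] = id" "word_prod (\<alpha> # \<alpha>s) = reflect \<alpha> \<circ> word_prod \<alpha>s"
  by (simp_all add: word_prod_def)

lemma word_prod_append: "word_prod (\<alpha>s @ \<beta>s) = word_prod \<alpha>s \<circ> word_prod \<beta>s"
  by (induction \<alpha>s) (auto simp: o_assoc)

lemma word_prod_rev: "word_prod (rev \<alpha>s) \<circ> word_prod \<alpha>s = id"
proof (induction \<alpha>s)
  case (Cons \<alpha> \<alpha>s)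
  then show ?case by (auto simp: word_prod_append fun_eq_iff)
qed simp

lemma inv_word_prod: "inv (word_prod \<alpha>s) = word_prod (rev \<alpha>s)"
  using word_prod_rev[of \<alpha>s] word_prod_rev[of "rev \<alpha>s"] by (simp add: inv_unique_comp)

lemma reflection_group_eq: "reflection_group S = {word_prod \<alpha>s | \<alpha>s. set \<alpha>s \<subseteq> S}"
proof (intro equalityI subsetI)
  fix w assume "w \<in> reflection_group S"
  then show "w \<in> {word_prod \<alpha>s | \<alpha>s. set \<alpha>s \<subseteq> S}"
  proof induction
    case id
    then show ?case by (auto intro!: exI[of _ "[]"])
  next
    case (step \<alpha> w)
    then obtain \<alpha>s where "w = word_prod \<alpha>s" "set \<alpha>s \<subseteq> S" by auto
    with step show ?case by (auto intro!: exI[of _ "\<alpha> # \<alpha>s"])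
  qed
next
  fix w assume "w \<in> {word_prod \<alpha>s | \<alpha>s. set \<alpha>s \<subseteq> S}"
  then obtain \<alpha>s where "w = word_prod \<alpha>s" "set \<alpha>s \<subseteq> S" by auto
  then show "w \<in> reflection_group S"
  proof (induction \<alpha>s arbitrary: w)
    case Nil
    then show ?case using reflection_group.id by (metis word_prod_simps(1))
  next
    case (Cons a \<alpha>s)
    then have "word_prod \<alpha>s \<in> reflection_group S" by simp
    then show ?case
      using Cons.prems reflection_group.step[of a S "word_prod \<alpha>s"] word_prod_simps(2)[of a \<alpha>s]
      by (metis insert_subset list.simps(15))
  qed
qed

lemma word_prod_in: "set \<alpha>s \<subseteq> S \<Longrightarrow> word_prod \<alpha>s \<in> reflection_group S"
  by (auto simp: reflection_group_eq)

lemma reflection_group_comp: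
  "v \<in> reflection_group S \<Longrightarrow> w \<in> reflection_group S \<Longrightarrow> v \<circ> w \<in> reflection_group S"
  unfolding reflection_group_eq
proof clarify
  fix \<alpha>s \<beta>s assume "set \<alpha>s \<subseteq> S" "set \<beta>s \<subseteq> S"
  then show "\<exists>\<gamma>s. word_prod \<alpha>s \<circ> word_prod \<beta>s = word_prod \<gamma>s \<and> set \<gamma>s \<subseteq> S"
    by (intro exI[of _ "\<alpha>s @ \<beta>s"]) (simp add: word_prod_append)
qed

lemma reflection_group_inv: "w \<in> reflection_group S \<Longrightarrow> inv w \<in> reflection_group S"
  unfolding reflection_group_eq
proof clarify
  fix \<alpha>s assume "set \<alpha>s \<subseteq> S"
  then show "\<exists>\<gamma>s. inv (word_prod \<alpha>s) = word_prod \<gamma>s \<and> set \<gamma>s \<subseteq> S"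
    by (intro exI[of _ "rev \<alpha>s"]) (simp add: inv_word_prod)
qed

lemma reflect_in: "\<alpha> \<in> S \<Longrightarrow> reflect \<alpha> \<in> reflection_group S"
  using word_prod_in[of "[\<alpha>]" S] by simp

lemma reflection_group_orthogonal:
  "w \<in> reflection_group S \<Longrightarrow> orthogonal_transformation w"
proof (induction rule: reflection_group.induct)
  case id
  show ?case by (simp add: orthogonal_transformation_id id_def)
next
  case (step \<alpha> w)
  from orthogonal_transformation_compose[OF orthogonal_reflect step.IH] show ?case .
qed

lemma reflection_group_inv_comp:
  assumes "w \<in> reflection_group S"
  shows "inv w \<circ> w = id" "w \<circ> inv w = id" "inv w (w x) = x" "w (inv w x) = x"
proof -
  have "bij w"
    by (rule orthogonal_transformation_bij[OF reflection_group_orthogonal[OF assms]])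
  then show i: "inv w \<circ> w = id" "w \<circ> inv w = id"
    by (simp_all only: bij_is_inj inv_o_cancel surj_iff[THEN iffD1, OF bij_is_surj])
  show "inv w (w x) = x" "w (inv w x) = x"
    by (rule pointfree_idE[OF i(1)], rule pointfree_idE[OF i(2)])
qed

lemma reflection_group_mono:
  assumes "S \<subseteq> T"
  shows "reflection_group S \<subseteq> reflection_group T"
proof
  fix w assume "w \<in> reflection_group S"
  then show "w \<in> reflection_group T"
  proof induction
    case id
    show ?case by (rule reflection_group.id)
  next
    case (step \<alpha> w)
    then show ?case using assms reflection_group.step by blast
  qed
qed

section \<open>Positive roots, simple reflections and finiteness of the Weyl group\<close>

locale based_root_system =
  fixes \<Phi> \<Delta> :: "'a::euclidean_space set"
  assumes root_system: "root_system \<Phi>" and simple_roots: "simple_roots \<Phi> \<Delta>"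
begin

abbreviation W :: "('a \<Rightarrow> 'a) set" where "W \<equiv> weyl_group \<Phi>"
abbreviation fw :: "'a \<Rightarrow> 'a" where "fw \<equiv> fundamental_weight \<Delta>"

lemma finite_roots: "finite \<Phi>" and root_nonzero: "\<beta> \<in> \<Phi> \<Longrightarrow> \<beta> \<noteq> 0"
  and span_roots: "span \<Phi> = UNIV"
  and reflect_root: "\<alpha> \<in> \<Phi> \<Longrightarrow> \<beta> \<in> \<Phi> \<Longrightarrow> reflect \<alpha> \<beta> \<in> \<Phi>"
  and cartan_int: "\<alpha> \<in> \<Phi> \<Longrightarrow> \<beta> \<in> \<Phi> \<Longrightarrow> coroot_pairing \<beta> \<alpha> \<in> \<int>"
  and root_reduced: "\<alpha> \<in> \<Phi> \<Longrightarrow> c *\<^sub>R \<alpha> \<in> \<Phi> \<Longrightarrow> c = 1 \<or> c = - 1"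
proof -
  note r = root_system[unfolded root_system_def]
  show "finite \<Phi>" "span \<Phi> = UNIV" using r by simp_all
  show "\<beta> \<in> \<Phi> \<Longrightarrow> \<beta> \<noteq> 0" using r by metis
  show "\<alpha> \<in> \<Phi> \<Longrightarrow> \<beta> \<in> \<Phi> \<Longrightarrow> reflect \<alpha> \<beta> \<in> \<Phi>" using r imageI by metis
  show "\<alpha> \<in> \<Phi> \<Longrightarrow> \<beta> \<in> \<Phi> \<Longrightarrow> coroot_pairing \<beta> \<alpha> \<in> \<int>" using r by simp
  show "\<alpha> \<in> \<Phi> \<Longrightarrow> c *\<^sub>R \<alpha> \<in> \<Phi> \<Longrightarrow> c = 1 \<or> c = - 1" using r by metis
qed

lemma simple_subset: "\<Delta> \<subseteq> \<Phi>" and indep_simple: "independent \<Delta>"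
  using simple_roots unfolding simple_roots_def by simp_all

lemma simple_root: "\<alpha> \<in> \<Delta> \<Longrightarrow> \<alpha> \<in> \<Phi>"
  using simple_subset by blast

lemma finite_simple: "finite \<Delta>"
  using finite_roots simple_subset finite_subset by blast

lemma simple_nonzero: "\<alpha> \<in> \<Delta> \<Longrightarrow> \<alpha> \<noteq> 0"
  using simple_root root_nonzero by blast

lemma span_simple: "span \<Delta> = UNIV"
proof -
  have "\<Phi> \<subseteq> span \<Delta>"
  proof
    fix \<beta> assume "\<beta> \<in> \<Phi>"
    then obtain c :: "'a \<Rightarrow> int" where "\<beta> = (\<Sum>\<gamma>\<in>\<Delta>. of_int (c \<gamma>) *\<^sub>R \<gamma>)"
      using simple_roots unfolding simple_roots_def by blast
    then show "\<beta> \<in> span \<Delta>" by (simp add: span_sum span_scale span_base)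
  qed
  then show ?thesis using span_roots span_mono[of \<Phi> "span \<Delta>"] by (simp add: span_span top.extremum_uniqueI)
qed

text \<open>The definite description is legitimate because \<Delta> is a basis: the prescribed
  values on \<Delta> extend to a linear functional, which the inner product represents by a vector,
  and a vector orthogonal to the spanning set \<Delta> is zero.\<close>

lemma fundamental_weight_pairing:
  assumes "\<gamma> \<in> \<Delta>" "\<beta> \<in> \<Delta>"
  shows "coroot_pairing (fw \<gamma>) \<beta> = (if \<beta> = \<gamma> then 1 else 0)"
proof -
  \<comment> \<open>Half the squared length is the inner product that corresponds to the coroot
    pairing 1.\<close>
  obtain f :: "'a \<Rightarrow> real" where f: "linear f" "\<forall>\<beta>\<in>\<Delta>. f \<beta> = (if \<beta> = \<gamma> then (\<beta> \<bullet> \<beta>) / 2 else 0)"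
    using linear_independent_extend[OF indep_simple, of "\<lambda>\<beta>. if \<beta> = \<gamma> then (\<beta> \<bullet> \<beta>) / 2 else 0"]
    by auto
  define x where "x = (\<Sum>b\<in>Basis. f b *\<^sub>R b)"
  have fx: "f y = x \<bullet> y" for y
  proof -
    have "f y = f (\<Sum>b\<in>Basis. (y \<bullet> b) *\<^sub>R b)" by (simp add: euclidean_representation)
    also have "\<dots> = (\<Sum>b\<in>Basis. (y \<bullet> b) * f b)"
      using f(1) by (simp add: linear_sum linear_scale)
    finally show ?thesis by (simp add: x_def inner_sum_left inner_commute[of y] mult.commute)
  qed
  have ex: "\<forall>\<beta>\<in>\<Delta>. coroot_pairing x \<beta> = (if \<beta> = \<gamma> then 1 else 0)"
    using f(2) simple_nonzero by (auto simp: coroot_pairing_def fx)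
  have uniq: "y = x" if y: "\<forall>\<beta>\<in>\<Delta>. coroot_pairing y \<beta> = (if \<beta> = \<gamma> then 1 else 0)" for y
  proof -
    have "(y - x) \<bullet> \<beta> = 0" if "\<beta> \<in> \<Delta>" for \<beta>
    proof -
      have "coroot_pairing (y - x) \<beta> = 0" using y ex that by (simp add: coroot_pairing_linear)
      then show ?thesis using simple_nonzero[OF that] by (simp add: coroot_pairing_def)
    qed
    then have "orthogonal (y - x) (y - x)"
      using orthogonal_to_span[of "y - x" \<Delta> "y - x"] span_simple by (simp add: orthogonal_def)
    then show ?thesis by (simp add: orthogonal_def)
  qed
  have "\<forall>\<beta>\<in>\<Delta>. coroot_pairing (fw \<gamma>) \<beta> = (if \<beta> = \<gamma> then 1 else 0)"
    unfolding fundamental_weight_def by (rule theI, rule ex, erule uniq)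
  then show ?thesis using assms by simp
qed

lemma inner_fundamental_weight:
  "\<gamma> \<in> \<Delta> \<Longrightarrow> \<beta> \<in> \<Delta> \<Longrightarrow> \<beta> \<bullet> fw \<gamma> = (if \<beta> = \<gamma> then (\<beta> \<bullet> \<beta>) / 2 else 0)"
  using fundamental_weight_pairing[of \<gamma> \<beta>] simple_nonzero[of \<beta>]
  by (auto simp: coroot_pairing_def inner_commute split: if_splits)

text \<open>Up to the factors 2 / (\<gamma> \<bullet> \<gamma>) the fundamental weights are the dual
  basis of the simple roots; both sides are linear in x and agree on \<Delta>.\<close>

lemma simple_expansion: "x = (\<Sum>\<gamma>\<in>\<Delta>. (2 * (x \<bullet> fw \<gamma>) / (\<gamma> \<bullet> \<gamma>)) *\<^sub>R \<gamma>)"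
proof -
  let ?g = "\<lambda>x. \<Sum>\<gamma>\<in>\<Delta>. (2 * (x \<bullet> fw \<gamma>) / (\<gamma> \<bullet> \<gamma>)) *\<^sub>R \<gamma>"
  have "linear ?g"
    by (rule linearI) (simp_all add: inner_simps sum.distrib[symmetric] scaleR_sum_right
        distrib_left add_divide_distrib scaleR_add_left mult.left_commute)
  moreover have "id \<beta> = ?g \<beta>" if "\<beta> \<in> \<Delta>" for \<beta>
  proof -
    have "?g \<beta> = (\<Sum>\<gamma>\<in>\<Delta>. if \<gamma> = \<beta> then \<gamma> else 0)"
      by (rule sum.cong) (use that simple_nonzero in \<open>auto simp: inner_fundamental_weight\<close>)
    then show ?thesis using that finite_simple by simp
  qed
  ultimately have "id x = ?g x"
    using linear_eq_on_span[of id ?g \<Delta> x] span_simple linear_id by auto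
  then show ?thesis by simp
qed

text \<open>By \<open>simple_expansion\<close> the inner products with the fundamental weights have
  the signs of the simple-root coefficients. In this form no integer coefficient function has to be
  carried along with a root.\<close>

definition pos :: "'a \<Rightarrow> bool" where
  "pos \<beta> \<longleftrightarrow> \<beta> \<in> \<Phi> \<and> (\<forall>\<gamma>\<in>\<Delta>. 0 \<le> \<beta> \<bullet> fw \<gamma>)"

lemma uminus_root: "\<beta> \<in> \<Phi> \<Longrightarrow> - \<beta> \<in> \<Phi>"
  using reflect_root[of \<beta> \<beta>] reflect_self[of \<beta>] root_nonzero by auto

lemma pos_root: "pos \<beta> \<Longrightarrow> \<beta> \<in> \<Phi>"
  by (simp add: pos_def)

lemma root_cases: assumes "\<beta> \<in> \<Phi>" shows "pos \<beta> \<or> pos (- \<beta>)"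
proof -
  obtain c :: "'a \<Rightarrow> int" where c: "\<beta> = (\<Sum>\<gamma>\<in>\<Delta>. of_int (c \<gamma>) *\<^sub>R \<gamma>)"
    "(\<forall>\<gamma>\<in>\<Delta>. c \<gamma> \<ge> 0) \<or> (\<forall>\<gamma>\<in>\<Delta>. c \<gamma> \<le> 0)"
    using simple_roots assms unfolding simple_roots_def by blast
  have e: "\<beta> \<bullet> fw \<gamma> = of_int (c \<gamma>) * ((\<gamma> \<bullet> \<gamma>) / 2)" if "\<gamma> \<in> \<Delta>" for \<gamma>
  proof -
    have "\<beta> \<bullet> fw \<gamma> = (\<Sum>\<delta>\<in>\<Delta>. if \<delta> = \<gamma> then of_int (c \<gamma>) * ((\<gamma> \<bullet> \<gamma>) / 2) else 0)"
      by (subst c(1), simp only: inner_sum_left, rule sum.cong)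
         (use that in \<open>auto simp: inner_fundamental_weight\<close>)
    then show ?thesis using that finite_simple by simp
  qed
  from c(2) show ?thesis
  proof
    assume "\<forall>\<gamma>\<in>\<Delta>. c \<gamma> \<ge> 0"
    then show ?thesis using assms by (auto simp: pos_def e)
  next
    assume "\<forall>\<gamma>\<in>\<Delta>. c \<gamma> \<le> 0"
    then have "0 \<le> - (of_int (c \<gamma>) * ((\<gamma> \<bullet> \<gamma>) / 2))" if "\<gamma> \<in> \<Delta>" for \<gamma>
      using that by (simp add: mult_nonpos_nonneg)
    then show ?thesis using assms uminus_root by (auto simp: pos_def e)
  qed
qed

lemma eq_zero_if_inner_fw: "(\<And>\<gamma>. \<gamma> \<in> \<Delta> \<Longrightarrow> x \<bullet> fw \<gamma> = 0) \<Longrightarrow> x = 0"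
  by (subst simple_expansion[of x]) simp

lemma pos_uminus: "pos \<beta> \<Longrightarrow> \<not> pos (- \<beta>)"
  using eq_zero_if_inner_fw[of \<beta>] root_nonzero[of \<beta>] by (force simp: pos_def)

lemma pos_uminus_iff: "\<beta> \<in> \<Phi> \<Longrightarrow> pos (- \<beta>) \<longleftrightarrow> \<not> pos \<beta>"
  using pos_uminus root_cases by blast

lemma simple_pos: "\<alpha> \<in> \<Delta> \<Longrightarrow> pos \<alpha>"
  by (simp add: pos_def simple_root inner_fundamental_weight)

text \<open>The reflection in \<alpha> changes only the \<alpha>-coefficient. If it made a positive
  \<beta> negative, all other coefficients of \<beta> would vanish, and the only multiples of
  \<alpha> in a reduced system are \<alpha> and -\<alpha>.\<close>

lemma reflect_pos:
  assumes "\<alpha> \<in> \<Delta>" "pos \<beta>" "\<beta> \<noteq> \<alpha>"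
  shows "pos (reflect \<alpha> \<beta>)"
proof (rule ccontr)
  assume "\<not> pos (reflect \<alpha> \<beta>)"
  moreover have b: "\<beta> \<in> \<Phi>" "reflect \<alpha> \<beta> \<in> \<Phi>"
    using assms reflect_root simple_root pos_root by auto
  ultimately have n: "pos (- reflect \<alpha> \<beta>)" using root_cases by blast
  have z: "\<beta> \<bullet> fw \<gamma> = 0" if "\<gamma> \<in> \<Delta>" "\<gamma> \<noteq> \<alpha>" for \<gamma>
  proof -
    have "reflect \<alpha> \<beta> \<bullet> fw \<gamma> = \<beta> \<bullet> fw \<gamma>"
      using that assms(1) by (auto simp: reflect_eq inner_simps inner_fundamental_weight)
    then have "\<beta> \<bullet> fw \<gamma> \<le> 0" using n that by (force simp: pos_def)
    moreover have "\<beta> \<bullet> fw \<gamma> \<ge> 0" using assms(2) that by (auto simp: pos_def)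
    ultimately show ?thesis by simp
  qed
  have "\<beta> = (\<Sum>\<gamma>\<in>\<Delta>. if \<gamma> = \<alpha> then (2 * (\<beta> \<bullet> fw \<alpha>) / (\<alpha> \<bullet> \<alpha>)) *\<^sub>R \<alpha> else 0)"
    by (rule trans[OF simple_expansion[of \<beta>]], rule sum.cong) (auto simp: z)
  then obtain c where c: "\<beta> = c *\<^sub>R \<alpha>"
    using assms(1) finite_simple by simp
  then have "c = 1 \<or> c = - 1" using root_reduced[of \<alpha> c] assms(1) simple_root b by auto
  then have "\<beta> = - \<alpha>" using c assms(3) by auto
  then show False using assms pos_uminus[of \<alpha>] simple_pos by auto
qed

lemma reflect_pos_iff:
  assumes "\<alpha> \<in> \<Delta>" "\<beta> \<in> \<Phi>" "\<beta> \<noteq> \<alpha>" "\<beta> \<noteq> - \<alpha>"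
  shows "pos (reflect \<alpha> \<beta>) \<longleftrightarrow> pos \<beta>"
proof (cases "pos \<beta>")
  case True
  then show ?thesis using assms reflect_pos by simp
next
  case False
  then have "pos (- \<beta>)" using assms pos_uminus_iff by simp
  then have "pos (reflect \<alpha> (- \<beta>))" using assms reflect_pos by (metis minus_minus)
  then have "pos (- reflect \<alpha> \<beta>)" by (simp add: linear_neg linear_reflect)
  then show ?thesis using False pos_uminus[of "- reflect \<alpha> \<beta>"] by simp
qed

lemma weyl_orthogonal: "w \<in> W \<Longrightarrow> orthogonal_transformation w"
  and weyl_linear: "w \<in> W \<Longrightarrow> linear w"
  by (simp_all add: reflection_group_orthogonal orthogonal_transformation_linear)

lemma weyl_root: "w \<in> W \<Longrightarrow> \<beta> \<in> \<Phi> \<Longrightarrow> w \<beta> \<in> \<Phi>"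
  by (induction rule: reflection_group.induct) (auto intro: reflect_root)

lemma weyl_uminus: "w \<in> W \<Longrightarrow> w (- x) = - w x"
  by (simp add: linear_neg weyl_linear)

lemma weyl_neg_iff: "w \<in> W \<Longrightarrow> \<beta> \<in> \<Phi> \<Longrightarrow> pos (w (- \<beta>)) \<longleftrightarrow> \<not> pos (w \<beta>)"
  using pos_uminus_iff[OF weyl_root] by (simp add: weyl_uminus)

lemma simple_weyl: "reflection_group \<Delta> \<subseteq> W"
  by (rule reflection_group_mono[OF simple_subset])

text \<open>The roots span, so an element is determined by the map that it induces on the finite set
  \<Phi>.\<close>

lemma finite_weyl: "finite W"
proof -
  have "inj_on (\<lambda>w. restrict w \<Phi>) W"
  proof (rule inj_onI)
    fix v w assume vw: "v \<in> W" "w \<in> W" and e: "restrict v \<Phi> = restrict w \<Phi>"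
    then have "v \<beta> = w \<beta>" if "\<beta> \<in> \<Phi>" for \<beta> using that by (metis restrict_apply')
    then show "v = w"
      using linear_eq_on_span[of v w \<Phi>] weyl_linear vw span_roots by auto
  qed
  moreover have "(\<lambda>w. restrict w \<Phi>) ` W \<subseteq> \<Phi> \<rightarrow>\<^sub>E \<Phi>" using weyl_root by auto
  ultimately show ?thesis
    using finite_imageD finite_subset finite_PiE[of \<Phi> "\<lambda>_. \<Phi>"] finite_roots by blast
qed

lemma weight_sum_pairing:
  assumes "I \<subseteq> \<Delta>" "\<beta> \<in> \<Delta>"
  shows "coroot_pairing (weight_sum \<Delta> I) \<beta> = (if \<beta> \<in> I then 1 else 0)"
proof -
  have fin: "finite I" using assms finite_simple finite_subset by blast
  have "coroot_pairing (weight_sum \<Delta> I) \<beta> = (\<Sum>\<gamma>\<in>I. if \<gamma> = \<beta> then 1 else 0)"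
    unfolding weight_sum_def coroot_pairing_sum
    by (rule sum.cong) (use assms in \<open>auto simp: fundamental_weight_pairing subset_iff\<close>)
  then show ?thesis using fin by simp
qed

text \<open>Descent on the inner product with \<rho> among the positive roots conjugate to \<beta>
  under the simple reflections: a minimal one that is not simple could be lowered by a simple
  reflection without losing positivity.\<close>

lemma root_simple_conj:
  assumes "pos \<beta>"
  shows "\<exists>w\<in>reflection_group \<Delta>. \<exists>\<alpha>\<in>\<Delta>. \<beta> = w \<alpha>"
proof -
  define \<rho> where "\<rho> = weight_sum \<Delta> \<Delta>"
  define X where "X = {\<gamma>. pos \<gamma> \<and> (\<exists>w\<in>reflection_group \<Delta>. \<gamma> = w \<beta>)}"
  have "finite X" unfolding X_def using finite_roots pos_root by (auto intro: finite_subset[of _ \<Phi>])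
  moreover have "\<beta> \<in> X" using assms reflection_group.id[of \<Delta>] by (auto simp: X_def intro!: bexI[of _ id])
  ultimately obtain \<gamma> where g: "\<gamma> \<in> X" "\<And>\<delta>. \<delta> \<in> X \<Longrightarrow> \<gamma> \<bullet> \<rho> \<le> \<delta> \<bullet> \<rho>"
    using ex_is_arg_min_if_finite[of X "\<lambda>\<gamma>. \<gamma> \<bullet> \<rho>"]
    by (auto simp: is_arg_min_linorder)
  have pg: "pos \<gamma>" using g by (simp add: X_def)
  obtain w where w: "w \<in> reflection_group \<Delta>" "\<gamma> = w \<beta>" using g by (auto simp: X_def)
  \<comment> \<open>Otherwise \<gamma>, a nonnegative combination of simple roots, would have a
    nonpositive inner product with itself.\<close>
  have "\<exists>\<alpha>\<in>\<Delta>. \<alpha> \<bullet> \<gamma> > 0"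
  proof (rule ccontr)
    assume n: "\<not> ?thesis"
    have "\<gamma> \<bullet> \<gamma> = (\<Sum>\<delta>\<in>\<Delta>. (2 * (\<gamma> \<bullet> fw \<delta>) / (\<delta> \<bullet> \<delta>)) * (\<delta> \<bullet> \<gamma>))"
      by (subst (1) simple_expansion[of \<gamma>]) (simp add: inner_sum_left)
    also have "\<dots> \<le> 0"
      by (rule sum_nonpos) (use n pg in \<open>auto simp: pos_def not_less mult_nonneg_nonpos intro!: divide_nonpos_nonneg\<close>)
    finally show False using root_nonzero[OF pos_root[OF pg]] by (metis inner_gt_zero_iff not_le)
  qed
  then obtain \<alpha> where a: "\<alpha> \<in> \<Delta>" "\<alpha> \<bullet> \<gamma> > 0" by blast
  have "\<gamma> = \<alpha>"
  proof (rule ccontr)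
    assume "\<gamma> \<noteq> \<alpha>"
    then have "pos (reflect \<alpha> \<gamma>)" using reflect_pos a pg by blast
    moreover have "reflect \<alpha> \<circ> w \<in> reflection_group \<Delta>" using w a reflection_group.step by blast
    ultimately have "reflect \<alpha> \<gamma> \<in> X" unfolding X_def using w(2) by (simp, metis comp_apply)
    then have "\<gamma> \<bullet> \<rho> \<le> reflect \<alpha> \<gamma> \<bullet> \<rho>" using g by blast
    moreover have "coroot_pairing \<rho> \<alpha> = 1" using a weight_sum_pairing[of \<Delta> \<alpha>] by (simp add: \<rho>_def)
    then have "2 * (\<alpha> \<bullet> \<rho>) = \<alpha> \<bullet> \<alpha>" using simple_nonzero[OF a(1)]
      by (auto simp: coroot_pairing_def inner_commute field_simps)
    then have "\<alpha> \<bullet> \<rho> > 0" using inner_gt_zero_iff[of \<alpha>] simple_nonzero[OF a(1)] by linarith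
    moreover have "coroot_pairing \<gamma> \<alpha> > 0" using a simple_nonzero[OF a(1)]
      by (simp add: coroot_pairing_def inner_commute)
    ultimately show False by (simp add: reflect_eq inner_simps mult_le_0_iff)
  qed
  then have "\<beta> = inv w \<alpha>" using w reflection_group_inv_comp(3) by metis
  then show ?thesis using a w reflection_group_inv by blast
qed

text \<open>A positive root has the form w \<alpha> with \<alpha> simple and w a product of simple
  reflections, and its reflection is the conjugate of s_\<alpha> by w.\<close>

lemma weyl_eq_simple: "W = reflection_group \<Delta>"
proof
  have r: "reflect \<beta> \<in> reflection_group \<Delta>" if b: "pos \<beta>" for \<beta>
  proof -
    obtain w \<alpha> where w: "w \<in> reflection_group \<Delta>" "\<alpha> \<in> \<Delta>" "\<beta> = w \<alpha>"
      using root_simple_conj[OF b] by blast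
    have "reflect \<beta> = w \<circ> reflect \<alpha> \<circ> inv w"
      using w comp_reflect[OF reflection_group_orthogonal[OF w(1)], of \<alpha>]
        reflection_group_inv_comp[OF w(1)] by (simp add: o_assoc[symmetric])
    then show ?thesis using w reflection_group_comp reflect_in reflection_group_inv by metis
  qed
  have r': "reflect \<beta> \<in> reflection_group \<Delta>" if "\<beta> \<in> \<Phi>" for \<beta>
    using root_cases[OF that] r[of \<beta>] r[of "-\<beta>"] by (auto simp: reflect_uminus)
  show "W \<subseteq> reflection_group \<Delta>"
  proof
    fix w assume "w \<in> W"
    then show "w \<in> reflection_group \<Delta>"
    proof induction
      case id
      show ?case by (rule reflection_group.id)
    next
      case (step \<alpha> w)
      then show ?case using r' reflection_group_comp by blast
    qed
  qed
qed (rule simple_weyl)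

lemma weyl_comp: "v \<in> W \<Longrightarrow> w \<in> W \<Longrightarrow> v \<circ> w \<in> W"
  and weyl_inv: "w \<in> W \<Longrightarrow> inv w \<in> W"
  and weyl_id: "id \<in> W"
  and weyl_reflect: "\<beta> \<in> \<Phi> \<Longrightarrow> reflect \<beta> \<in> W"
  by (simp_all add: reflection_group_comp reflection_group_inv reflection_group.id reflect_in)

lemma weyl_simple [intro]:
  "\<alpha> \<in> \<Delta> \<Longrightarrow> reflect \<alpha> \<in> W"
  "\<alpha> \<in> \<Delta> \<Longrightarrow> w \<in> W \<Longrightarrow> w \<circ> reflect \<alpha> \<in> W"
  "\<alpha> \<in> \<Delta> \<Longrightarrow> w \<in> W \<Longrightarrow> reflect \<alpha> \<circ> w \<in> W"
  using weyl_reflect simple_root weyl_comp by blast+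

lemma word_prod_weyl: "set \<alpha>s \<subseteq> \<Delta> \<Longrightarrow> word_prod \<alpha>s \<in> W"
  by (simp add: weyl_eq_simple word_prod_in)

section \<open>Length, the exchange condition and descents\<close>

lemma obtain_reduced:
  assumes "w \<in> W"
  obtains \<alpha>s where "set \<alpha>s \<subseteq> \<Delta>" "length \<alpha>s = len \<Delta> w" "word_prod \<alpha>s = w"
proof -
  have "w \<in> {word_prod \<alpha>s | \<alpha>s. set \<alpha>s \<subseteq> \<Delta>}"
    using assms by (simp only: weyl_eq_simple reflection_group_eq[of \<Delta>])
  then have "\<exists>n \<alpha>s. set \<alpha>s \<subseteq> \<Delta> \<and> length \<alpha>s = n \<and> word_prod \<alpha>s = w"
    by (elim CollectE exE conjE) (rule exI, rule exI, intro conjI, assumption, rule refl, rule sym)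
  from LeastI_ex[OF this] show ?thesis using that unfolding len_def by blast
qed

lemma len_le: "set \<alpha>s \<subseteq> \<Delta> \<Longrightarrow> len \<Delta> (word_prod \<alpha>s) \<le> length \<alpha>s"
  unfolding len_def by (rule Least_le) blast

lemma len_id [simp]: "len \<Delta> id = 0"
  using len_le[of "[]"] by simp

lemma len_eq_0: "w \<in> W \<Longrightarrow> len \<Delta> w = 0 \<longleftrightarrow> w = id"
  by (metis len_id length_0_conv obtain_reduced word_prod_simps(1))

text \<open>Follow \<beta> through the word from right to left. Just before the letter \<alpha> that
  makes it negative, the image must be \<alpha> itself, since a simple reflection makes no other
  positive root negative. Deleting this letter has the effect of composing with the reflection in
  \<beta>.\<close>

lemma exchange:
  assumes "set \<alpha>s \<subseteq> \<Delta>" "pos \<beta>" "\<not> pos (word_prod \<alpha>s \<beta>)"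
  shows "\<exists>\<alpha>s'. set \<alpha>s' \<subseteq> \<Delta> \<and> length \<alpha>s' < length \<alpha>s \<and> word_prod \<alpha>s' = word_prod \<alpha>s \<circ> reflect \<beta>"
  using assms
proof (induction \<alpha>s)
  case (Cons \<alpha> \<alpha>s)
  let ?u = "word_prod \<alpha>s"
  have u: "?u \<in> W" using Cons.prems word_prod_weyl by simp
  show ?case
  proof (cases "pos (?u \<beta>)")
    case False
    then obtain \<alpha>s' where "set \<alpha>s' \<subseteq> \<Delta> \<and> length \<alpha>s' < length \<alpha>s \<and> word_prod \<alpha>s' = ?u \<circ> reflect \<beta>"
      using Cons.IH Cons.prems by force
    then show ?thesis using Cons.prems
      by (intro exI[of _ "\<alpha> # \<alpha>s'"]) (simp add: o_assoc)
  next
    case True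
    then have "?u \<beta> = \<alpha>" using Cons.prems reflect_pos by auto
    then have "?u \<circ> reflect \<beta> = reflect \<alpha> \<circ> ?u" using comp_reflect[OF weyl_orthogonal[OF u]] by simp
    then have "word_prod (\<alpha> # \<alpha>s) \<circ> reflect \<beta> = ?u \<circ> reflect \<beta> \<circ> reflect \<beta>" by simp
    then have "word_prod \<alpha>s = word_prod (\<alpha> # \<alpha>s) \<circ> reflect \<beta>"
      by (simp only: reflect_comp_self)
    then show ?thesis using Cons.prems by (metis insert_subset length_Cons lessI list.simps(15))
  qed
qed simp

lemma len_reflect_less:
  assumes "w \<in> W" "pos \<beta>" "\<not> pos (w \<beta>)"
  shows "len \<Delta> (w \<circ> reflect \<beta>) < len \<Delta> w"
proof -
  obtain \<alpha>s where "set \<alpha>s \<subseteq> \<Delta>" "length \<alpha>s = len \<Delta> w" "word_prod \<alpha>s = w"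
    using obtain_reduced[OF assms(1)] .
  with exchange[of \<alpha>s \<beta>] assms len_le show ?thesis by (metis le_less_trans)
qed

lemma len_reflect_greater:
  assumes "w \<in> W" "pos \<beta>" "pos (w \<beta>)"
  shows "len \<Delta> w < len \<Delta> (w \<circ> reflect \<beta>)"
proof -
  have "(w \<circ> reflect \<beta>) \<beta> = w (- \<beta>)" using assms root_nonzero[of \<beta>] pos_root by (auto simp: reflect_self)
  then have "\<not> pos ((w \<circ> reflect \<beta>) \<beta>)"
    using weyl_neg_iff[of w \<beta>] assms pos_root by simp
  moreover have "w \<circ> reflect \<beta> \<in> W" using assms weyl_comp weyl_reflect pos_root by blast
  ultimately show ?thesis using len_reflect_less[of "w \<circ> reflect \<beta>" \<beta>] assms by simp
qed

lemma len_reflect_iff: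
  "w \<in> W \<Longrightarrow> pos \<beta> \<Longrightarrow> len \<Delta> w < len \<Delta> (w \<circ> reflect \<beta>) \<longleftrightarrow> pos (w \<beta>)"
  using len_reflect_greater len_reflect_less by (metis less_asym)

lemma len_right_iff:
  "w \<in> W \<Longrightarrow> \<alpha> \<in> \<Delta> \<Longrightarrow> len \<Delta> w < len \<Delta> (w \<circ> reflect \<alpha>) \<longleftrightarrow> pos (w \<alpha>)"
  by (rule len_reflect_iff) (auto simp: simple_pos)

lemma reflect_comp:
  assumes "w \<in> W"
  shows "reflect \<alpha> \<circ> w = w \<circ> reflect (inv w \<alpha>)"
  using comp_reflect[OF weyl_orthogonal[OF assms], of "inv w \<alpha>"] reflection_group_inv_comp(4)[OF assms]
  by simp

lemma len_left_iff:
  assumes "w \<in> W" "\<alpha> \<in> \<Delta>"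
  shows "len \<Delta> w < len \<Delta> (reflect \<alpha> \<circ> w) \<longleftrightarrow> pos (inv w \<alpha>)"
proof -
  have r: "inv w \<alpha> \<in> \<Phi>" using assms weyl_inv weyl_root simple_root by blast
  have c: "w (inv w \<alpha>) = \<alpha>" using reflection_group_inv_comp(4)[OF assms(1)] .
  show ?thesis
  proof (cases "pos (inv w \<alpha>)")
    case True
    then show ?thesis using len_reflect_iff[OF assms(1) True] c assms simple_pos
      by (simp add: reflect_comp)
  next
    case False
    then have "pos (- inv w \<alpha>)" using r pos_uminus_iff by simp
    then show ?thesis using len_reflect_iff[OF assms(1), of "- inv w \<alpha>"] c assms simple_pos pos_uminus False
      by (simp add: reflect_comp reflect_uminus weyl_uminus)
  qed
qed

lemma len_right_le: assumes "w \<in> W" "\<alpha> \<in> \<Delta>" shows "len \<Delta> (w \<circ> reflect \<alpha>) \<le> len \<Delta> w + 1"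
proof -
  obtain \<alpha>s where "set \<alpha>s \<subseteq> \<Delta>" "length \<alpha>s = len \<Delta> w" "word_prod \<alpha>s = w"
    using obtain_reduced[OF assms(1)] .
  then show ?thesis using len_le[of "\<alpha>s @ [\<alpha>]"] assms by (auto simp: word_prod_append)
qed

lemma len_left_le: assumes "w \<in> W" "\<alpha> \<in> \<Delta>" shows "len \<Delta> (reflect \<alpha> \<circ> w) \<le> len \<Delta> w + 1"
proof -
  obtain \<alpha>s where "set \<alpha>s \<subseteq> \<Delta>" "length \<alpha>s = len \<Delta> w" "word_prod \<alpha>s = w"
    using obtain_reduced[OF assms(1)] .
  then show ?thesis using len_le[of "\<alpha> # \<alpha>s"] assms by auto
qed

text \<open>One letter changes the length by at most one, and the sign of w \<alpha> decides
  strictly between longer and shorter, which excludes equality.\<close>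

lemma len_right_cases:
  assumes "w \<in> W" "\<alpha> \<in> \<Delta>"
  shows "len \<Delta> (w \<circ> reflect \<alpha>) = len \<Delta> w + 1 \<or> len \<Delta> w = len \<Delta> (w \<circ> reflect \<alpha>) + 1"
proof -
  have "len \<Delta> (w \<circ> reflect \<alpha>) \<noteq> len \<Delta> w"
    using len_right_iff[OF assms] len_reflect_less[OF assms(1) simple_pos[OF assms(2)]] by force
  moreover have "len \<Delta> w \<le> len \<Delta> (w \<circ> reflect \<alpha>) + 1"
    using len_right_le[of "w \<circ> reflect \<alpha>" \<alpha>] assms by auto
  ultimately show ?thesis using len_right_le[OF assms] by linarith
qed

lemma len_left_cases:
  assumes "w \<in> W" "\<alpha> \<in> \<Delta>"
  shows "len \<Delta> (reflect \<alpha> \<circ> w) = len \<Delta> w + 1 \<or> len \<Delta> w = len \<Delta> (reflect \<alpha> \<circ> w) + 1"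
proof -
  let ?v = "reflect \<alpha> \<circ> w"
  have v: "?v \<in> W" using assms by auto
  \<comment> \<open>The root that decides the left ascent changes sign from w to s_\<alpha> w, so
    exactly one of the two has an ascent at \<alpha>.\<close>
  have "inv ?v \<alpha> = inv w (- \<alpha>)"
    using assms v reflection_group_inv_comp[OF assms(1)] reflection_group_inv_comp(3)[OF v, of "inv w (- \<alpha>)"]
      reflect_self[OF simple_nonzero] by (simp add: linear_neg linear_reflect)
  then have "pos (inv ?v \<alpha>) \<longleftrightarrow> \<not> pos (inv w \<alpha>)"
    using weyl_neg_iff[OF weyl_inv[OF assms(1)] simple_root[OF assms(2)]] by simp
  then have "len \<Delta> ?v \<noteq> len \<Delta> w"
    using len_left_iff[OF assms] len_left_iff[OF v assms(2)] by auto
  moreover have "len \<Delta> w \<le> len \<Delta> ?v + 1"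
    using len_left_le[OF v assms(2)] by simp
  ultimately show ?thesis using len_left_le[OF assms] by linarith
qed

lemma exists_right_descent:
  assumes "w \<in> W" "w \<noteq> id"
  obtains u \<alpha> where "\<alpha> \<in> \<Delta>" "u \<in> W" "w = u \<circ> reflect \<alpha>" "len \<Delta> w = len \<Delta> u + 1"
proof -
  obtain \<alpha>s where a: "set \<alpha>s \<subseteq> \<Delta>" "length \<alpha>s = len \<Delta> w" "word_prod \<alpha>s = w"
    using obtain_reduced[OF assms(1)] .
  then obtain \<beta>s \<alpha> where b: "\<alpha>s = \<beta>s @ [\<alpha>]" using assms(2) by (cases \<alpha>s rule: rev_cases) auto
  let ?u = "word_prod \<beta>s"
  have w: "w = ?u \<circ> reflect \<alpha>" using a b by (simp add: word_prod_append)
  have "\<alpha> \<in> \<Delta>" "set \<beta>s \<subseteq> \<Delta>" using a b by auto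
  moreover from this have "?u \<in> W" using word_prod_weyl by blast
  moreover have "len \<Delta> ?u < len \<Delta> w" using len_le[of \<beta>s] a b by auto
  ultimately show ?thesis using that w len_right_cases[of ?u \<alpha>] by simp
qed

section \<open>The Bruhat order and its lifting property\<close>

lemma bruhat_weyl: "bruhat_le \<Phi> \<Delta> y w \<Longrightarrow> y \<in> W \<and> w \<in> W"
  by (simp add: bruhat_le_def)

lemma bruhat_refl: "w \<in> W \<Longrightarrow> bruhat_le \<Phi> \<Delta> w w"
  by (simp add: bruhat_le_def)

lemma bruhat_trans: "bruhat_le \<Phi> \<Delta> x y \<Longrightarrow> bruhat_le \<Phi> \<Delta> y z \<Longrightarrow> bruhat_le \<Phi> \<Delta> x z"
  unfolding bruhat_le_def by (meson rtrancl_trans)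

lemma bruhat_step:
  assumes "u \<in> W" "\<beta> \<in> \<Phi>" "len \<Delta> u < len \<Delta> (u \<circ> reflect \<beta>)"
  shows "bruhat_le \<Phi> \<Delta> u (u \<circ> reflect \<beta>)"
  unfolding bruhat_le_def using assms weyl_comp weyl_reflect by (auto intro!: r_into_rtrancl)

text \<open>A root and its negative give the same reflection, so each generating step can be taken
  with \<beta> positive. The increase of length then becomes positivity of u \<beta>, the form in
  which steps are conjugated later.\<close>

lemma bruhat_induct [consumes 1, case_names refl step]:
  assumes "bruhat_le \<Phi> \<Delta> y w"
    and "y \<in> W \<Longrightarrow> P y"
    and "\<And>u \<beta>. bruhat_le \<Phi> \<Delta> y u \<Longrightarrow> P u \<Longrightarrow> u \<in> W \<Longrightarrow> pos \<beta> \<Longrightarrow> pos (u \<beta>) \<Longrightarrow> P (u \<circ> reflect \<beta>)"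
  shows "P w"
proof -
  have y: "y \<in> W" using assms(1) bruhat_weyl by blast
  have "(y, w) \<in> {(u, u \<circ> reflect \<beta>) | u \<beta>.
                 u \<in> W \<and> \<beta> \<in> \<Phi> \<and> len \<Delta> u < len \<Delta> (u \<circ> reflect \<beta>)}\<^sup>*"
    using assms(1) by (simp add: bruhat_le_def)
  then have "P w \<and> bruhat_le \<Phi> \<Delta> y w"
  proof (induction rule: rtrancl_induct)
    case base
    then show ?case using y assms(2) bruhat_refl by blast
  next
    case (step u v)
    then obtain \<beta> where b: "u \<in> W" "v = u \<circ> reflect \<beta>" "\<beta> \<in> \<Phi>" "len \<Delta> u < len \<Delta> v" by blast
    obtain \<gamma> where g: "pos \<gamma>" "v = u \<circ> reflect \<gamma>"
      using root_cases[OF b(3)] b(2) reflect_uminus by metis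
    then have "pos (u \<gamma>)" using len_reflect_iff b by blast
    then have "P v" using assms(3)[of u \<gamma>] step.IH g b(1) by simp
    moreover have "bruhat_le \<Phi> \<Delta> u v" using bruhat_step b by simp
    ultimately show ?case using step.IH bruhat_trans by metis
  qed
  then show ?thesis by blast
qed

lemma bruhat_len: "bruhat_le \<Phi> \<Delta> y w \<Longrightarrow> y = w \<or> len \<Delta> y < len \<Delta> w"
proof (induction rule: bruhat_induct)
  case (step u \<beta>)
  then have "len \<Delta> u < len \<Delta> (u \<circ> reflect \<beta>)" using len_reflect_iff by blast
  then show ?case using step.IH by (metis less_trans)
qed simp

lemma bruhat_simple_up:
  assumes "u \<in> W" "\<alpha> \<in> \<Delta>" "len \<Delta> u < len \<Delta> (u \<circ> reflect \<alpha>)"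
  shows "bruhat_le \<Phi> \<Delta> u (u \<circ> reflect \<alpha>)"
  using bruhat_step assms simple_root by blast

text \<open>Induction along a chain from y to w. A step by the reflection in \<alpha> itself swaps
  the two alternatives. Any other step from u to u s_\<beta> remains a step after right
  multiplication by s_\<alpha>, now for the positive root s_\<alpha> \<beta>.\<close>

lemma bruhat_lift:
  assumes "bruhat_le \<Phi> \<Delta> y w" "\<alpha> \<in> \<Delta>"
  shows "bruhat_le \<Phi> \<Delta> (y \<circ> reflect \<alpha>) w \<or> bruhat_le \<Phi> \<Delta> (y \<circ> reflect \<alpha>) (w \<circ> reflect \<alpha>)"
  using assms(1)
proof (induction rule: bruhat_induct)
  case refl
  then show ?case using bruhat_refl assms by blast
next
  case (step u \<beta>)
  have up: "bruhat_le \<Phi> \<Delta> u (u \<circ> reflect \<beta>)"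
    using step bruhat_step len_reflect_iff pos_root by blast
  show ?case
  proof (cases "\<beta> = \<alpha>")
    case True
    then show ?thesis using step up bruhat_trans by fastforce
  next
    case False
    let ?v = "u \<circ> reflect \<alpha>" and ?\<gamma> = "reflect \<alpha> \<beta>"
    have g: "pos ?\<gamma>" using reflect_pos assms step False by blast
    have v: "?v \<in> W" using step assms by blast
    have "?v \<circ> reflect ?\<gamma> = u \<circ> reflect \<beta> \<circ> reflect \<alpha>"
      using comp_reflect[OF orthogonal_reflect, of \<alpha> ?\<gamma>] by (simp add: o_assoc[symmetric])
    moreover have "pos (?v ?\<gamma>)" using step by simp
    ultimately have "bruhat_le \<Phi> \<Delta> ?v (u \<circ> reflect \<beta> \<circ> reflect \<alpha>)"
      using bruhat_step[OF v, of ?\<gamma>] len_reflect_iff[OF v g] pos_root[OF g] by simp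
    then show ?thesis using step.IH up bruhat_trans by blast
  qed
qed

lemma bruhat_lift_up:
  assumes "bruhat_le \<Phi> \<Delta> y u" "\<alpha> \<in> \<Delta>" "len \<Delta> u < len \<Delta> (u \<circ> reflect \<alpha>)"
  shows "bruhat_le \<Phi> \<Delta> (y \<circ> reflect \<alpha>) (u \<circ> reflect \<alpha>)"
  using bruhat_lift[OF assms(1,2)] bruhat_simple_up[of u \<alpha>] assms bruhat_trans bruhat_weyl by blast

lemma bruhat_id: "bruhat_le \<Phi> \<Delta> y id \<longleftrightarrow> y = id"
  using bruhat_len[of y id] bruhat_refl[OF weyl_id] by auto

end

section \<open>Laurent polynomials\<close>

lemma lookup_single_times:
  fixes k m :: "'a::ab_group_add" and f :: "'a \<Rightarrow>\<^sub>0 'b::comm_ring_1"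
  shows "Poly_Mapping.lookup (Poly_Mapping.single k c * f) m = c * Poly_Mapping.lookup f (m - k)"
proof -
  have "(m = k + q) = (m - k = q)" for q by auto
  then show ?thesis
    by (simp add: lookup_mult lookup_single when_mult)
qed

lemma lookup_laurent_bar: "Poly_Mapping.lookup (laurent_bar a) k = Poly_Mapping.lookup a (- k)"
  by (simp add: laurent_bar_def map_key.rep_eq)

lemma laurent_bar_add: "laurent_bar (a + b) = laurent_bar a + laurent_bar b"
  and laurent_bar_diff: "laurent_bar (a - b) = laurent_bar a - laurent_bar b"
  and laurent_bar_0: "laurent_bar 0 = 0"
  by (simp_all add: poly_mapping_eq_iff fun_eq_iff lookup_laurent_bar lookup_add lookup_minus)

lemma laurent_bar_sum: "laurent_bar (\<Sum>i\<in>I. f i) = (\<Sum>i\<in>I. laurent_bar (f i))"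
  by (simp add: poly_mapping_eq_iff fun_eq_iff lookup_laurent_bar lookup_sum)

lemma laurent_bar_single: "laurent_bar (Poly_Mapping.single k c * a) = Poly_Mapping.single (- k) c * laurent_bar a"
proof (rule poly_mapping_eqI)
  fix m
  have "- m - k = - (m + k)" by simp
  then show "Poly_Mapping.lookup (laurent_bar (Poly_Mapping.single k c * a)) m
      = Poly_Mapping.lookup (Poly_Mapping.single (- k) c * laurent_bar a) m"
    by (simp add: lookup_laurent_bar lookup_single_times)
qed

lemma vpow_mult: "vpow m * vpow n = vpow (m + n)"
  by (simp add: vpow_def mult_single)

lemma vpow_0: "vpow 0 = 1"
  by (simp add: vpow_def)

lemma laurent_bar_vpow: "laurent_bar (vpow n * a) = vpow (- n) * laurent_bar a"
  by (simp add: vpow_def laurent_bar_single)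

lemma of_int_laurent: "(of_int c :: laurent) = Poly_Mapping.single 0 c"
  by (subst single_of_int[symmetric]) (simp only: of_int_eq_id id_apply)

lemma laurent_bar_of_int: "laurent_bar (of_int c * a) = of_int c * laurent_bar a"
  using laurent_bar_single[of 0 c a] by (simp add: of_int_laurent)

lemma lookup_vpow_times: "Poly_Mapping.lookup (vpow n * a) k = Poly_Mapping.lookup a (k - n)"
  by (simp add: vpow_def lookup_single_times)

lemma lookup_of_int_times: "Poly_Mapping.lookup (of_int c * (a::laurent)) k = c * Poly_Mapping.lookup a k"
  by (simp add: of_int_laurent lookup_single_times)

abbreviation qinv :: laurent where "qinv \<equiv> vpow (- 2)"

lemma qinv_qv: "qinv * qv = 1" "qv * qinv = 1"
  by (simp_all add: qv_def vpow_mult vpow_0)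

lemma qinv_qv_cancel: "qinv * (qv * a) = a" "qv * (qinv * a) = a"
    "qv * (a * qinv) = a" "qinv * (a * qv) = a"
proof -
  show "qinv * (qv * a) = a" "qv * (qinv * a) = a"
    by (simp_all add: mult.assoc[symmetric] qinv_qv)
  then show "qv * (a * qinv) = a" "qinv * (a * qv) = a"
    by (simp_all only: mult.commute[of a])
qed

text \<open>The inner part of \<open>hecke_kl_element\<close>, named so that its coefficients can be
  computed: since q = v^2, only even nonnegative exponents occur, and degree bounds become bounds on
  Laurent exponents.\<close>

definition poly_q :: "int poly \<Rightarrow> laurent" where
  "poly_q p = poly (map_poly of_int p) qv"

lemma lookup_poly_q:
  "Poly_Mapping.lookup (poly_q p) k = (if 0 \<le> k \<and> even k then coeff p (nat (k div 2)) else 0)"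
proof (induction p arbitrary: k)
  case 0
  then show ?case by (simp add: poly_q_def)
next
  case (pCons a p)
  have e: "poly_q (pCons a p) = of_int a + qv * poly_q p"
    by (simp add: poly_q_def map_poly_pCons)
  have n: "nat (k div 2) = Suc (nat ((k - 2) div 2))" if "2 \<le> k" using that by linarith
  have "k = 0 \<or> k = 1 \<or> k < 0 \<or> 2 \<le> k" by linarith
  then show ?case
    using n by (auto simp: e lookup_add lookup_of_int qv_def lookup_vpow_times pCons.IH)
qed

lemma poly_q_eqD: assumes "poly_q p = poly_q r" shows "p = r"
proof (rule poly_eqI)
  fix n
  have "Poly_Mapping.lookup (poly_q p) (2 * int n) = Poly_Mapping.lookup (poly_q r) (2 * int n)"
    using assms by simp
  then show "coeff p n = coeff r n" by (simp add: lookup_poly_q)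
qed

lemma poly_q_add: "poly_q (p + r) = poly_q p + poly_q r"
  and poly_q_diff: "poly_q (p - r) = poly_q p - poly_q r"
  and poly_q_smult: "poly_q (smult c p) = of_int c * poly_q p"
  and poly_q_0: "poly_q 0 = 0"
  by (auto intro!: poly_mapping_eqI
      simp: lookup_poly_q lookup_add lookup_minus lookup_of_int_times lookup_one when_def)

lemma poly_q_1: "poly_q 1 = 1"
  by (simp add: poly_q_def one_pCons map_poly_pCons)

lemma poly_q_sum: "poly_q (\<Sum>i\<in>I. f i) = (\<Sum>i\<in>I. poly_q (f i))"
  by (auto intro!: poly_mapping_eqI simp: lookup_poly_q lookup_sum coeff_sum)

lemma poly_q_monom: "poly_q (monom 1 m * p) = vpow (2 * int m) * poly_q p"
proof (rule poly_mapping_eqI)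
  fix k :: int
  show "Poly_Mapping.lookup (poly_q (monom 1 m * p)) k
      = Poly_Mapping.lookup (vpow (2 * int m) * poly_q p) k"
  proof (cases "even k")
    case True
    then obtain j where k: "k = 2 * j" by (elim evenE)
    have "k - 2 * int m = 2 * (j - int m)" using k by simp
    then have "Poly_Mapping.lookup (vpow (2 * int m) * poly_q p) k
      = (if 0 \<le> j - int m then coeff p (nat (j - int m)) else 0)"
      by (simp only: lookup_vpow_times lookup_poly_q) simp
    moreover have "nat (j - int m) = nat j - m" "0 \<le> j - int m \<longleftrightarrow> 0 \<le> j \<and> m \<le> nat j" by linarith+
    ultimately show ?thesis by (simp add: lookup_poly_q coeff_monom_mult k)
  next
    case False
    then show ?thesis by (simp add: lookup_vpow_times lookup_poly_q)
  qed
qed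

section \<open>The Hecke algebra and its bar involution\<close>

context based_root_system begin

section \<open>Left and right multiplication by the generators commute\<close>

lemma len_left_not_less:
  "x \<in> W \<Longrightarrow> \<alpha> \<in> \<Delta> \<Longrightarrow> len \<Delta> (reflect \<alpha> \<circ> x) < len \<Delta> x \<longleftrightarrow> \<not> len \<Delta> x < len \<Delta> (reflect \<alpha> \<circ> x)"
  using len_left_cases[of x \<alpha>] by linarith

lemma len_right_not_less:
  "x \<in> W \<Longrightarrow> \<alpha> \<in> \<Delta> \<Longrightarrow> len \<Delta> (x \<circ> reflect \<alpha>) < len \<Delta> x \<longleftrightarrow> \<not> len \<Delta> x < len \<Delta> (x \<circ> reflect \<alpha>)"
  using len_right_cases[of x \<alpha>] by linarith

lemma reflect_comp_eq_iff: "reflect \<alpha> \<circ> x = y \<longleftrightarrow> x = reflect \<alpha> \<circ> y"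
  "x \<circ> reflect \<alpha> = y \<longleftrightarrow> x = y \<circ> reflect \<alpha>"
  by (metis reflect_comp_self(2), metis reflect_comp_self(3))

text \<open>The definition runs over the basis elements that are multiplied; collecting what arrives
  at a fixed x leaves the sources w = x and w = s x.\<close>

lemma T_simple_mult_apply:
  assumes "\<alpha> \<in> \<Delta>" "x \<in> W"
  shows "T_simple_mult \<Phi> \<Delta> \<alpha> h x =
    (if len \<Delta> x < len \<Delta> (reflect \<alpha> \<circ> x) then qv * h (reflect \<alpha> \<circ> x)
     else h (reflect \<alpha> \<circ> x) + (qv - 1) * h x)"
proof -
  let ?s = "reflect \<alpha>"
  have sx: "?s \<circ> x \<in> W" using assms by blast
  have gen: "c * (if A then (if B then 1 else 0) else (qv - 1) * (if C then 1 else 0) + qv * (if B then 1 else 0))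
    = (if B then c * (if A then 1 else qv) else 0) + (if C then c * (if A then 0 else qv - 1) else 0)"
    for A B C and c :: laurent by (simp add: algebra_simps)
  have "T_simple_mult \<Phi> \<Delta> \<alpha> h x =
    (\<Sum>w\<in>W. (if w = ?s \<circ> x then h w * (if len \<Delta> w < len \<Delta> (?s \<circ> w) then 1 else qv) else 0)
          + (if w = x then h w * (if len \<Delta> w < len \<Delta> (?s \<circ> w) then 0 else qv - 1) else 0))"
    unfolding T_simple_mult_def
  proof (rule sum.cong[OF refl])
    fix w
    have "x = ?s \<circ> w \<longleftrightarrow> w = ?s \<circ> x" using reflect_comp_eq_iff(1)[of \<alpha> w x] by metis
    then have t: "Tb (?s \<circ> w) x = (if w = ?s \<circ> x then 1 else 0)" by (simp only: Tb_def)
    have t': "Tb w x = (if w = x then 1 else 0)" by (simp add: Tb_def eq_commute)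
    show "h w * (if len \<Delta> w < len \<Delta> (?s \<circ> w) then Tb (?s \<circ> w) x
            else (qv - 1) * Tb w x + qv * Tb (?s \<circ> w) x) =
      (if w = ?s \<circ> x then h w * (if len \<Delta> w < len \<Delta> (?s \<circ> w) then 1 else qv) else 0)
          + (if w = x then h w * (if len \<Delta> w < len \<Delta> (?s \<circ> w) then 0 else qv - 1) else 0)"
      unfolding t t' by (rule gen)
  qed
  also have "\<dots> = h (?s \<circ> x) * (if len \<Delta> (?s \<circ> x) < len \<Delta> x then 1 else qv)
     + h x * (if len \<Delta> x < len \<Delta> (?s \<circ> x) then 0 else qv - 1)"
    using sx assms(2) finite_weyl by (simp only: sum.distrib sum.delta reflect_comp_self if_True)
  also have "\<dots> = (if len \<Delta> x < len \<Delta> (?s \<circ> x) then qv * h (?s \<circ> x)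
     else h (?s \<circ> x) + (qv - 1) * h x)"
    using len_left_not_less[OF assms(2,1)] by (simp add: mult.commute)
  finally show ?thesis .
qed

lemma T_simple_mult_outside:
  assumes "\<alpha> \<in> \<Delta>" "x \<notin> W" shows "T_simple_mult \<Phi> \<Delta> \<alpha> h x = 0"
  unfolding T_simple_mult_def
proof (rule sum.neutral, rule ballI)
  fix w assume w: "w \<in> W"
  then have "reflect \<alpha> \<circ> w \<in> W" using assms by blast
  then have "x \<noteq> w" "x \<noteq> reflect \<alpha> \<circ> w" using assms w by metis+
  then show "h w * (if len \<Delta> w < len \<Delta> (reflect \<alpha> \<circ> w) then Tb (reflect \<alpha> \<circ> w) x
     else (qv - 1) * Tb w x + qv * Tb (reflect \<alpha> \<circ> w) x) = 0"
    by (simp only: Tb_def if_False mult_zero_right add_0_left if_cancel)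
qed

text \<open>The product h T_s, given by coefficients rather than through \<open>hecke_mult\<close>,
  which is assembled from left multiplications along a chosen word. Commutation of the two sides is
  the form in which associativity is used.\<close>

definition T_right_mult :: "'a \<Rightarrow> 'a hecke \<Rightarrow> 'a hecke" where
  "T_right_mult \<alpha> h = (\<lambda>x. if x \<in> W then
     if len \<Delta> x < len \<Delta> (x \<circ> reflect \<alpha>) then qv * h (x \<circ> reflect \<alpha>)
     else h (x \<circ> reflect \<alpha>) + (qv - 1) * h x else 0)"

abbreviation HC :: "'a hecke set" where "HC \<equiv> hecke_carrier \<Phi>"

lemma HC_iff: "h \<in> HC \<longleftrightarrow> (\<forall>w. w \<notin> W \<longrightarrow> h w = 0)"
  by (simp add: hecke_carrier_def)

lemma HC_eqI: "h \<in> HC \<Longrightarrow> k \<in> HC \<Longrightarrow> (\<And>x. x \<in> W \<Longrightarrow> h x = k x) \<Longrightarrow> h = k"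
  unfolding HC_iff by (rule ext) metis

lemma T_simple_mult_HC: "\<alpha> \<in> \<Delta> \<Longrightarrow> T_simple_mult \<Phi> \<Delta> \<alpha> h \<in> HC"
  by (simp add: HC_iff T_simple_mult_outside)

lemma T_right_mult_HC: "T_right_mult \<alpha> h \<in> HC"
  by (simp add: HC_iff T_right_mult_def)

text \<open>By the last hypothesis x^{-1} \<alpha> is neither \<beta> nor -\<beta>, so the
  reflection in \<beta> keeps its sign, and with it the left ascent condition at \<alpha>. The same
  holds for x \<beta> and the right ascent condition.\<close>

lemma left_right_length:
  assumes "x \<in> W" "\<alpha> \<in> \<Delta>" "\<beta> \<in> \<Delta>" "reflect \<alpha> \<circ> x \<noteq> x \<circ> reflect \<beta>"
  shows "len \<Delta> (x \<circ> reflect \<beta>) < len \<Delta> (reflect \<alpha> \<circ> (x \<circ> reflect \<beta>)) \<longleftrightarrow> len \<Delta> x < len \<Delta> (reflect \<alpha> \<circ> x)"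
    and "len \<Delta> (reflect \<alpha> \<circ> x) < len \<Delta> (reflect \<alpha> \<circ> x \<circ> reflect \<beta>) \<longleftrightarrow> len \<Delta> x < len \<Delta> (x \<circ> reflect \<beta>)"
proof -
  let ?g = "inv x \<alpha>"
  have g: "?g \<in> \<Phi>" using assms weyl_inv weyl_root simple_root by blast
  have xs: "x \<circ> reflect \<beta> \<in> W" "reflect \<alpha> \<circ> x \<in> W" using assms by blast+
  have xg: "x ?g = \<alpha>" using reflection_group_inv_comp(4)[OF assms(1)] .
  have r: "reflect \<alpha> \<circ> x = x \<circ> reflect ?g" by (rule reflect_comp[OF assms(1)])
  have ne: "?g \<noteq> \<beta>" "?g \<noteq> - \<beta>" using assms(4) r reflect_uminus by metis+
  have "(x \<circ> reflect \<beta>) (reflect \<beta> ?g) = \<alpha>" using xg by simp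
  then have "inv (x \<circ> reflect \<beta>) \<alpha> = reflect \<beta> ?g"
    using reflection_group_inv_comp(3)[OF xs(1)] by metis
  then show "len \<Delta> (x \<circ> reflect \<beta>) < len \<Delta> (reflect \<alpha> \<circ> (x \<circ> reflect \<beta>)) \<longleftrightarrow> len \<Delta> x < len \<Delta> (reflect \<alpha> \<circ> x)"
    using len_left_iff[OF assms(1,2)] len_left_iff[OF xs(1) assms(2)] reflect_pos_iff[OF assms(3) g ne] by simp
  have xb: "x \<beta> \<in> \<Phi>" using assms weyl_root simple_root by blast
  have "inv x (x \<beta>) = \<beta>" using reflection_group_inv_comp(3)[OF assms(1)] .
  then have "x \<beta> \<noteq> \<alpha>" "x \<beta> \<noteq> - \<alpha>" using ne weyl_uminus[OF weyl_inv[OF assms(1)], of \<alpha>] by auto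
  then show "len \<Delta> (reflect \<alpha> \<circ> x) < len \<Delta> (reflect \<alpha> \<circ> x \<circ> reflect \<beta>) \<longleftrightarrow> len \<Delta> x < len \<Delta> (x \<circ> reflect \<beta>)"
    using len_right_iff[OF assms(1,3)] len_right_iff[OF xs(2) assms(3)] reflect_pos_iff[OF assms(2) xb] by simp
qed

text \<open>Let s and t be the two reflections. If s x = x t, only the coefficients at x and s x
  occur, and left and right ascents coincide. Otherwise both sides combine the coefficients at x, s
  x, x t and s x t, and by \<open>left_right_length\<close> the conditions are those at x.\<close>

lemma left_right_commute:
  assumes "\<alpha> \<in> \<Delta>" "\<beta> \<in> \<Delta>"
  shows "T_simple_mult \<Phi> \<Delta> \<alpha> (T_right_mult \<beta> h) = T_right_mult \<beta> (T_simple_mult \<Phi> \<Delta> \<alpha> h)"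
proof (rule HC_eqI[OF T_simple_mult_HC[OF assms(1)] T_right_mult_HC])
  fix x assume x: "x \<in> W"
  let ?a = "reflect \<alpha>" and ?b = "reflect \<beta>"
  have xs: "?a \<circ> x \<in> W" "x \<circ> ?b \<in> W" using x assms by blast+
  note L = T_simple_mult_apply[OF assms(1)]
  note R = T_right_mult_def
  show "T_simple_mult \<Phi> \<Delta> \<alpha> (T_right_mult \<beta> h) x = T_right_mult \<beta> (T_simple_mult \<Phi> \<Delta> \<alpha> h) x"
  proof (cases "?a \<circ> x = x \<circ> ?b")
    case True
    define y where "y = x \<circ> ?b"
    have e: "?a \<circ> x = y" "x \<circ> ?b = y" "?a \<circ> y = x" "y \<circ> ?b = x"
      using True unfolding y_def by (simp, simp, metis reflect_comp_self(2), metis reflect_comp_self(3))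
    have y: "y \<in> W" using xs(2) by (simp only: y_def)
    have "len \<Delta> y < len \<Delta> x \<longleftrightarrow> \<not> len \<Delta> x < len \<Delta> y"
      using len_right_not_less[OF x assms(2)] e by metis
    then show ?thesis
      by (simp only: L[OF x] L[OF y] R e x y if_True; simp add: algebra_simps)
  next
    case False
    note l = left_right_length[OF x assms False]
    define z where "z = ?a \<circ> x \<circ> ?b"
    have e: "?a \<circ> (x \<circ> ?b) = z" "?a \<circ> x \<circ> ?b = z" by (simp_all only: z_def o_assoc)
    show ?thesis
      using l unfolding e
      by (simp only: L[OF x] L[OF xs(2)] R x xs if_True e; simp add: algebra_simps)
  qed
qed

lemma Tb_HC: "w \<in> W \<Longrightarrow> Tb w \<in> HC"
  by (auto simp: HC_iff Tb_def)

lemma T_simple_mult_Tb: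
  assumes "\<alpha> \<in> \<Delta>" "u \<in> W" "len \<Delta> u < len \<Delta> (reflect \<alpha> \<circ> u)"
  shows "T_simple_mult \<Phi> \<Delta> \<alpha> (Tb u) = Tb (reflect \<alpha> \<circ> u)"
proof (rule HC_eqI)
  have su: "reflect \<alpha> \<circ> u \<in> W" using assms by blast
  show "Tb (reflect \<alpha> \<circ> u) \<in> HC" using su by (rule Tb_HC)
  fix x assume x: "x \<in> W"
  have "reflect \<alpha> \<circ> x = u \<longleftrightarrow> x = reflect \<alpha> \<circ> u" by (rule reflect_comp_eq_iff)
  moreover have "x = u \<Longrightarrow> x = reflect \<alpha> \<circ> u \<Longrightarrow> False" using assms(3) by (metis less_irrefl)
  moreover have "len \<Delta> x < len \<Delta> (reflect \<alpha> \<circ> x) \<Longrightarrow> x = reflect \<alpha> \<circ> u \<Longrightarrow> False"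
    using assms(3) by (metis reflect_comp_self(2) less_asym)
  moreover have "\<not> len \<Delta> x < len \<Delta> (reflect \<alpha> \<circ> x) \<Longrightarrow> x = u \<Longrightarrow> False"
    using assms(3) by metis
  ultimately show "T_simple_mult \<Phi> \<Delta> \<alpha> (Tb u) x = Tb (reflect \<alpha> \<circ> u) x"
    unfolding T_simple_mult_apply[OF assms(1) x] Tb_def
    by (cases "x = u"; cases "x = reflect \<alpha> \<circ> u"; simp only: if_True if_False if_cancel
      mult_zero_right mult_1_right add_0_left add_0_right split: if_split) blast+
qed (rule T_simple_mult_HC[OF assms(1)])

lemma T_right_mult_Tb:
  assumes "\<alpha> \<in> \<Delta>" "u \<in> W" "len \<Delta> u < len \<Delta> (u \<circ> reflect \<alpha>)"
  shows "T_right_mult \<alpha> (Tb u) = Tb (u \<circ> reflect \<alpha>)"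
proof (rule HC_eqI)
  have su: "u \<circ> reflect \<alpha> \<in> W" using assms by blast
  show "Tb (u \<circ> reflect \<alpha>) \<in> HC" using su by (rule Tb_HC)
  fix x assume x: "x \<in> W"
  have "x \<circ> reflect \<alpha> = u \<longleftrightarrow> x = u \<circ> reflect \<alpha>" by (rule reflect_comp_eq_iff)
  moreover have "x = u \<Longrightarrow> x = u \<circ> reflect \<alpha> \<Longrightarrow> False" using assms(3) by (metis less_irrefl)
  moreover have "len \<Delta> x < len \<Delta> (x \<circ> reflect \<alpha>) \<Longrightarrow> x = u \<circ> reflect \<alpha> \<Longrightarrow> False"
    using assms(3) by (metis reflect_comp_self(3) less_asym)
  moreover have "\<not> len \<Delta> x < len \<Delta> (x \<circ> reflect \<alpha>) \<Longrightarrow> x = u \<Longrightarrow> False"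
    using assms(3) by metis
  ultimately show "T_right_mult \<alpha> (Tb u) x = Tb (u \<circ> reflect \<alpha>) x"
    unfolding T_right_mult_def Tb_def using x
    by (cases "x = u"; cases "x = u \<circ> reflect \<alpha>"; simp only: if_True if_False if_cancel
      mult_zero_right mult_1_right add_0_left add_0_right split: if_split) blast+
qed (rule T_right_mult_HC)

text \<open>The endomorphisms of the Hecke algebra as a right module over itself, expressed through
  the right multiplications by generators only.\<close>

definition hecke_op :: "('a hecke \<Rightarrow> 'a hecke) \<Rightarrow> bool" where
  "hecke_op \<phi> \<longleftrightarrow> (\<forall>h\<in>HC. \<phi> h \<in> HC) \<and>
     (\<forall>a. \<forall>h\<in>HC. \<forall>k\<in>HC. \<phi> (\<lambda>x. a * h x + k x) = (\<lambda>x. a * \<phi> h x + \<phi> k x)) \<and>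
     (\<forall>\<beta>\<in>\<Delta>. \<forall>h\<in>HC. \<phi> (T_right_mult \<beta> h) = T_right_mult \<beta> (\<phi> h))"

lemma hecke_opD:
  assumes "hecke_op \<phi>"
  shows "h \<in> HC \<Longrightarrow> \<phi> h \<in> HC"
    and "h \<in> HC \<Longrightarrow> k \<in> HC \<Longrightarrow> \<phi> (\<lambda>x. a * h x + k x) = (\<lambda>x. a * \<phi> h x + \<phi> k x)"
    and "\<beta> \<in> \<Delta> \<Longrightarrow> h \<in> HC \<Longrightarrow> \<phi> (T_right_mult \<beta> h) = T_right_mult \<beta> (\<phi> h)"
  using assms unfolding hecke_op_def by simp_all

lemma hecke_op_zero: assumes "hecke_op \<phi>" shows "\<phi> (\<lambda>x. 0) = (\<lambda>x. 0)"
proof -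
  have "(\<lambda>x. 0) \<in> HC" by (simp add: HC_iff)
  from hecke_opD(2)[OF assms this this, of "- 1"] show ?thesis by simp
qed

lemma hecke_op_sum:
  assumes "hecke_op \<phi>" "finite A" "\<And>i. i \<in> A \<Longrightarrow> h i \<in> HC"
  shows "\<phi> (\<lambda>x. \<Sum>i\<in>A. a i * h i x) = (\<lambda>x. \<Sum>i\<in>A. a i * \<phi> (h i) x)"
  using assms(2,3)
proof (induction A)
  case empty
  show ?case using hecke_op_zero[OF assms(1)] by simp
next
  case (insert i A)
  have "(\<lambda>x. \<Sum>i\<in>A. a i * h i x) \<in> HC" using insert.prems by (auto simp: HC_iff)
  then show ?case
    using insert hecke_opD(2)[OF assms(1), of "h i" "\<lambda>x. \<Sum>i\<in>A. a i * h i x" "a i"] by simp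
qed

lemma HC_expansion: assumes "h \<in> HC" shows "h = (\<lambda>x. \<Sum>w\<in>W. h w * Tb w x)"
proof
  fix x
  have "(\<Sum>w\<in>W. h w * Tb w x) = (\<Sum>w\<in>W. if w = x then h x else 0)"
    by (rule sum.cong) (auto simp: Tb_def)
  also have "\<dots> = h x" using assms finite_weyl by (simp add: HC_iff)
  finally show "h x = (\<Sum>w\<in>W. h w * Tb w x)" by simp
qed

text \<open>The right multiplications by the \<open>T\<^sub>s\<close> generate the whole module from the unit.\<close>

lemma hecke_op_eq:
  assumes "hecke_op \<phi>" "hecke_op \<psi>" "\<phi> (Tb id) = \<psi> (Tb id)" "h \<in> HC"
  shows "\<phi> h = \<psi> h"
proof -
  have T: "\<phi> (Tb w) = \<psi> (Tb w)" if "w \<in> W" for w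
    using that
  proof (induction "len \<Delta> w" arbitrary: w)
    case 0
    then have "w = id" using len_eq_0 by metis
    then show ?case using assms(3) by (simp only:)
  next
    case (Suc n)
    then have "len \<Delta> w \<noteq> 0" by linarith
    then have "w \<noteq> id" by (simp only: len_eq_0[OF Suc.prems] not_False_eq_True)
    then obtain u \<alpha> where u: "\<alpha> \<in> \<Delta>" "u \<in> W" "w = u \<circ> reflect \<alpha>" "len \<Delta> w = len \<Delta> u + 1"
      using exists_right_descent[OF Suc.prems] by blast
    then have "Tb w = T_right_mult \<alpha> (Tb u)" using T_right_mult_Tb[OF u(1,2)] by (simp only: u(3) less_add_one)
    moreover have "\<phi> (Tb u) = \<psi> (Tb u)" using Suc.hyps u by simp
    ultimately show ?case using assms(1,2) u Tb_HC by (simp add: hecke_opD)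
  qed
  have "\<phi> (\<lambda>x. \<Sum>w\<in>W. h w * Tb w x) = \<psi> (\<lambda>x. \<Sum>w\<in>W. h w * Tb w x)"
    using T Tb_HC by (simp add: hecke_op_sum[OF assms(1) finite_weyl] hecke_op_sum[OF assms(2) finite_weyl])
  then show ?thesis using HC_expansion[OF assms(4)] by simp
qed

lemma hecke_op_id: "hecke_op (\<lambda>h. h)"
  by (simp add: hecke_op_def)

lemma T_simple_mult_linear:
  "T_simple_mult \<Phi> \<Delta> \<alpha> (\<lambda>x. a * h x + k x)
    = (\<lambda>x. a * T_simple_mult \<Phi> \<Delta> \<alpha> h x + T_simple_mult \<Phi> \<Delta> \<alpha> k x)"
  by (simp only: T_simple_mult_def sum_distrib_left sum.distrib[symmetric] distrib_right mult.assoc)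

lemma hecke_op_T: "\<alpha> \<in> \<Delta> \<Longrightarrow> hecke_op (T_simple_mult \<Phi> \<Delta> \<alpha>)"
  by (simp add: hecke_op_def T_simple_mult_HC left_right_commute T_simple_mult_linear)

lemma T_right_mult_linear:
  "T_right_mult \<beta> (\<lambda>x. a * h x + b * k x) = (\<lambda>x. a * T_right_mult \<beta> h x + b * T_right_mult \<beta> k x)"
  by (auto simp: T_right_mult_def algebra_simps)

lemma T_right_mult_sum:
  "T_right_mult \<beta> (\<lambda>x. \<Sum>i\<in>I. a i * h i x) = (\<lambda>x. \<Sum>i\<in>I. a i * T_right_mult \<beta> (h i) x)"
  by (auto simp: T_right_mult_def sum_distrib_left sum.distrib[symmetric] algebra_simps intro!: sum.cong)

lemma hecke_op_lincomb:
  assumes "hecke_op \<phi>" "hecke_op \<psi>"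
  shows "hecke_op (\<lambda>h x. a * \<phi> h x + b * \<psi> h x)"
  using assms unfolding hecke_op_def
  by (auto simp: HC_iff T_right_mult_linear algebra_simps)

lemma hecke_op_sum_op:
  assumes "\<And>i. i \<in> I \<Longrightarrow> hecke_op (\<phi> i)"
  shows "hecke_op (\<lambda>h x. \<Sum>i\<in>I. a i * \<phi> i h x)"
  unfolding hecke_op_def
proof (intro conjI ballI allI)
  fix h assume h: "h \<in> HC"
  show "(\<lambda>x. \<Sum>i\<in>I. a i * \<phi> i h x) \<in> HC"
    using hecke_opD(1)[OF assms h] by (simp add: HC_iff)
  show "(\<lambda>x. \<Sum>i\<in>I. a i * \<phi> i (T_right_mult \<beta> h) x) = T_right_mult \<beta> (\<lambda>x. \<Sum>i\<in>I. a i * \<phi> i h x)"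
    if "\<beta> \<in> \<Delta>" for \<beta>
    using hecke_opD(3)[OF assms that h] by (simp add: T_right_mult_sum)
  show "(\<lambda>x. \<Sum>i\<in>I. a i * \<phi> i (\<lambda>x. c * h x + k x) x) =
     (\<lambda>x. c * (\<Sum>i\<in>I. a i * \<phi> i h x) + (\<Sum>i\<in>I. a i * \<phi> i k x))" if "k \<in> HC" for k c
    using hecke_opD(2)[OF assms h that]
    by (simp add: sum_distrib_left sum.distrib[symmetric] algebra_simps)
qed

lemma hecke_op_foldr:
  assumes "\<And>\<alpha>. \<alpha> \<in> set \<alpha>s \<Longrightarrow> hecke_op (F \<alpha>)"
  shows "hecke_op (foldr F \<alpha>s)"
  using assms
proof (induction \<alpha>s)
  case Nil
  then show ?case by (simp add: hecke_op_def)
next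
  case (Cons \<alpha> \<alpha>s)
  then have "hecke_op (F \<alpha>)" "hecke_op (foldr F \<alpha>s)" by auto
  then show ?case by (simp add: hecke_op_def)
qed

lemma hecke_op_word: "set \<alpha>s \<subseteq> \<Delta> \<Longrightarrow> hecke_op (foldr (T_simple_mult \<Phi> \<Delta>) \<alpha>s)"
  by (rule hecke_op_foldr) (auto intro: hecke_op_T)

text \<open>The length count shows that every tail of a reduced word is reduced, so only the
  length-increasing case of T_s T_u occurs.\<close>

lemma word_Tb:
  assumes "set \<alpha>s \<subseteq> \<Delta>" "length \<alpha>s = len \<Delta> (word_prod \<alpha>s)"
  shows "foldr (T_simple_mult \<Phi> \<Delta>) \<alpha>s (Tb id) = Tb (word_prod \<alpha>s)"
  using assms
proof (induction \<alpha>s)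
  case Nil
  then show ?case by simp
next
  case (Cons \<alpha> \<alpha>s)
  let ?u = "word_prod \<alpha>s"
  have a: "\<alpha> \<in> \<Delta>" "set \<alpha>s \<subseteq> \<Delta>" and u: "?u \<in> W" using Cons.prems word_prod_weyl by auto
  have l: "len \<Delta> (reflect \<alpha> \<circ> ?u) = length \<alpha>s + 1"
    using Cons.prems(2) by (simp only: word_prod_simps list.size)
  then have "length \<alpha>s = len \<Delta> ?u"
    using len_left_le[OF u a(1)] len_le[OF a(2)] by linarith
  then have "T_simple_mult \<Phi> \<Delta> \<alpha> (foldr (T_simple_mult \<Phi> \<Delta>) \<alpha>s (Tb id)) = Tb (reflect \<alpha> \<circ> ?u)"
    using T_simple_mult_Tb[OF a(1) u] l
    by (simp only: Cons.IH[OF a(2) \<open>length \<alpha>s = len \<Delta> ?u\<close>] less_add_one)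
  then show ?case by (simp only: foldr_Cons comp_apply) (simp only: word_prod_simps)
qed

lemma reduced_word:
  assumes "w \<in> W"
  shows "set (reduced_word \<Delta> w) \<subseteq> \<Delta>" "length (reduced_word \<Delta> w) = len \<Delta> w"
    "word_prod (reduced_word \<Delta> w) = w"
proof -
  obtain \<alpha>s where "set \<alpha>s \<subseteq> \<Delta> \<and> length \<alpha>s = len \<Delta> w \<and> word_prod \<alpha>s = w"
    using obtain_reduced[OF assms] by metis
  from someI[of "\<lambda>\<alpha>s. set \<alpha>s \<subseteq> \<Delta> \<and> length \<alpha>s = len \<Delta> w \<and> word_prod \<alpha>s = w", OF this]
  show "set (reduced_word \<Delta> w) \<subseteq> \<Delta>" "length (reduced_word \<Delta> w) = len \<Delta> w"
    "word_prod (reduced_word \<Delta> w) = w"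
    unfolding reduced_word_def by auto
qed

text \<open>Each summand is a word of left multiplications. By \<open>hecke_op_eq\<close> a product
  is therefore known from its value on the unit, whatever reduced words were chosen.\<close>

lemma hecke_op_mult: "hecke_op (hecke_mult \<Phi> \<Delta> h)"
  unfolding hecke_mult_def
  by (rule hecke_op_sum_op) (simp add: hecke_op_word reduced_word)

lemma hecke_mult_one: assumes "h \<in> HC" shows "hecke_mult \<Phi> \<Delta> h (Tb id) = h"
proof -
  have "foldr (T_simple_mult \<Phi> \<Delta>) (reduced_word \<Delta> w) (Tb id) = Tb w" if "w \<in> W" for w
    using word_Tb[of "reduced_word \<Delta> w"] reduced_word[OF that] by simp
  then have "hecke_mult \<Phi> \<Delta> h (Tb id) = (\<lambda>x. \<Sum>w\<in>W. h w * Tb w x)"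
    unfolding hecke_mult_def by simp
  then show ?thesis using HC_expansion[OF assms] by simp
qed

section \<open>Inverses of the standard basis elements\<close>

text \<open>From T_s^2 = (q - 1) T_s + q one gets T_s^{-1} = q^{-1} T_s + (q^{-1} - 1); this is its
  left multiplication.\<close>

definition T_simple_inv :: "'a \<Rightarrow> 'a hecke \<Rightarrow> 'a hecke" where
  "T_simple_inv \<alpha> h = (\<lambda>x. qinv * T_simple_mult \<Phi> \<Delta> \<alpha> h x + (qinv - 1) * h x)"

definition T_right_inv :: "'a \<Rightarrow> 'a hecke \<Rightarrow> 'a hecke" where
  "T_right_inv \<alpha> h = (\<lambda>x. qinv * T_right_mult \<alpha> h x + (qinv - 1) * h x)"

lemma hecke_op_inv: "\<alpha> \<in> \<Delta> \<Longrightarrow> hecke_op (T_simple_inv \<alpha>)"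
  unfolding T_simple_inv_def by (rule hecke_op_lincomb[OF hecke_op_T hecke_op_id])

lemma T_simple_quadratic:
  assumes "\<alpha> \<in> \<Delta>" "h \<in> HC"
  shows "T_simple_mult \<Phi> \<Delta> \<alpha> (T_simple_mult \<Phi> \<Delta> \<alpha> h)
    = (\<lambda>x. (qv - 1) * T_simple_mult \<Phi> \<Delta> \<alpha> h x + qv * h x)"
proof (rule HC_eqI)
  show "T_simple_mult \<Phi> \<Delta> \<alpha> (T_simple_mult \<Phi> \<Delta> \<alpha> h) \<in> HC" using assms T_simple_mult_HC by blast
  show "(\<lambda>x. (qv - 1) * T_simple_mult \<Phi> \<Delta> \<alpha> h x + qv * h x) \<in> HC"
    using T_simple_mult_HC[OF assms(1), of h] assms(2) by (simp add: HC_iff)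
  fix x assume x: "x \<in> W"
  have sx: "reflect \<alpha> \<circ> x \<in> W" using x assms by blast
  note L = T_simple_mult_apply[OF assms(1)]
  show "T_simple_mult \<Phi> \<Delta> \<alpha> (T_simple_mult \<Phi> \<Delta> \<alpha> h) x
    = (qv - 1) * T_simple_mult \<Phi> \<Delta> \<alpha> h x + qv * h x"
    using len_left_not_less[OF x assms(1)]
    by (simp only: L[OF x] L[OF sx] reflect_comp_self; simp add: algebra_simps)
qed

lemma T_simple_inverse:
  assumes "\<alpha> \<in> \<Delta>" "h \<in> HC"
  shows "T_simple_mult \<Phi> \<Delta> \<alpha> (T_simple_inv \<alpha> h) = h" "T_simple_inv \<alpha> (T_simple_mult \<Phi> \<Delta> \<alpha> h) = h"
proof -
  let ?L = "T_simple_mult \<Phi> \<Delta> \<alpha>"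
  have "hecke_op (\<lambda>h x. 0 * ?L h x + (qinv - 1) * h x)"
    by (rule hecke_op_lincomb[OF hecke_op_T[OF assms(1)] hecke_op_id])
  from hecke_opD(1)[OF this assms(2)] have c: "(\<lambda>x. (qinv - 1) * h x) \<in> HC" by simp
  have z: "(\<lambda>x. 0) \<in> HC" by (simp add: HC_iff)
  have "?L (\<lambda>x. (qinv - 1) * h x) = (\<lambda>x. (qinv - 1) * ?L h x)"
    using hecke_opD(2)[OF hecke_op_T[OF assms(1)] assms(2) z, of "qinv - 1"] hecke_op_zero[OF hecke_op_T[OF assms(1)]]
    by simp
  then show "?L (T_simple_inv \<alpha> h) = h"
    unfolding T_simple_inv_def
    using hecke_opD(2)[OF hecke_op_T[OF assms(1)] T_simple_mult_HC[OF assms(1)] c, of qinv h]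
    by (simp add: T_simple_quadratic[OF assms] algebra_simps qinv_qv_cancel)
  show "T_simple_inv \<alpha> (?L h) = h"
    unfolding T_simple_inv_def
    by (simp add: T_simple_quadratic[OF assms] algebra_simps qinv_qv_cancel)
qed

lemma word_inverse:
  assumes "set \<alpha>s \<subseteq> \<Delta>" "h \<in> HC"
  shows "foldr (T_simple_mult \<Phi> \<Delta>) (rev \<alpha>s) (foldr T_simple_inv \<alpha>s h) = h"
    and "foldr T_simple_inv \<alpha>s (foldr (T_simple_mult \<Phi> \<Delta>) (rev \<alpha>s) h) = h"
proof -
  have op: "hecke_op (foldr T_simple_inv \<beta>s)" if "set \<beta>s \<subseteq> \<Delta>" for \<beta>s
    by (rule hecke_op_foldr) (use that hecke_op_inv in blast)
  show "foldr (T_simple_mult \<Phi> \<Delta>) (rev \<alpha>s) (foldr T_simple_inv \<alpha>s h) = h"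
    using assms(1)
  proof (induction \<alpha>s)
    case (Cons \<alpha> \<alpha>s)
    then show ?case using T_simple_inverse(1)[of \<alpha>] hecke_opD(1)[OF op assms(2), of \<alpha>s] by simp
  qed simp
  show "foldr T_simple_inv \<alpha>s (foldr (T_simple_mult \<Phi> \<Delta>) (rev \<alpha>s) h) = h"
    using assms
  proof (induction \<alpha>s arbitrary: h)
    case (Cons \<alpha> \<alpha>s)
    then show ?case using T_simple_inverse(2)[of \<alpha> h] T_simple_mult_HC by simp
  qed simp
qed

lemma len_inv: assumes "w \<in> W" shows "len \<Delta> (inv w) = len \<Delta> w"
proof -
  have le: "len \<Delta> (inv w) \<le> len \<Delta> w" if "w \<in> W" for w
    using reduced_word[OF that] len_le[of "rev (reduced_word \<Delta> w)"] inv_word_prod[of "reduced_word \<Delta> w"] by simp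
  have "bij w" by (rule orthogonal_transformation_bij[OF weyl_orthogonal[OF assms]])
  then have "inv (inv w) = w" by (rule inv_inv_eq)
  then show ?thesis using le[OF assms] le[OF weyl_inv[OF assms]] by simp
qed

text \<open>For w = s ... t the product T_s^{-1} ... T_t^{-1} inverts T_t ... T_s, the basis element
  of w^{-1}. Multiplication by either is identified with a word of left operators through
  \<open>hecke_op_eq\<close>, and these words are mutually inverse, which also gives uniqueness. The
  freedom in the reduced word is what \<open>barT_right\<close> exploits.\<close>

lemma hecke_inverse_word:
  assumes "set \<alpha>s \<subseteq> \<Delta>" "length \<alpha>s = len \<Delta> (word_prod \<alpha>s)"
  shows "hecke_inverse \<Phi> \<Delta> (Tb (inv (word_prod \<alpha>s))) = foldr T_simple_inv \<alpha>s (Tb id)"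
proof -
  let ?w = "word_prod \<alpha>s" and ?k = "foldr T_simple_inv \<alpha>s (Tb id)"
  let ?L = "foldr (T_simple_mult \<Phi> \<Delta>) (rev \<alpha>s)"
  let ?T = "Tb (inv ?w)"
  have w: "?w \<in> W" using assms word_prod_weyl by blast
  have opL: "hecke_op ?L" using assms by (intro hecke_op_word) simp
  have opI: "hecke_op (foldr T_simple_inv \<alpha>s)"
    by (rule hecke_op_foldr) (use assms hecke_op_inv in blast)
  have one: "Tb id \<in> HC" using weyl_id by (rule Tb_HC)
  have k: "?k \<in> HC" using hecke_opD(1)[OF opI one] .
  have T: "?T \<in> HC" using weyl_inv[OF w] by (rule Tb_HC)
  have LT: "?L (Tb id) = ?T"
    using word_Tb[of "rev \<alpha>s"] assms len_inv[OF w] by (simp add: inv_word_prod)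
  have mT: "hecke_mult \<Phi> \<Delta> ?T h = ?L h" if "h \<in> HC" for h
    by (rule hecke_op_eq[OF hecke_op_mult opL _ that]) (simp add: LT hecke_mult_one[OF T])
  have mk: "hecke_mult \<Phi> \<Delta> ?k h = foldr T_simple_inv \<alpha>s h" if "h \<in> HC" for h
    by (rule hecke_op_eq[OF hecke_op_mult opI _ that]) (simp add: hecke_mult_one[OF k])
  show ?thesis
    unfolding hecke_inverse_def
  proof (rule the_equality)
    show "?k \<in> HC \<and> hecke_mult \<Phi> \<Delta> ?T ?k = Tb id \<and> hecke_mult \<Phi> \<Delta> ?k ?T = Tb id"
      using k mT[OF k] mk[OF T] word_inverse[OF assms(1) one] LT by simp
    fix h assume h: "h \<in> HC \<and> hecke_mult \<Phi> \<Delta> ?T h = Tb id \<and> hecke_mult \<Phi> \<Delta> h ?T = Tb id"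
    then have hc: "h \<in> HC" and "hecke_mult \<Phi> \<Delta> ?T h = Tb id" by blast+
    then have "?L h = Tb id" by (simp only: mT[OF hc])
    then show "h = ?k" using word_inverse(2)[OF assms(1) hc] by (simp only:)
  qed
qed

abbreviation barT :: "('a \<Rightarrow> 'a) \<Rightarrow> 'a hecke" where
  "barT w \<equiv> hecke_inverse \<Phi> \<Delta> (Tb (inv w))"

lemma barT_id: "barT id = Tb id"
  using hecke_inverse_word[of "[]"] by (simp only: word_prod_simps list.size len_id inv_id foldr_Nil id_apply) simp

lemma barT_HC: assumes "w \<in> W" shows "barT w \<in> HC"
proof -
  have "hecke_op (foldr T_simple_inv (reduced_word \<Delta> w))"
    by (rule hecke_op_foldr) (use reduced_word(1)[OF assms] hecke_op_inv in blast)
  from hecke_opD(1)[OF this Tb_HC[OF weyl_id]] show ?thesis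
    using hecke_inverse_word[of "reduced_word \<Delta> w"] reduced_word[OF assms] by simp
qed

lemma hecke_op_right_inv:
  assumes "hecke_op \<phi>" "\<beta> \<in> \<Delta>" "h \<in> HC"
  shows "\<phi> (T_right_inv \<beta> h) = T_right_inv \<beta> (\<phi> h)"
proof -
  have z: "(\<lambda>x. 0) \<in> HC" by (simp add: HC_iff)
  have c: "(\<lambda>x. (qinv - 1) * h x) \<in> HC" using assms(3) by (simp add: HC_iff)
  have "\<phi> (\<lambda>x. (qinv - 1) * h x) = (\<lambda>x. (qinv - 1) * \<phi> h x)"
    using hecke_opD(2)[OF assms(1,3) z, of "qinv - 1"] hecke_op_zero[OF assms(1)] by simp
  then show ?thesis
    unfolding T_right_inv_def
    using hecke_opD(2)[OF assms(1) T_right_mult_HC c, of qinv \<beta> h] hecke_opD(3)[OF assms] by simp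
qed

text \<open>Extend a reduced word of u by \<beta>. On the unit, left and right multiplication by the
  inverse of the new generator agree, and the right one passes through the remaining left operators
  to the outside.\<close>

lemma barT_right:
  assumes "\<beta> \<in> \<Delta>" "u \<in> W" "len \<Delta> u < len \<Delta> (u \<circ> reflect \<beta>)"
  shows "barT (u \<circ> reflect \<beta>) = T_right_inv \<beta> (barT u)"
proof -
  let ?\<alpha>s = "reduced_word \<Delta> u"
  note r = reduced_word[OF assms(2)]
  have l: "len \<Delta> (u \<circ> reflect \<beta>) = len \<Delta> u + 1" using len_right_cases[OF assms(2,1)] assms(3) by linarith
  have w: "word_prod (?\<alpha>s @ [\<beta>]) = u \<circ> reflect \<beta>" by (simp add: word_prod_append r)
  have one: "Tb id \<in> HC" using weyl_id by (rule Tb_HC)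
  have opI: "hecke_op (foldr T_simple_inv ?\<alpha>s)"
    by (rule hecke_op_foldr) (use r hecke_op_inv in blast)
  have up: "len \<Delta> id < len \<Delta> (reflect \<beta>)"
    using len_right_iff[OF weyl_id assms(1)] simple_pos[OF assms(1)] by simp
  have "T_simple_mult \<Phi> \<Delta> \<beta> (Tb id) = T_right_mult \<beta> (Tb id)"
    using T_simple_mult_Tb[OF assms(1) weyl_id] T_right_mult_Tb[OF assms(1) weyl_id] up by simp
  then have e: "T_simple_inv \<beta> (Tb id) = T_right_inv \<beta> (Tb id)"
    by (simp add: T_simple_inv_def T_right_inv_def)
  have "barT (u \<circ> reflect \<beta>) = foldr T_simple_inv (?\<alpha>s @ [\<beta>]) (Tb id)"
    using hecke_inverse_word[of "?\<alpha>s @ [\<beta>]"] r assms l unfolding w by simp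
  also have "\<dots> = T_right_inv \<beta> (foldr T_simple_inv ?\<alpha>s (Tb id))"
    using e hecke_op_right_inv[OF opI assms(1) one] by simp
  also have "foldr T_simple_inv ?\<alpha>s (Tb id) = barT u"
    using hecke_inverse_word[of ?\<alpha>s] r by simp
  finally show ?thesis .
qed

lemma T_right_inv_apply:
  assumes "x \<in> W"
  shows "T_right_inv \<beta> h x = (if len \<Delta> x < len \<Delta> (x \<circ> reflect \<beta>)
     then h (x \<circ> reflect \<beta>) + (qinv - 1) * h x else qinv * h (x \<circ> reflect \<beta>))"
  using assms by (simp add: T_right_inv_def T_right_mult_def algebra_simps qinv_qv_cancel)

lemma T_right_inv_HC: "h \<in> HC \<Longrightarrow> T_right_inv \<beta> h \<in> HC"
  using T_right_mult_HC[of \<beta> h] by (simp add: HC_iff T_right_inv_def)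

lemma T_right_inv_quadratic:
  assumes "\<beta> \<in> \<Delta>" "h \<in> HC"
  shows "T_right_inv \<beta> (T_right_inv \<beta> h) = (\<lambda>x. qinv * h x + (qinv - 1) * T_right_inv \<beta> h x)"
proof (rule HC_eqI)
  show "T_right_inv \<beta> (T_right_inv \<beta> h) \<in> HC" using assms T_right_inv_HC by blast
  show "(\<lambda>x. qinv * h x + (qinv - 1) * T_right_inv \<beta> h x) \<in> HC"
    using T_right_inv_HC[OF assms(2), of \<beta>] assms(2) by (simp add: HC_iff)
  fix x assume x: "x \<in> W"
  have sx: "x \<circ> reflect \<beta> \<in> W" using x assms by blast
  note L = T_right_inv_apply
  show "T_right_inv \<beta> (T_right_inv \<beta> h) x = qinv * h x + (qinv - 1) * T_right_inv \<beta> h x"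
    using len_right_not_less[OF x assms(1)]
    by (simp only: L[OF x] L[OF sx] reflect_comp_self; simp add: algebra_simps)
qed

end

section \<open>Existence and uniqueness of Kazhdan-Lusztig polynomials\<close>

context based_root_system begin

section \<open>The bar involution on right multiples, and its triangularity\<close>

lemma bij_betw_right: "\<beta> \<in> \<Delta> \<Longrightarrow> bij_betw (\<lambda>w. w \<circ> reflect \<beta>) W W"
  by (rule bij_betw_byWitness[where f' = "\<lambda>w. w \<circ> reflect \<beta>"]) (simp_all add: image_subset_iff weyl_simple(2))

text \<open>Reindexing w to w s moves the multiplication from the coefficients onto the bar images
  of the T_w. There \<open>barT_right\<close> settles the ascents, and the quadratic relation of
  T_s^{-1} the descents.\<close>

lemma hecke_bar_right_mult:
  assumes "\<beta> \<in> \<Delta>"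
  shows "hecke_bar \<Phi> \<Delta> (T_right_mult \<beta> h) = T_right_inv \<beta> (hecke_bar \<Phi> \<Delta> h)"
proof
  fix x
  let ?up = "\<lambda>w. len \<Delta> w < len \<Delta> (w \<circ> reflect \<beta>)"
  let ?b = laurent_bar
  have b1: "?b (qv * a) = qinv * ?b a" for a by (simp add: qv_def laurent_bar_vpow)
  have b2: "?b ((qv - 1) * a) = (qinv - 1) * ?b a" for a
    by (simp add: left_diff_distrib laurent_bar_diff b1)
  have "hecke_bar \<Phi> \<Delta> (T_right_mult \<beta> h) x =
     (\<Sum>w\<in>W. ?b (h (w \<circ> reflect \<beta>)) * ((if ?up w then qinv else 1) * barT w x))
     + (\<Sum>w\<in>W. ?b (h w) * ((if ?up w then 0 else qinv - 1) * barT w x))"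
    unfolding hecke_bar_def sum.distrib[symmetric]
    by (rule sum.cong[OF refl])
       (simp add: T_right_mult_def laurent_bar_add b1 b2, simp add: algebra_simps)
  also have "(\<Sum>w\<in>W. ?b (h (w \<circ> reflect \<beta>)) * ((if ?up w then qinv else 1) * barT w x))
    = (\<Sum>w\<in>W. ?b (h w) * ((if ?up w then 1 else qinv) * barT (w \<circ> reflect \<beta>) x))"
  proof (rule sum.reindex_bij_betw[OF bij_betw_right[OF assms], symmetric, THEN trans])
    show "(\<Sum>w\<in>W. ?b (h (w \<circ> reflect \<beta> \<circ> reflect \<beta>)) *
        ((if ?up (w \<circ> reflect \<beta>) then qinv else 1) * barT (w \<circ> reflect \<beta>) x))
      = (\<Sum>w\<in>W. ?b (h w) * ((if ?up w then 1 else qinv) * barT (w \<circ> reflect \<beta>) x))"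
      by (rule sum.cong[OF refl])
         (simp only: reflect_comp_self len_right_not_less[OF _ assms] if_not_P if_P split: if_split; simp)
  qed
  also have "\<dots> + (\<Sum>w\<in>W. ?b (h w) * ((if ?up w then 0 else qinv - 1) * barT w x))
    = (\<Sum>w\<in>W. ?b (h w) * T_right_inv \<beta> (barT w) x)"
    unfolding sum.distrib[symmetric] distrib_left[symmetric]
  proof (rule sum.cong[OF refl])
    fix w assume w: "w \<in> W"
    show "?b (h w) * ((if ?up w then 1 else qinv) * barT (w \<circ> reflect \<beta>) x
        + (if ?up w then 0 else qinv - 1) * barT w x) = ?b (h w) * T_right_inv \<beta> (barT w) x"
    proof (cases "?up w")
      case True
      then show ?thesis by (simp add: barT_right[OF assms w])
    next
      case False
      define u where "u = w \<circ> reflect \<beta>"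
      have u: "u \<in> W" using w assms unfolding u_def by blast
      have wu: "u \<circ> reflect \<beta> = w" by (simp only: u_def reflect_comp_self)
      have "len \<Delta> u < len \<Delta> w" using False len_right_not_less[OF w assms] unfolding u_def by blast
      then have "barT w = T_right_inv \<beta> (barT u)" using barT_right[OF assms u] unfolding wu by blast
      then have "T_right_inv \<beta> (barT w) x = qinv * barT u x + (qinv - 1) * barT w x"
        by (simp add: T_right_inv_quadratic[OF assms barT_HC[OF u]])
      then show ?thesis using False unfolding u_def by simp
    qed
  qed
  also have "\<dots> = T_right_inv \<beta> (hecke_bar \<Phi> \<Delta> h) x"
    unfolding hecke_bar_def T_right_inv_def T_right_mult_sum
    by (simp add: sum_distrib_left sum.distrib[symmetric] algebra_simps)
  finally show "hecke_bar \<Phi> \<Delta> (T_right_mult \<beta> h) x = T_right_inv \<beta> (hecke_bar \<Phi> \<Delta> h) x" .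
qed

text \<open>Right multiplication by v^{-1} (T_s + 1), the element C'_s of the Hecke algebra.\<close>

definition kl_right_mult :: "'a \<Rightarrow> 'a hecke \<Rightarrow> 'a hecke" where
  "kl_right_mult \<beta> h = (\<lambda>x. vpow (- 1) * (T_right_mult \<beta> h x + h x))"

lemma hecke_bar_scale: "hecke_bar \<Phi> \<Delta> (\<lambda>x. vpow n * h x) = (\<lambda>x. vpow (- n) * hecke_bar \<Phi> \<Delta> h x)"
  by (simp add: hecke_bar_def laurent_bar_vpow sum_distrib_left mult.assoc)

lemma hecke_bar_add: "hecke_bar \<Phi> \<Delta> (\<lambda>x. h x + k x) = (\<lambda>x. hecke_bar \<Phi> \<Delta> h x + hecke_bar \<Phi> \<Delta> k x)"
  by (simp add: hecke_bar_def laurent_bar_add sum.distrib distrib_right)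

lemma hecke_bar_diff: "hecke_bar \<Phi> \<Delta> (\<lambda>x. h x - k x) = (\<lambda>x. hecke_bar \<Phi> \<Delta> h x - hecke_bar \<Phi> \<Delta> k x)"
  by (simp add: hecke_bar_def laurent_bar_diff sum_subtractf left_diff_distrib)

lemma hecke_bar_sum:
  "hecke_bar \<Phi> \<Delta> (\<lambda>x. \<Sum>z\<in>Z. of_int (m z) * k z x) = (\<lambda>x. \<Sum>z\<in>Z. of_int (m z) * hecke_bar \<Phi> \<Delta> (k z) x)"
  by (rule ext, simp only: hecke_bar_def laurent_bar_sum laurent_bar_of_int sum_distrib_right sum_distrib_left mult.assoc)
     (rule sum.swap)

lemma hecke_bar_kl_right_mult:
  assumes "\<beta> \<in> \<Delta>" "hecke_bar \<Phi> \<Delta> h = h"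
  shows "hecke_bar \<Phi> \<Delta> (kl_right_mult \<beta> h) = kl_right_mult \<beta> h"
proof -
  have "hecke_bar \<Phi> \<Delta> (kl_right_mult \<beta> h) = (\<lambda>x. vpow 1 * (T_right_inv \<beta> h x + h x))"
    unfolding kl_right_mult_def hecke_bar_scale
    using hecke_bar_add[of "T_right_mult \<beta> h" h] hecke_bar_right_mult[OF assms(1), of h] assms(2) by simp
  \<comment> \<open>Here T_s^{-1} + 1 = q^{-1} (T_s + 1), so the factor v produced by the bar turns
    back into v^{-1}.\<close>
  also have "\<dots> = (\<lambda>x. (vpow 1 * qinv) * T_right_mult \<beta> h x + (vpow 1 * qinv) * h x)"
    by (simp add: T_right_inv_def algebra_simps)
  finally show ?thesis by (simp add: kl_right_mult_def vpow_mult distrib_left)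
qed

text \<open>Triangularity is measured by length, to match the uniqueness argument, which inspects an
  element of maximal length where two families differ.\<close>

lemma barT_triangular:
  assumes "w \<in> W" "x \<in> W"
  shows "len \<Delta> w \<le> len \<Delta> x \<Longrightarrow> x \<noteq> w \<Longrightarrow> barT w x = 0"
    and "barT w w = vpow (- 2 * int (len \<Delta> w))"
proof -
  have "(\<forall>x\<in>W. len \<Delta> w \<le> len \<Delta> x \<longrightarrow> x \<noteq> w \<longrightarrow> barT w x = 0) \<and> barT w w = vpow (- 2 * int (len \<Delta> w))"
    using assms(1)
  proof (induction "len \<Delta> w" arbitrary: w)
    case 0
    have "len \<Delta> w = 0" using 0(1) by simp
    then have w: "w = id" by (simp only: len_eq_0[OF 0(2)])
    have "Tb id x = 0" if "x \<noteq> id" for x :: "'a \<Rightarrow> 'a" using that unfolding Tb_def by (simp only: if_False)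
    moreover have "Tb id (id :: 'a \<Rightarrow> 'a) = vpow (- 2 * int 0)" by (simp add: Tb_def vpow_0)
    ultimately show ?case unfolding w barT_id len_id by blast
  next
    case (Suc n)
    then have "len \<Delta> w \<noteq> 0" by linarith
    then have "w \<noteq> id" by (simp only: len_eq_0[OF Suc.prems] not_False_eq_True)
    then obtain u \<beta> where b: "\<beta> \<in> \<Delta>" and u: "u \<in> W" and wu: "w = u \<circ> reflect \<beta>"
      and l: "len \<Delta> w = len \<Delta> u + 1"
      using exists_right_descent[OF Suc.prems] by metis
    have uw: "w \<circ> reflect \<beta> = u" unfolding wu by (simp only: reflect_comp_self)
    have e: "barT w = T_right_inv \<beta> (barT u)" unfolding wu using barT_right[OF b u] l wu by simp
    have "n = len \<Delta> u" using Suc.hyps(2) l by linarith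
    note IH = Suc.hyps(1)[OF this u]
    have "barT w x = 0" if x: "x \<in> W" "len \<Delta> w \<le> len \<Delta> x" "x \<noteq> w" for x
    proof -
      have xu: "x \<circ> reflect \<beta> \<noteq> u" using x(3) wu reflect_comp_eq_iff(2)[of x \<beta> u] by metis
      have xs: "x \<circ> reflect \<beta> \<in> W" using x b by blast
      have "len \<Delta> u \<le> len \<Delta> (x \<circ> reflect \<beta>)" using len_right_cases[OF x(1) b] x(2) l by linarith
      then have 1: "barT u (x \<circ> reflect \<beta>) = 0" using IH xs xu by blast
      have "x \<noteq> u" "len \<Delta> u \<le> len \<Delta> x" using x l by auto
      then have 2: "barT u x = 0" using IH x by blast
      show ?thesis unfolding e T_right_inv_apply[OF x(1)] 1 2 by simp
    qed
    moreover have "barT w w = vpow (- 2 * int (len \<Delta> w))"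
      using l IH by (simp add: e T_right_inv_apply[OF Suc.prems] uw vpow_mult)
    ultimately show ?case by blast
  qed
  then show "len \<Delta> w \<le> len \<Delta> x \<Longrightarrow> x \<noteq> w \<Longrightarrow> barT w x = 0"
    and "barT w w = vpow (- 2 * int (len \<Delta> w))"
    using assms(2) by blast+
qed

text \<open>The degree bound is restated as the vanishing of coefficients for all y \<noteq> w,
  including those with zero polynomial; later estimates then need no case distinction on the Bruhat
  order.\<close>

lemma kl_familyD:
  assumes "is_kl_family \<Phi> \<Delta> w P"
  shows "P w = 1" "P y \<noteq> 0 \<Longrightarrow> bruhat_le \<Phi> \<Delta> y w"
    and "y \<noteq> w \<Longrightarrow> len \<Delta> w \<le> 2 * k + len \<Delta> y \<Longrightarrow> coeff (P y) k = 0"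
    and "hecke_bar \<Phi> \<Delta> (hecke_kl_element \<Phi> \<Delta> w P) = hecke_kl_element \<Phi> \<Delta> w P"
    and "hecke_kl_element \<Phi> \<Delta> w P y = vpow (- int (len \<Delta> w)) * poly_q (P y)"
proof -
  note a = assms[unfolded is_kl_family_def]
  show "P w = 1" "P y \<noteq> 0 \<Longrightarrow> bruhat_le \<Phi> \<Delta> y w"
    "hecke_bar \<Phi> \<Delta> (hecke_kl_element \<Phi> \<Delta> w P) = hecke_kl_element \<Phi> \<Delta> w P"
    using a by metis+
  show "coeff (P y) k = 0" if "y \<noteq> w" "len \<Delta> w \<le> 2 * k + len \<Delta> y"
  proof (cases "bruhat_le \<Phi> \<Delta> y w")
    case True
    then have "2 * degree (P y) + len \<Delta> y + 1 \<le> len \<Delta> w" using a that by metis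
    then have "degree (P y) < k" using that by linarith
    then show ?thesis by (rule coeff_eq_0)
  next
    case False
    then have "P y = 0" using a by metis
    then show ?thesis by simp
  qed
  show "hecke_kl_element \<Phi> \<Delta> w P y = vpow (- int (len \<Delta> w)) * poly_q (P y)"
  proof (cases "bruhat_le \<Phi> \<Delta> y w")
    case False
    then have "P y = 0" using a by metis
    then show ?thesis using False by (simp add: hecke_kl_element_def poly_q_0)
  qed (simp add: hecke_kl_element_def poly_q_def)
qed

lemma kl_familyI:
  assumes "P w = 1" "\<And>y. P y \<noteq> 0 \<Longrightarrow> bruhat_le \<Phi> \<Delta> y w"
    and "\<And>y k. y \<noteq> w \<Longrightarrow> len \<Delta> w \<le> 2 * k + len \<Delta> y \<Longrightarrow> coeff (P y) k = 0"
    and "hecke_bar \<Phi> \<Delta> (\<lambda>y. vpow (- int (len \<Delta> w)) * poly_q (P y))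
      = (\<lambda>y. vpow (- int (len \<Delta> w)) * poly_q (P y))"
  shows "is_kl_family \<Phi> \<Delta> w P"
proof -
  have e: "hecke_kl_element \<Phi> \<Delta> w P = (\<lambda>y. vpow (- int (len \<Delta> w)) * poly_q (P y))"
  proof
    fix y
    show "hecke_kl_element \<Phi> \<Delta> w P y = vpow (- int (len \<Delta> w)) * poly_q (P y)"
      using assms(2)[of y] by (cases "P y = 0") (simp_all add: hecke_kl_element_def poly_q_def)
  qed
  have d: "2 * degree (P y) + len \<Delta> y + 1 \<le> len \<Delta> w" if "bruhat_le \<Phi> \<Delta> y w" "y \<noteq> w" for y
  proof (cases "P y = 0")
    case True
    then show ?thesis using bruhat_len[OF that(1)] that(2) by simp
  next
    case False
    then have "coeff (P y) (degree (P y)) \<noteq> 0" by simp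
    then show ?thesis using assms(3)[OF that(2), of "degree (P y)"] by linarith
  qed
  show ?thesis unfolding is_kl_family_def e
    using assms(1,2,4) d by metis
qed

text \<open>At a y of maximal length where the families differ, triangularity gives h_y = v^{-2
  l(y)} bar(h_y) for their difference h, so the exponents of h_y are symmetric about -l(y). The
  degree bound confines them strictly below -l(y), hence h_y = 0.\<close>

lemma kl_family_unique:
  assumes "w \<in> W" "is_kl_family \<Phi> \<Delta> w P" "is_kl_family \<Phi> \<Delta> w Q"
  shows "P = Q"
proof (rule ccontr)
  let ?l = "len \<Delta>"
  define h where "h = (\<lambda>x. hecke_kl_element \<Phi> \<Delta> w P x - hecke_kl_element \<Phi> \<Delta> w Q x)"
  note D = kl_familyD[OF assms(2)] and D' = kl_familyD[OF assms(3)]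
  have h: "h y = vpow (- int (?l w)) * poly_q (P y - Q y)" for y
    by (simp add: h_def D(5) D'(5) poly_q_diff right_diff_distrib)
  have bar: "hecke_bar \<Phi> \<Delta> h = h" unfolding h_def hecke_bar_diff D(4) D'(4) ..
  assume "P \<noteq> Q"
  then obtain y0 where y0: "P y0 \<noteq> Q y0" by blast
  define X where "X = {y \<in> W. P y \<noteq> Q y}"
  have "finite X" using finite_weyl unfolding X_def by simp
  moreover have "P y0 \<noteq> 0 \<or> Q y0 \<noteq> 0" using y0 by auto
  then have "y0 \<in> W" using D(2)[of y0] D'(2)[of y0] bruhat_weyl[of y0 w] by blast
  then have "y0 \<in> X" unfolding X_def using y0 by blast
  ultimately have fin: "finite (?l ` X)" "?l ` X \<noteq> {}" by blast+
  from Max_in[OF this] obtain y where y: "y \<in> X" "Max (?l ` X) = ?l y" by blast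
  have ymax: "?l z \<le> ?l y" if "z \<in> X" for z
    using Max_ge[OF fin(1), of "?l z"] that y(2) by simp
  have yW: "y \<in> W" and yne: "P y \<noteq> Q y" using y(1) unfolding X_def by blast+
  have yw: "y \<noteq> w" using yne D(1) D'(1) by metis
  have z0: "h z = 0" if "z \<in> W" "?l y < ?l z" for z
  proof -
    have "z \<notin> X" using ymax that by (meson not_le)
    then have "P z = Q z" using that unfolding X_def by blast
    then show ?thesis by (simp add: h poly_q_0)
  qed
  have "h y = hecke_bar \<Phi> \<Delta> h y" using bar by simp
  also have "\<dots> = (\<Sum>z\<in>W. if z = y then laurent_bar (h y) * vpow (- 2 * int (?l y)) else 0)"
    unfolding hecke_bar_def
  proof (rule sum.cong[OF refl])
    fix z assume z: "z \<in> W"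
    show "laurent_bar (h z) * barT z y = (if z = y then laurent_bar (h y) * vpow (- 2 * int (?l y)) else 0)"
    proof (cases "z = y")
      case True
      then show ?thesis using barT_triangular(2)[OF yW yW] by simp
    next
      case False
      show ?thesis
      proof (cases "?l z \<le> ?l y")
        case True
        then show ?thesis using barT_triangular(1)[OF z yW] False by simp
      next
        case ngt: False
        then have "h z = 0" using z0 z by simp
        then show ?thesis using False by (simp add: laurent_bar_0)
      qed
    qed
  qed
  also have "\<dots> = laurent_bar (h y) * vpow (- 2 * int (?l y))" using yW finite_weyl by simp
  finally have "h y = vpow (- 2 * int (?l y)) * laurent_bar (h y)" by (simp add: mult.commute)
  then have sym: "Poly_Mapping.lookup (h y) k = Poly_Mapping.lookup (h y) (- k - 2 * int (?l y))" for k
    using lookup_vpow_times[of "- 2 * int (?l y)" "laurent_bar (h y)" k]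
    by (simp add: lookup_laurent_bar algebra_simps)
  \<comment> \<open>The exponent k in h_y belongs to the degree (k + l(w)) / 2 of the
    polynomials.\<close>
  have small: "Poly_Mapping.lookup (h y) k = 0" if "k \<ge> - int (?l y)" for k
  proof (cases "0 \<le> k + int (?l w) \<and> even (k + int (?l w))")
    case True
    then obtain j where j: "k + int (?l w) = 2 * j" by (elim conjE evenE)
    have "?l w \<le> 2 * nat ((k + int (?l w)) div 2) + ?l y" using that True unfolding j by (simp, use j in linarith)
    then have "coeff (P y) (nat ((k + int (?l w)) div 2)) = 0" "coeff (Q y) (nat ((k + int (?l w)) div 2)) = 0"
      using D(3)[OF yw] D'(3)[OF yw] by blast+
    then show ?thesis by (simp add: h lookup_vpow_times lookup_poly_q)
  next
    case False
    then show ?thesis by (auto simp: h lookup_vpow_times lookup_poly_q)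
  qed
  have "Poly_Mapping.lookup (h y) k = 0" for k
  proof (cases "k \<ge> - int (?l y)")
    case False
    then show ?thesis using sym[of k] small[of "- k - 2 * int (?l y)"] by simp
  qed (rule small)
  then have "h y = 0" by (simp add: poly_mapping_eq_iff fun_eq_iff)
  then have "vpow (int (?l w)) * h y = 0" by simp
  then have "poly_q (P y - Q y) = 0" by (simp add: h mult.assoc[symmetric] vpow_mult vpow_0)
  then have "P y - Q y = 0" using poly_q_eqD poly_q_0 by metis
  then show False using yne by simp
qed

text \<open>
  The induction step \<open>C'\<^sub>u C'\<^sub>s - \<Sum>z. \<mu>(z, u) C'\<^sub>z\<close>. The sum runs over \<open>z\<close> with \<open>zs < z\<close>
  only, so every term is invariant under \<open>s\<close> from the right.
\<close>

lemma kl_family_step: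
  assumes b: "\<beta> \<in> \<Delta>" and u: "u \<in> W" and wu: "w = u \<circ> reflect \<beta>" and l: "len \<Delta> w = len \<Delta> u + 1"
    and Pu: "is_kl_family \<Phi> \<Delta> u Pu"
    and Q: "\<And>z. z \<in> W \<Longrightarrow> len \<Delta> z < len \<Delta> w \<Longrightarrow> is_kl_family \<Phi> \<Delta> z (Q z)"
    and Qs: "\<And>z y. z \<in> W \<Longrightarrow> len \<Delta> z < len \<Delta> w \<Longrightarrow> len \<Delta> (z \<circ> reflect \<beta>) < len \<Delta> z \<Longrightarrow> y \<in> W \<Longrightarrow>
        Q z (y \<circ> reflect \<beta>) = Q z y"
  shows "\<exists>P. is_kl_family \<Phi> \<Delta> w P \<and> (\<forall>y\<in>W. P (y \<circ> reflect \<beta>) = P y)"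
proof -
  let ?l = "len \<Delta>" and ?X = "monom 1 1 :: int poly"
  let ?up = "\<lambda>x. ?l x < ?l (x \<circ> reflect \<beta>)"
  \<comment> \<open>Up to the factor v^{-l(w)} these are the coefficients of C'_u C'_s: T_s + 1
    combines the polynomials at y and y s.\<close>
  define E where "E = (\<lambda>y. if y \<in> W then if ?up y then ?X * Pu (y \<circ> reflect \<beta>) + Pu y
     else Pu (y \<circ> reflect \<beta>) + ?X * Pu y else 0)"
  \<comment> \<open>For even length difference this is the first degree at which the bound for w
    fails at z. Moreover q^{M z} turns the normalization v^{-l(w)} into v^{-l(z)}, so the correction
    terms are integer multiples of C'_z.\<close>
  define M where "M z = (?l w - ?l z) div 2" for z :: "'a \<Rightarrow> 'a"
  \<comment> \<open>The number \<mu>(z, u), read off from \<open>E\<close> as the offending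
    coefficient. The default 0 lets the correction run over all of W.\<close>
  define m where "m z = (if z \<in> W \<and> \<not> ?up z \<and> ?l z < ?l w \<and> even (?l w - ?l z) then coeff (E z) (M z) else 0)" for z
  define P where "P = (\<lambda>y. E y - (\<Sum>z\<in>W. smult (m z) (monom 1 (M z) * Q z y)))"
  note D = kl_familyD[OF Pu]
  have w: "w \<in> W" using u b wu by blast
  have uw: "w \<circ> reflect \<beta> = u" unfolding wu by (simp only: reflect_comp_self)
  have uup: "?up u" using l wu by simp
  have wdown: "\<not> ?up w" unfolding uw using l by simp
  have mD: "z \<in> W" "\<not> ?up z" "?l z < ?l w" "even (?l w - ?l z)" "E z \<noteq> 0" if "m z \<noteq> 0" for z
    using that by (auto simp: m_def split: if_splits)
  have Pu0: "Pu z \<noteq> 0 \<Longrightarrow> bruhat_le \<Phi> \<Delta> z w" for z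
    using D(2) bruhat_simple_up[OF u b uup] wu bruhat_trans by metis
  have Pu1: "bruhat_le \<Phi> \<Delta> y w" if "Pu (y \<circ> reflect \<beta>) \<noteq> 0" for y
    using bruhat_lift_up[OF D(2)[OF that] b uup] by (simp only: reflect_comp_self wu)
  have E0: "bruhat_le \<Phi> \<Delta> y w" if "E y \<noteq> 0" for y
  proof (rule ccontr)
    assume "\<not> bruhat_le \<Phi> \<Delta> y w"
    then have "Pu y = 0" "Pu (y \<circ> reflect \<beta>) = 0" using Pu0[of y] Pu1[of y] by blast+
    then show False using that unfolding E_def by (simp split: if_splits)
  qed
  have Pw0: "Pu w = 0" using D(2)[of w] bruhat_len[of w u] l by fastforce
  have Es: "E (y \<circ> reflect \<beta>) = E y" if y: "y \<in> W" for y
  proof -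
    have ys: "y \<circ> reflect \<beta> \<in> W" using y b by blast
    show ?thesis unfolding E_def
      by (simp only: y ys if_True reflect_comp_self len_right_not_less[OF y b] split: if_split;
          simp add: add.commute)
  qed
  \<comment> \<open>\<open>E\<close> can violate the degree bound only at y with y s < y, and there
    only in the coefficient k > 0 with 2 k = l(w) - l(y); this is what the correction
    removes.\<close>
  have Ec: "coeff (E y) k = 0"
    if "y \<noteq> w" "?l w \<le> 2 * k + ?l y" "\<not> (\<not> ?up y \<and> 2 * k + ?l y = ?l w \<and> 0 < k)" for y k
  proof (cases "y \<in> W")
    case False
    then show ?thesis by (simp add: E_def)
  next
    case y: True
    have ysu: "y \<circ> reflect \<beta> \<noteq> u" using that(1) wu reflect_comp_eq_iff(2)[of y \<beta> u] by metis
    show ?thesis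
    proof (cases "?up y")
      case True
      then have ly: "?l (y \<circ> reflect \<beta>) = ?l y + 1" using len_right_cases[OF y b] by linarith
      have 1: "coeff (Pu (y \<circ> reflect \<beta>)) (k - 1) = 0" if "1 \<le> k"
        by (rule D(3)[OF ysu]) (use that \<open>?l w \<le> 2 * k + ?l y\<close> l ly in linarith)
      have 2: "coeff (Pu y) k = 0"
      \<comment> \<open>At y = u the polynomial is 1, and l(u) < l(w) forces k > 0.\<close>
      proof (cases "y = u")
        case True
        then have "k \<noteq> 0" using that(2) l by auto
        then show ?thesis using True D(1) by simp
      next
        case False
        then show ?thesis by (rule D(3)) (use that(2) l in linarith)
      qed
      show ?thesis unfolding E_def using y True 1 2 by (simp add: coeff_monom_mult)
    next
      case False
      then have ly: "?l y = ?l (y \<circ> reflect \<beta>) + 1" using len_right_cases[OF y b] by linarith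
      have 1: "coeff (Pu (y \<circ> reflect \<beta>)) k = 0"
        by (rule D(3)[OF ysu]) (use that(2) l ly in linarith)
      have yu: "y \<noteq> u" using False uup by metis
      have 2: "coeff (Pu y) (k - 1) = 0" if "1 \<le> k"
      proof (rule D(3)[OF yu])
        \<comment> \<open>The factor q costs two in the estimate and l(u) = l(w) - 1 returns one;
          strictness supplies the other.\<close>
        have "?l w < 2 * k + ?l y"
          using False that \<open>?l w \<le> 2 * k + ?l y\<close> \<open>\<not> (\<not> ?up y \<and> 2 * k + ?l y = ?l w \<and> 0 < k)\<close> by linarith
        then show "?l u \<le> 2 * (k - 1) + ?l y" using l that by linarith
      qed
      show ?thesis unfolding E_def using y False 1 2 by (simp add: coeff_monom_mult)
    qed
  qed
  have Qz: "z \<in> W" "is_kl_family \<Phi> \<Delta> z (Q z)" if "m z \<noteq> 0" for z using Q mD[OF that] by blast+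
  have Pne: "P y \<noteq> 0 \<Longrightarrow> bruhat_le \<Phi> \<Delta> y w" for y
  proof (rule ccontr)
    assume n: "P y \<noteq> 0" "\<not> bruhat_le \<Phi> \<Delta> y w"
    have f: "smult (m z) (monom 1 (M z) * Q z y) = 0" for z
    proof (rule ccontr)
      assume "smult (m z) (monom 1 (M z) * Q z y) \<noteq> 0"
      then have mz: "m z \<noteq> 0" and "Q z y \<noteq> 0" by auto
      then have "bruhat_le \<Phi> \<Delta> y z" using kl_familyD(2)[OF Qz(2)] by blast
      then show False using n bruhat_trans E0[OF mD(5)[OF mz]] by blast
    qed
    have "E y = 0" using n E0 by blast
    then show False using n(1) unfolding P_def f by simp
  qed
  have Pw: "P w = 1"
  proof -
    have f: "smult (m z) (monom 1 (M z) * Q z w) = 0" for z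
    proof (cases "m z = 0")
      case False
      have "Q z w = 0"
        using kl_familyD(2)[OF Qz(2)[OF False], of w] bruhat_len[of w z] mD(3)[OF False] by fastforce
      then show ?thesis by simp
    qed simp
    have "E w = 1" using w wdown D(1) Pw0 unfolding E_def uw by simp
    then show ?thesis unfolding P_def f by simp
  qed
  have Pc: "coeff (P y) k = 0" if y: "y \<noteq> w" and k: "?l w \<le> 2 * k + ?l y" for y k
  proof -
    \<comment> \<open>In the range of k where the bound is at stake, z contributes only at y = z,
      where its polynomial is 1; elsewhere the bound for z itself makes the shifted coefficient
      vanish.\<close>
    have "coeff (smult (m z) (monom 1 (M z) * Q z y)) k = (if z = y then if k = M y then m y else 0 else 0)" for z
    proof (cases "m z = 0")
      case False
      have "2 * M z = ?l w - ?l z" unfolding M_def using mD(4)[OF False] by simp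
      then have M: "2 * M z + ?l z = ?l w" using mD(3)[OF False] by linarith
      show ?thesis
      proof (cases "z = y")
        case True
        have "Q z z = 1" using kl_familyD(1)[OF Qz(2)[OF False]] .
        then show ?thesis unfolding True by simp
      next
        case ne: False
        have "coeff (Q z y) (k - M z) = 0" if "M z \<le> k"
          by (rule kl_familyD(3)[OF Qz(2)[OF False] ne[symmetric]]) (use that M k in linarith)
        then show ?thesis using ne by (simp add: coeff_monom_mult)
      qed
    qed auto
    then have s: "coeff (P y) k = coeff (E y) k - (if y \<in> W then if k = M y then m y else 0 else 0)"
      unfolding P_def using finite_weyl by (simp add: coeff_sum)
    show ?thesis
    proof (cases "y \<in> W \<and> \<not> ?up y \<and> 2 * k + ?l y = ?l w \<and> 0 < k")
      case True
      then have "?l w = 2 * k + ?l y" "0 < k" by auto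
      then have "?l y < ?l w" "even (?l w - ?l y)" and kM: "k = M y" unfolding M_def by simp_all
      then have "m y = coeff (E y) k" using True unfolding m_def by simp
      then show ?thesis using s True kM by simp
    next
      case False
      have "coeff (E y) k = 0" using Ec[OF y k] False unfolding E_def by (cases "y \<in> W") auto
      moreover have "m y = 0" if "k = M y"
      proof (rule ccontr)
        assume n: "m y \<noteq> 0"
        have "2 * M y = ?l w - ?l y" unfolding M_def using mD(4)[OF n] by simp
        then show False using False mD(1-3)[OF n] that by linarith
      qed
      ultimately show ?thesis using s by simp
    qed
  qed
  have Pbar: "hecke_bar \<Phi> \<Delta> (\<lambda>y. vpow (- int (?l w)) * poly_q (P y)) = (\<lambda>y. vpow (- int (?l w)) * poly_q (P y))"
  proof -
    let ?C = "hecke_kl_element \<Phi> \<Delta>"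
    have 1: "vpow (- int (?l w)) * poly_q (E y) = kl_right_mult \<beta> (?C u Pu) y" for y
    proof -
      have v: "vpow (- int (?l w)) = vpow (- 1) * vpow (- int (?l u))" by (simp add: vpow_mult l)
      have x: "poly_q (?X * p) = qv * poly_q p" for p by (simp add: poly_q_monom qv_def)
      have y: "?C u Pu y = 0" if "y \<notin> W"
      proof -
        have "Pu y = 0" using that D(2)[of y] bruhat_weyl[of y u] by blast
        then show ?thesis by (simp add: D(5) poly_q_0)
      qed
      show ?thesis
      proof (cases "y \<in> W")
        case True
        show ?thesis
        proof (cases "?up y")
          case up: True
          show ?thesis unfolding kl_right_mult_def T_right_mult_def E_def v D(5)
            using True up by (simp add: poly_q_add x[unfolded One_nat_def], simp add: algebra_simps)
        next
          case up: False
          show ?thesis unfolding kl_right_mult_def T_right_mult_def E_def v D(5)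
            using True up by (simp add: poly_q_add x[unfolded One_nat_def], simp add: algebra_simps)
        qed
      qed (simp add: E_def kl_right_mult_def T_right_mult_def y poly_q_0)
    qed
    have 2: "vpow (- int (?l w)) * poly_q (smult (m z) (monom 1 (M z) * Q z y)) = of_int (m z) * ?C z (Q z) y"
      for z y
    proof (cases "m z = 0")
      case False
      have "2 * M z = ?l w - ?l z" unfolding M_def using mD(4)[OF False] by simp
      then have "2 * int (M z) = int (?l w) - int (?l z)" using mD(3)[OF False] by linarith
      then have v: "vpow (- int (?l w)) * vpow (2 * int (M z)) = vpow (- int (?l z))"
        by (simp add: vpow_mult)
      have "vpow (- int (?l w)) * poly_q (smult (m z) (monom 1 (M z) * Q z y))
        = of_int (m z) * (vpow (- int (?l w)) * vpow (2 * int (M z)) * poly_q (Q z y))"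
        unfolding poly_q_smult poly_q_monom by (simp only: mult_ac)
      then show ?thesis unfolding v kl_familyD(5)[OF Qz(2)[OF False]] .
    qed (simp add: poly_q_0)
    have e: "(\<lambda>y. vpow (- int (?l w)) * poly_q (P y))
      = (\<lambda>y. kl_right_mult \<beta> (?C u Pu) y - (\<Sum>z\<in>W. of_int (m z) * ?C z (Q z) y))"
      by (simp add: P_def poly_q_diff poly_q_sum right_diff_distrib sum_distrib_left 1 2)
    have 3: "of_int (m z) * hecke_bar \<Phi> \<Delta> (?C z (Q z)) y = of_int (m z) * ?C z (Q z) y" for z y
    proof (cases "m z = 0")
      case False
      then show ?thesis using kl_familyD(4)[OF Qz(2)[OF False]] by simp
    qed simp
    show ?thesis
      unfolding e hecke_bar_diff hecke_bar_sum hecke_bar_kl_right_mult[OF b D(4)] 3 ..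
  qed
  have "P (y \<circ> reflect \<beta>) = P y" if y: "y \<in> W" for y
  proof -
    have "smult (m z) (monom 1 (M z) * Q z (y \<circ> reflect \<beta>)) = smult (m z) (monom 1 (M z) * Q z y)" if "z \<in> W" for z
    proof (cases "m z = 0")
      case False
      then show ?thesis using Qs[of z y] mD(1-3)[OF False] y len_right_not_less[OF that b] by simp
    qed simp
    then show ?thesis unfolding P_def Es[OF y] by (simp only: cong: sum.cong)
  qed
  moreover have "is_kl_family \<Phi> \<Delta> w P"
    by (rule kl_familyI[of P w]) (use Pw Pne Pc Pbar in blast)+
  ultimately show ?thesis by blast
qed

text \<open>For every descent \<beta> of w the step yields a family invariant under s_\<beta>.
  Uniqueness identifies these families, so a single one is invariant under all descents. The
  invariance belongs to the induction because the step requires it of the shorter elements.\<close>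

lemma kl_family_exists:
  "w \<in> W \<Longrightarrow> \<exists>P. is_kl_family \<Phi> \<Delta> w P \<and>
     (\<forall>\<beta>\<in>\<Delta>. len \<Delta> (w \<circ> reflect \<beta>) < len \<Delta> w \<longrightarrow> (\<forall>y\<in>W. P (y \<circ> reflect \<beta>) = P y))"
proof (induction "len \<Delta> w" arbitrary: w rule: less_induct)
  case less
  note w = less.prems
  show ?case
  proof (cases "w = id")
    case True
    define P :: "('a \<Rightarrow> 'a) \<Rightarrow> int poly" where "P = (\<lambda>y. if y = id then 1 else 0)"
    have e: "(\<lambda>y. vpow (- int (len \<Delta> id)) * poly_q (P y)) = Tb id"
      by (rule ext) (simp add: P_def Tb_def poly_q_0 poly_q_1 vpow_0)
    have "hecke_bar \<Phi> \<Delta> (Tb id) = (\<lambda>x. \<Sum>w\<in>W. if w = id then Tb id x else 0)"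
      unfolding hecke_bar_def
    proof (rule ext, rule sum.cong[OF refl])
      fix x w
      show "laurent_bar (Tb id w) * barT w x = (if w = id then Tb id x else 0)"
      proof (cases "w = id")
        case True
        have "laurent_bar 1 = 1" using laurent_bar_vpow[of 0 1] laurent_bar_single[of 0 1 1]
          by (simp add: poly_mapping_eq_iff fun_eq_iff lookup_laurent_bar lookup_one)
        then show ?thesis unfolding True barT_id by (simp add: Tb_def)
      qed (simp add: Tb_def laurent_bar_0)
    qed
    then have "hecke_bar \<Phi> \<Delta> (Tb id) = Tb id" using finite_weyl weyl_id by simp
    then have "is_kl_family \<Phi> \<Delta> id P"
      by (intro kl_familyI) (unfold e, auto simp: P_def bruhat_id split: if_splits)
    moreover have "\<not> len \<Delta> (id \<circ> reflect \<beta>) < len \<Delta> id" for \<beta> unfolding len_id by simp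
    ultimately show ?thesis unfolding True by blast
  next
    case False
    \<comment> \<open>The correction involves all shorter z at once, hence a choice of one family
      for each.\<close>
    define Q where "Q z = (SOME P. is_kl_family \<Phi> \<Delta> z P \<and>
     (\<forall>\<beta>\<in>\<Delta>. len \<Delta> (z \<circ> reflect \<beta>) < len \<Delta> z \<longrightarrow> (\<forall>y\<in>W. P (y \<circ> reflect \<beta>) = P y)))" for z
    have Q: "is_kl_family \<Phi> \<Delta> z (Q z) \<and>
     (\<forall>\<beta>\<in>\<Delta>. len \<Delta> (z \<circ> reflect \<beta>) < len \<Delta> z \<longrightarrow> (\<forall>y\<in>W. Q z (y \<circ> reflect \<beta>) = Q z y))"
      if "z \<in> W" "len \<Delta> z < len \<Delta> w" for z
      using someI_ex[OF less.hyps[OF that(2,1)]] unfolding Q_def .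
    have step: "\<exists>P. is_kl_family \<Phi> \<Delta> w P \<and> (\<forall>y\<in>W. P (y \<circ> reflect \<beta>) = P y)"
      if b: "\<beta> \<in> \<Delta>" and d: "len \<Delta> (w \<circ> reflect \<beta>) < len \<Delta> w" for \<beta>
    proof (rule kl_family_step[of \<beta> "w \<circ> reflect \<beta>" w "Q (w \<circ> reflect \<beta>)" Q])
      show "w \<circ> reflect \<beta> \<in> W" using w b by blast
      then show "is_kl_family \<Phi> \<Delta> (w \<circ> reflect \<beta>) (Q (w \<circ> reflect \<beta>))" using Q d by blast
      show "w = w \<circ> reflect \<beta> \<circ> reflect \<beta>" by (simp only: reflect_comp_self)
      show "len \<Delta> w = len \<Delta> (w \<circ> reflect \<beta>) + 1" using len_right_cases[OF w b] d by linarith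
    qed (use Q b in blast)+
    obtain u \<beta> where b: "\<beta> \<in> \<Delta>" and wu: "w = u \<circ> reflect \<beta>" and l: "len \<Delta> w = len \<Delta> u + 1"
      using exists_right_descent[OF w False] by metis
    have "w \<circ> reflect \<beta> = u" unfolding wu by (simp only: reflect_comp_self)
    then have "len \<Delta> (w \<circ> reflect \<beta>) < len \<Delta> w" using l by simp
    then obtain P where P: "is_kl_family \<Phi> \<Delta> w P" using step[OF b] by blast
    have "\<forall>y\<in>W. P (y \<circ> reflect \<gamma>) = P y" if "\<gamma> \<in> \<Delta>" "len \<Delta> (w \<circ> reflect \<gamma>) < len \<Delta> w" for \<gamma>
      using step[OF that] kl_family_unique[OF w P] by metis
    then show ?thesis using P by blast
  qed
qed

section \<open>Values at 1 and their invariance under right descents\<close>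

lemma kl_poly_family: assumes "w \<in> W" shows "is_kl_family \<Phi> \<Delta> w (\<lambda>y. kl_poly \<Phi> \<Delta> y w)"
proof -
  obtain P where P: "is_kl_family \<Phi> \<Delta> w P" using kl_family_exists[OF assms] by blast
  then have "(THE P. is_kl_family \<Phi> \<Delta> w P) = P"
    using kl_family_unique[OF assms] by (intro the_equality) blast+
  then show ?thesis using P by (simp add: kl_poly_def)
qed

definition klc :: "('a \<Rightarrow> 'a) \<Rightarrow> ('a \<Rightarrow> 'a) \<Rightarrow> int" where
  "klc y w = poly (kl_poly \<Phi> \<Delta> y w) 1"

lemma klc_self: "w \<in> W \<Longrightarrow> klc w w = 1"
  using kl_familyD(1)[OF kl_poly_family] by (simp add: klc_def)

lemma klc_nonzero: "w \<in> W \<Longrightarrow> klc y w \<noteq> 0 \<Longrightarrow> bruhat_le \<Phi> \<Delta> y w"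
  using kl_familyD(2)[OF kl_poly_family, of w y] by (cases "kl_poly \<Phi> \<Delta> y w = 0") (simp_all add: klc_def)

lemma klc_descent:
  assumes "w \<in> W" "\<alpha> \<in> descents \<Delta> w" "y \<in> W"
  shows "klc (y \<circ> reflect \<alpha>) w = klc y w"
proof -
  obtain P where P: "is_kl_family \<Phi> \<Delta> w P"
    "\<forall>\<beta>\<in>\<Delta>. len \<Delta> (w \<circ> reflect \<beta>) < len \<Delta> w \<longrightarrow> (\<forall>y\<in>W. P (y \<circ> reflect \<beta>) = P y)"
    using kl_family_exists[OF assms(1)] by blast
  have "P = (\<lambda>y. kl_poly \<Phi> \<Delta> y w)" using kl_family_unique[OF assms(1) P(1) kl_poly_family[OF assms(1)]] .
  then have "kl_poly \<Phi> \<Delta> (y \<circ> reflect \<alpha>) w = kl_poly \<Phi> \<Delta> y w"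
    using P(2) assms unfolding descents_def by (metis (lifting) mem_Collect_eq)
  then show ?thesis by (simp add: klc_def)
qed

end

section \<open>Dominant weights and the group ring\<close>

lemma poly_mapping_sum_single:
  "f = (\<Sum>k\<in>Poly_Mapping.keys f. Poly_Mapping.single k (Poly_Mapping.lookup f k))"
proof (rule poly_mapping_eqI)
  fix k
  have "(\<Sum>i\<in>Poly_Mapping.keys f. Poly_Mapping.lookup (Poly_Mapping.single i (Poly_Mapping.lookup f i)) k)
    = (\<Sum>i\<in>Poly_Mapping.keys f. if k = i then Poly_Mapping.lookup f i else 0)"
    by (rule sum.cong) (auto simp: lookup_single when_def)
  then show "Poly_Mapping.lookup f k =
      Poly_Mapping.lookup (\<Sum>k\<in>Poly_Mapping.keys f. Poly_Mapping.single k (Poly_Mapping.lookup f k)) k"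
    by (simp add: lookup_sum in_keys_iff)
qed

lemma lookup_times_keys:
  fixes f g :: "'a::ab_group_add \<Rightarrow>\<^sub>0 'b::comm_ring_1"
  shows "Poly_Mapping.lookup (f * g) x
    = (\<Sum>k\<in>Poly_Mapping.keys f. Poly_Mapping.lookup f k * Poly_Mapping.lookup g (x - k))"
  by (subst (1) poly_mapping_sum_single[of f]) (simp only: sum_distrib_right lookup_sum lookup_single_times)

context based_root_system begin

abbreviation \<Lambda> :: "'a set" where "\<Lambda> \<equiv> weight_lattice \<Phi>"

lemma weyl_simple_integral:
  assumes "w \<in> W" "\<forall>\<alpha>\<in>\<Delta>. coroot_pairing x \<alpha> \<in> \<int>"
  shows "\<forall>\<alpha>\<in>\<Delta>. coroot_pairing (w x) \<alpha> \<in> \<int>"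
  using assms(1)[unfolded weyl_eq_simple]
proof induction
  case id
  then show ?case using assms(2) by simp
next
  case (step \<beta> w)
  then show ?case using cartan_int simple_root
    by (auto simp: reflect_eq coroot_pairing_linear intro!: Ints_diff Ints_mult)
qed

lemma pairing_weyl: "w \<in> W \<Longrightarrow> coroot_pairing (w x) (w \<beta>) = coroot_pairing x \<beta>"
  by (rule coroot_pairing_orthogonal[OF weyl_orthogonal])

lemma pairing_weyl_inv: "w \<in> W \<Longrightarrow> coroot_pairing (w x) \<beta> = coroot_pairing x (inv w \<beta>)"
  using pairing_weyl[of w x "inv w \<beta>"] reflection_group_inv_comp(4)[of w \<Phi> \<beta>] by simp

text \<open>Every positive root is conjugate to a simple one, and integrality at the simple coroots
  survives the action of W because the Cartan numbers are integers.\<close>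

lemma weightI:
  assumes "\<And>\<alpha>. \<alpha> \<in> \<Delta> \<Longrightarrow> coroot_pairing x \<alpha> \<in> \<int>"
  shows "x \<in> \<Lambda>"
proof -
  have p: "coroot_pairing x \<beta> \<in> \<int>" if b: "pos \<beta>" for \<beta>
  proof -
    obtain w \<alpha> where w: "w \<in> reflection_group \<Delta>" "\<alpha> \<in> \<Delta>" "\<beta> = w \<alpha>"
      using root_simple_conj[OF b] by blast
    have wW: "w \<in> W" using w(1) by (simp only: weyl_eq_simple)
    have "coroot_pairing (inv w x) \<alpha> = coroot_pairing x \<beta>"
      using pairing_weyl[OF wW, of "inv w x" \<alpha>] reflection_group_inv_comp(4)[OF wW] w(3) by simp
    then show ?thesis using weyl_simple_integral[OF weyl_inv[OF wW], of x] assms w(2) by metis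
  qed
  have "coroot_pairing x \<beta> \<in> \<int>" if b: "\<beta> \<in> \<Phi>" for \<beta>
    using root_cases[OF b] p[of \<beta>] p[of "- \<beta>"] by (auto simp: coroot_pairing_uminus_right)
  then show ?thesis by (simp add: weight_lattice_def)
qed

lemma weight_pairing: "x \<in> \<Lambda> \<Longrightarrow> \<beta> \<in> \<Phi> \<Longrightarrow> coroot_pairing x \<beta> \<in> \<int>"
  by (simp add: weight_lattice_def)

lemma weight_add: "x \<in> \<Lambda> \<Longrightarrow> y \<in> \<Lambda> \<Longrightarrow> x + y \<in> \<Lambda>"
  and weight_diff: "x \<in> \<Lambda> \<Longrightarrow> y \<in> \<Lambda> \<Longrightarrow> x - y \<in> \<Lambda>"
  by (simp_all add: weight_lattice_def coroot_pairing_linear)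

lemma weight_weyl: "w \<in> W \<Longrightarrow> x \<in> \<Lambda> \<Longrightarrow> w x \<in> \<Lambda>"
  using weyl_simple_integral[of w x] weight_pairing[of x] simple_root by (intro weightI) blast

section \<open>Dominant weights and the height\<close>

definition dominant :: "'a \<Rightarrow> bool" where
  "dominant x \<longleftrightarrow> (\<forall>\<alpha>\<in>\<Delta>. 0 \<le> coroot_pairing x \<alpha>)"

text \<open>The pairing with the sum of the positive coroots: a linear functional with value 2 on
  every simple root. It gives a numerical order in which each dominant weight lies strictly above
  its other conjugates.\<close>

definition height :: "'a \<Rightarrow> real" where
  "height x = (\<Sum>\<beta>\<in>{\<beta>. pos \<beta>}. coroot_pairing x \<beta>)"

lemma finite_pos: "finite {\<beta>. pos \<beta>}"
  by (rule finite_subset[OF _ finite_roots]) (auto dest: pos_root)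

lemma height_add: "height (x + y) = height x + height y"
  by (simp add: height_def coroot_pairing_linear sum.distrib)

text \<open>The reflection permutes the positive roots other than \<alpha>, and only the term of
  \<alpha> changes sign, which accounts for the factor 2.\<close>

lemma height_reflect:
  assumes a: "\<alpha> \<in> \<Delta>"
  shows "height (reflect \<alpha> x) = height x - 2 * coroot_pairing x \<alpha>"
proof -
  let ?P = "{\<beta>. pos \<beta>} - {\<alpha>}"
  have p: "coroot_pairing (reflect \<alpha> x) \<beta> = coroot_pairing x (reflect \<alpha> \<beta>)" for \<beta>
    using coroot_pairing_orthogonal[OF orthogonal_reflect, of \<alpha> x "reflect \<alpha> \<beta>"] by simp
  have "reflect \<alpha> \<beta> \<in> ?P" if "\<beta> \<in> ?P" for \<beta>
  proof -
    have "reflect \<alpha> \<beta> \<noteq> \<alpha>"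
    proof
      assume "reflect \<alpha> \<beta> = \<alpha>"
      then have "\<beta> = reflect \<alpha> \<alpha>" by (metis reflect_reflect)
      then have "\<beta> = - \<alpha>" using reflect_self simple_nonzero[OF a] by simp
      then show False using that pos_uminus simple_pos[OF a] by auto
    qed
    then show ?thesis using that reflect_pos[OF a] by auto
  qed
  then have "bij_betw (reflect \<alpha>) ?P ?P"
    by (intro bij_betw_byWitness[where f' = "reflect \<alpha>"]) auto
  from sum.reindex_bij_betw[OF this, of "coroot_pairing x"]
  have "(\<Sum>\<beta>\<in>?P. coroot_pairing (reflect \<alpha> x) \<beta>) = (\<Sum>\<beta>\<in>?P. coroot_pairing x \<beta>)"
    unfolding p .
  moreover have "coroot_pairing (reflect \<alpha> x) \<alpha> = - coroot_pairing x \<alpha>"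
    unfolding p using reflect_self[OF simple_nonzero[OF a]] by (simp add: coroot_pairing_uminus_right)
  moreover have "height y = coroot_pairing y \<alpha> + (\<Sum>\<beta>\<in>?P. coroot_pairing y \<beta>)" for y
    unfolding height_def by (rule sum.remove[OF finite_pos]) (simp add: simple_pos[OF a])
  ultimately show ?thesis by simp
qed

lemma dominant_pairing_pos:
  assumes "dominant x" "pos \<beta>" shows "0 \<le> coroot_pairing x \<beta>"
proof -
  have "0 \<le> x \<bullet> \<gamma>" if "\<gamma> \<in> \<Delta>" for \<gamma>
  proof -
    have "0 \<le> coroot_pairing x \<gamma>" using assms(1) that by (simp add: dominant_def)
    moreover have "0 < \<gamma> \<bullet> \<gamma>" using simple_nonzero[OF that] by simp
    ultimately show ?thesis by (simp add: coroot_pairing_def zero_le_divide_iff)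
  qed
  moreover have "x \<bullet> \<beta> = (\<Sum>\<gamma>\<in>\<Delta>. (2 * (\<beta> \<bullet> fw \<gamma>) / (\<gamma> \<bullet> \<gamma>)) * (x \<bullet> \<gamma>))"
    by (subst (1) simple_expansion[of \<beta>]) (simp add: inner_sum_right)
  ultimately have "0 \<le> x \<bullet> \<beta>"
    using assms(2) by (simp add: pos_def sum_nonneg)
  then show ?thesis by (simp add: coroot_pairing_def)
qed

lemma height_dominant_nonneg: "dominant x \<Longrightarrow> 0 \<le> height x"
  unfolding height_def by (rule sum_nonneg) (simp add: dominant_pairing_pos)

lemma height_weight: "x \<in> \<Lambda> \<Longrightarrow> height x \<in> \<int>"
  unfolding height_def by (rule Ints_sum) (auto intro: weight_pairing pos_root)

lemma exists_left_descent:
  assumes "w \<in> W" "w \<noteq> id"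
  obtains u \<alpha> where "\<alpha> \<in> \<Delta>" "u \<in> W" "w = reflect \<alpha> \<circ> u" "len \<Delta> w = len \<Delta> u + 1"
proof -
  obtain \<alpha>s where a: "set \<alpha>s \<subseteq> \<Delta>" "length \<alpha>s = len \<Delta> w" "word_prod \<alpha>s = w"
    using obtain_reduced[OF assms(1)] .
  then obtain \<beta>s \<alpha> where b: "\<alpha>s = \<alpha> # \<beta>s" using assms(2) by (cases \<alpha>s) auto
  let ?u = "word_prod \<beta>s"
  have w: "w = reflect \<alpha> \<circ> ?u" using a(3) b word_prod_simps(2) by metis
  have "\<alpha> \<in> \<Delta>" "set \<beta>s \<subseteq> \<Delta>" using a b by auto
  moreover from this have "?u \<in> W" using word_prod_weyl by blast
  moreover have "len \<Delta> ?u < len \<Delta> w" using len_le[OF \<open>set \<beta>s \<subseteq> \<Delta>\<close>] a b by auto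
  ultimately show ?thesis using that w len_left_cases[of ?u \<alpha>] by simp
qed

text \<open>Build w from the right along a reduced word. Each new letter lengthens, so its simple
  root pairs nonnegatively with the weight reached so far and the reflection cannot raise the
  height; equality of heights makes every letter fix \<mu>. One induction thus yields maximality,
  strictness and the generation of the stabilizer by simple reflections.\<close>

lemma height_weyl_dominant:
  assumes "dominant \<mu>" "w \<in> W"
  shows "height (w \<mu>) \<le> height \<mu>"
    and "height (w \<mu>) = height \<mu> \<Longrightarrow> w \<mu> = \<mu>"
    and "w \<mu> = \<mu> \<Longrightarrow> w \<in> reflection_group {\<alpha> \<in> \<Delta>. coroot_pairing \<mu> \<alpha> = 0}"
proof -
  let ?G = "reflection_group {\<alpha> \<in> \<Delta>. coroot_pairing \<mu> \<alpha> = 0}"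
  have *: "height (w \<mu>) \<le> height \<mu> \<and> (height (w \<mu>) = height \<mu> \<longrightarrow> w \<mu> = \<mu> \<and> w \<in> ?G)"
    using assms(2)
  proof (induction "len \<Delta> w" arbitrary: w)
    case 0
    have "len \<Delta> w = 0" using 0(1) by simp
    then have w: "w = id" by (simp only: len_eq_0[OF 0(2)])
    show ?case unfolding w by (intro conjI impI; (rule reflection_group.id | simp))
  next
    case (Suc n)
    then have "len \<Delta> w \<noteq> 0" by linarith
    then have "w \<noteq> id" by (simp only: len_eq_0[OF Suc.prems] not_False_eq_True)
    then obtain u \<alpha> where a: "\<alpha> \<in> \<Delta>" and u: "u \<in> W" and wu: "w = reflect \<alpha> \<circ> u"
      and l: "len \<Delta> w = len \<Delta> u + 1"
      using exists_left_descent[OF Suc.prems] by metis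
    have "n = len \<Delta> u" using Suc.hyps(2) l by linarith
    note IH = Suc.hyps(1)[OF this u]
    have "pos (inv u \<alpha>)" using len_left_iff[OF u a] l wu by simp
    then have c: "0 \<le> coroot_pairing (u \<mu>) \<alpha>"
      unfolding pairing_weyl_inv[OF u] by (rule dominant_pairing_pos[OF assms(1)])
    have h: "height (w \<mu>) = height (u \<mu>) - 2 * coroot_pairing (u \<mu>) \<alpha>"
      unfolding wu comp_apply by (rule height_reflect[OF a])
    show ?case
    proof (intro conjI impI)
      show "height (w \<mu>) \<le> height \<mu>" using h c IH by linarith
      assume e: "height (w \<mu>) = height \<mu>"
      then have z: "coroot_pairing (u \<mu>) \<alpha> = 0" and "height (u \<mu>) = height \<mu>" using h c IH by linarith+
      then have u': "u \<mu> = \<mu>" "u \<in> ?G" using IH by blast+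
      then show "w \<mu> = \<mu>" unfolding wu using z by (simp add: reflect_eq)
      show "w \<in> ?G" unfolding wu
        by (rule reflection_group.step) (use u' z a in auto)
    qed
  qed
  then show "height (w \<mu>) \<le> height \<mu>" "height (w \<mu>) = height \<mu> \<Longrightarrow> w \<mu> = \<mu>" by blast+
  show "w \<in> ?G" if "w \<mu> = \<mu>" using * that by metis
qed

lemma dominant_conj_unique:
  assumes "dominant \<mu>" "dominant (w \<mu>)" "w \<in> W" shows "w \<mu> = \<mu>"
proof -
  have "height (inv w (w \<mu>)) \<le> height (w \<mu>)"
    by (rule height_weyl_dominant(1)[OF assms(2) weyl_inv[OF assms(3)]])
  then have "height \<mu> \<le> height (w \<mu>)" by (simp only: reflection_group_inv_comp[OF assms(3)])
  then show ?thesis using height_weyl_dominant(1,2)[OF assms(1,3)] by linarith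
qed

text \<open>A conjugate of greatest height is dominant: a negative pairing with a simple coroot
  would allow a simple reflection to raise the height.\<close>

lemma exists_dominant_conj: "\<exists>w\<in>W. dominant (w x)"
proof -
  have fin: "finite ((\<lambda>w. height (w x)) ` W)" "(\<lambda>w. height (w x)) ` W \<noteq> {}"
    using finite_weyl weyl_id by blast+
  from Max_in[OF this] obtain w where w: "w \<in> W" "Max ((\<lambda>w. height (w x)) ` W) = height (w x)" by blast
  have "0 \<le> coroot_pairing (w x) \<alpha>" if a: "\<alpha> \<in> \<Delta>" for \<alpha>
  proof -
    have "reflect \<alpha> \<circ> w \<in> W" using a w by blast
    then have "height ((reflect \<alpha> \<circ> w) x) \<in> (\<lambda>w. height (w x)) ` W" by (rule imageI)
    then have "height (reflect \<alpha> (w x)) \<le> height (w x)"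
      using Max_ge[OF fin(1)] w(2) by (metis comp_apply)
    then show ?thesis using height_reflect[OF a, of "w x"] by linarith
  qed
  then show ?thesis using w unfolding dominant_def by blast
qed

section \<open>Stabilizers, cosets and the coefficients of f_w\<close>

abbreviation vpi :: "('a \<Rightarrow> 'a) \<Rightarrow> 'a" where
  "vpi w \<equiv> weight_sum \<Delta> (\<Delta> - descents \<Delta> w)"

lemma descents_subset: "descents \<Delta> w \<subseteq> \<Delta>"
  by (auto simp: descents_def)

lemma vpi_pairing: "\<alpha> \<in> \<Delta> \<Longrightarrow> coroot_pairing (vpi w) \<alpha> = (if \<alpha> \<in> descents \<Delta> w then 0 else 1)"
  by (subst weight_sum_pairing) auto

lemma vpi_dominant: "dominant (vpi w)"
  by (simp add: dominant_def vpi_pairing)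

lemma vpi_weight: "vpi w \<in> \<Lambda>"
  by (rule weightI) (simp add: vpi_pairing)

abbreviation par :: "('a \<Rightarrow> 'a) \<Rightarrow> ('a \<Rightarrow> 'a) set" where
  "par w \<equiv> reflection_group (descents \<Delta> w)"

lemma par_weyl: "par w \<subseteq> W"
  using reflection_group_mono[OF descents_subset] by (simp only: weyl_eq_simple)

lemma par_fixes: "z \<in> par w \<Longrightarrow> z (vpi w) = vpi w"
proof (induction rule: reflection_group.induct)
  case (step \<alpha> z)
  then show ?case using descents_subset[of w] by (auto simp: reflect_eq vpi_pairing)
qed simp

text \<open>The simple roots orthogonal to \<open>vpi w\<close> are exactly the descents of w, so
  \<open>height_weyl_dominant\<close> places the stabilizer inside \<open>par w\<close>.\<close>

lemma orbit_stabilizer_vpi: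
  assumes "x \<in> W"
  shows "{y \<in> W. y (vpi w) = x (vpi w)} = (\<lambda>z. x \<circ> z) ` par w"
proof (intro equalityI subsetI)
  fix y assume "y \<in> {y \<in> W. y (vpi w) = x (vpi w)}"
  then have y: "y \<in> W" "y (vpi w) = x (vpi w)" by auto
  have i: "inv x \<circ> y \<in> W" using weyl_comp weyl_inv assms y by blast
  have "(inv x \<circ> y) (vpi w) = vpi w"
    using y(2) by (simp add: reflection_group_inv_comp[OF assms])
  from height_weyl_dominant(3)[OF vpi_dominant i this]
  have "inv x \<circ> y \<in> reflection_group {\<alpha> \<in> \<Delta>. coroot_pairing (vpi w) \<alpha> = 0}" .
  moreover have "{\<alpha> \<in> \<Delta>. coroot_pairing (vpi w) \<alpha> = 0} = descents \<Delta> w"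
    using descents_subset[of w] by (auto simp: vpi_pairing split: if_splits)
  ultimately have "inv x \<circ> y \<in> par w" by simp
  moreover have "y = x \<circ> (inv x \<circ> y)"
    using reflection_group_inv_comp(2)[OF assms] by (simp only: o_assoc id_comp)
  ultimately show "y \<in> (\<lambda>z. x \<circ> z) ` par w" by (intro image_eqI[of _ _ "inv x \<circ> y"])
next
  fix y assume "y \<in> (\<lambda>z. x \<circ> z) ` par w"
  then obtain z where z: "z \<in> par w" "y = x \<circ> z" by blast
  have "z \<in> W" using z par_weyl by blast
  then have "y \<in> W" using z weyl_comp assms by blast
  then show "y \<in> {y \<in> W. y (vpi w) = x (vpi w)}" using par_fixes[OF z(1)] z(2) by simp
qed

lemma klc_par:
  assumes "w \<in> W" "z \<in> par w" "x \<in> W"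
  shows "klc (x \<circ> z) w = klc x w"
  using assms(2,3)
proof (induction arbitrary: x rule: reflection_group.induct)
  case id
  show ?case by (simp only: comp_id)
next
  case (step \<alpha> z)
  have xs: "x \<circ> reflect \<alpha> \<in> W" using step.hyps(1) step.prems descents_subset by blast
  have "klc (x \<circ> (reflect \<alpha> \<circ> z)) w = klc (x \<circ> reflect \<alpha> \<circ> z) w" by (simp only: o_assoc)
  also have "\<dots> = klc (x \<circ> reflect \<alpha>) w" by (rule step.IH[OF xs])
  also have "\<dots> = klc x w" by (rule klc_descent[OF assms(1) step.hyps(1) step.prems])
  finally show ?case .
qed

lemma finite_par: "finite (par w)"
  using finite_subset[OF par_weyl finite_weyl] .

lemma card_par: "card (par w) \<noteq> 0"
  using finite_par reflection_group.id[of "descents \<Delta> w"] by (metis card_0_eq empty_iff)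

text \<open>The y with the same value on \<open>vpi w\<close> as x form the coset of x modulo
  \<open>par w\<close>, on which \<open>klc\<close> is constant; its size is the number by which
  \<open>kl_basis_element\<close> divides. The function G allows for the coefficients of f_w as well
  as those of its multiples.\<close>

lemma coset_sum:
  fixes G :: "'a \<Rightarrow> rat"
  assumes "w \<in> W" "x \<in> W" "\<And>y. y \<in> W \<Longrightarrow> y (vpi w) \<noteq> x (vpi w) \<Longrightarrow> G (y (vpi w)) = 0"
  shows "(\<Sum>y\<in>W. of_int (klc y w) * G (y (vpi w))) = of_nat (card (par w)) * (of_int (klc x w) * G (x (vpi w)))"
proof -
  have inj: "inj_on (\<lambda>z. x \<circ> z) (par w)"
  proof (rule inj_onI)
    fix a b assume "x \<circ> a = x \<circ> b"
    then have "inv x \<circ> (x \<circ> a) = inv x \<circ> (x \<circ> b)" by (simp only:)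
    then show "a = b" using reflection_group_inv_comp(1)[OF assms(2)] by (simp only: o_assoc id_comp)
  qed
  have "(\<Sum>y\<in>W. of_int (klc y w) * G (y (vpi w)))
    = (\<Sum>y\<in>{y \<in> W. y (vpi w) = x (vpi w)}. of_int (klc y w) * G (y (vpi w)))"
    by (rule sum.mono_neutral_right) (use finite_weyl assms(3) in auto)
  also have "\<dots> = (\<Sum>z\<in>par w. of_int (klc (x \<circ> z) w) * G ((x \<circ> z) (vpi w)))"
    unfolding orbit_stabilizer_vpi[OF assms(2)] using sum.reindex[OF inj, of "\<lambda>y. of_int (klc y w) * G (y (vpi w))"]
    by (simp only: comp_def[of "\<lambda>y. of_int (klc y w) * G (y (vpi w))"])
  also have "\<dots> = (\<Sum>z\<in>par w. of_int (klc x w) * G (x (vpi w)))"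
    by (rule sum.cong[OF refl]) (simp add: klc_par[OF assms(1) _ assms(2)] par_fixes)
  finally show ?thesis by simp
qed

abbreviation F :: "('a \<Rightarrow> 'a) \<Rightarrow> ('a \<Rightarrow>\<^sub>0 rat)" where "F w \<equiv> kl_basis_element \<Phi> \<Delta> w"

lemma lookup_kl_element:
  assumes "w \<in> W" shows "Poly_Mapping.lookup (kl_element \<Phi> \<Delta> w) y = klc y w"
proof -
  have fin: "finite {y. bruhat_le \<Phi> \<Delta> y w}"
    by (rule finite_subset[OF _ finite_weyl]) (use bruhat_weyl in blast)
  have "Poly_Mapping.lookup (kl_element \<Phi> \<Delta> w) y = (\<Sum>z\<in>{y. bruhat_le \<Phi> \<Delta> y w}. if z = y then klc y w else 0)"
    unfolding kl_element_def lookup_sum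
    by (rule sum.cong) (auto simp: lookup_single when_def klc_def)
  also have "\<dots> = klc y w" using fin klc_nonzero[OF assms, of y] by auto
  finally show ?thesis .
qed

text \<open>The division becomes multiplication by a constant monomial at exponent 0, and the sum is
  extended from the support of C'_w to all of W, where the additional coefficients are zero.\<close>

lemma kl_basis_element_eq:
  assumes "w \<in> W"
  shows "F w = Poly_Mapping.single 0 (1 / of_nat (card (par w))) *
    (\<Sum>y\<in>W. Poly_Mapping.single (y (vpi w)) (of_int (klc y w)))"
proof -
  have 1: "of_int c * weyl_act y (chexp (vpi w)) = Poly_Mapping.single (y (vpi w)) (of_int c)" for c y
  proof -
    have "weyl_act y (chexp (vpi w)) = Poly_Mapping.single (y (vpi w)) 1"
      by (simp add: weyl_act_def chexp_def)
    moreover have "(of_int c :: 'a \<Rightarrow>\<^sub>0 rat) = Poly_Mapping.single 0 (of_int c)" by simp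
    ultimately show ?thesis by (simp only: mult_single mult_1_right add_0)
  qed
  have "group_ring_act (kl_element \<Phi> \<Delta> w) (chexp (vpi w))
    = (\<Sum>y\<in>Poly_Mapping.keys (kl_element \<Phi> \<Delta> w). Poly_Mapping.single (y (vpi w)) (of_int (klc y w)))"
    unfolding group_ring_act_def 1 lookup_kl_element[OF assms] ..
  also have "\<dots> = (\<Sum>y\<in>W. Poly_Mapping.single (y (vpi w)) (of_int (klc y w)))"
  proof (rule sum.mono_neutral_left[OF finite_weyl])
    show "Poly_Mapping.keys (kl_element \<Phi> \<Delta> w) \<subseteq> W"
    proof
      fix y assume "y \<in> Poly_Mapping.keys (kl_element \<Phi> \<Delta> w)"
      then have "klc y w \<noteq> 0" by (simp add: in_keys_iff lookup_kl_element[OF assms])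
      then show "y \<in> W" using klc_nonzero[OF assms] bruhat_weyl by blast
    qed
    show "\<forall>y\<in>W - Poly_Mapping.keys (kl_element \<Phi> \<Delta> w). Poly_Mapping.single (y (vpi w)) (of_int (klc y w)) = (0 :: 'a \<Rightarrow>\<^sub>0 rat)"
      by (simp add: in_keys_iff lookup_kl_element[OF assms])
  qed
  finally show ?thesis
    unfolding kl_basis_element_def by (simp only: mult_map_scale_conv_mult)
qed

lemma lookup_times_F:
  assumes "w \<in> W"
  shows "Poly_Mapping.lookup (g * F w) x
    = 1 / of_nat (card (par w)) * (\<Sum>y\<in>W. of_int (klc y w) * Poly_Mapping.lookup g (x - y (vpi w)))"
proof -
  have "g * F w = Poly_Mapping.single 0 (1 / of_nat (card (par w))) *
    (\<Sum>y\<in>W. Poly_Mapping.single (y (vpi w)) (of_int (klc y w)) * g)"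
    unfolding kl_basis_element_eq[OF assms] sum_distrib_right[symmetric] by (simp only: mult_ac)
  then show ?thesis by (simp only: lookup_single_times lookup_sum diff_0_right)
qed

lemma lookup_times_F_coset:
  assumes "w \<in> W" "x \<in> W"
    "\<And>y. y \<in> W \<Longrightarrow> y (vpi w) \<noteq> x (vpi w) \<Longrightarrow> Poly_Mapping.lookup g (k - y (vpi w)) = 0"
  shows "Poly_Mapping.lookup (g * F w) k = of_int (klc x w) * Poly_Mapping.lookup g (k - x (vpi w))"
  using coset_sum[OF assms(1,2), of "\<lambda>j. Poly_Mapping.lookup g (k - j)"] assms(3) card_par[of w]
  by (simp add: lookup_times_F[OF assms(1)])

text \<open>The case g = 1 of the preceding formulas. The denominator has cancelled, which is why
  f_w has integer coefficients.\<close>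

lemma lookup_F:
  assumes "w \<in> W"
  shows "x \<in> W \<Longrightarrow> Poly_Mapping.lookup (F w) (x (vpi w)) = of_int (klc x w)"
    and "k \<notin> (\<lambda>y. y (vpi w)) ` W \<Longrightarrow> Poly_Mapping.lookup (F w) k = 0"
proof -
  show "Poly_Mapping.lookup (F w) (x (vpi w)) = of_int (klc x w)" if x: "x \<in> W"
    using lookup_times_F_coset[OF assms x, of 1 "x (vpi w)"] by (simp add: lookup_one when_def)
  show "Poly_Mapping.lookup (F w) k = 0" if "k \<notin> (\<lambda>y. y (vpi w)) ` W"
  proof -
    have "Poly_Mapping.lookup (1 :: 'a \<Rightarrow>\<^sub>0 rat) (k - y (vpi w)) = 0" if "y \<in> W" for y
      using that \<open>k \<notin> (\<lambda>y. y (vpi w)) ` W\<close> by (auto simp: lookup_one when_def)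
    then show ?thesis using lookup_times_F[OF assms, of 1 k] by simp
  qed
qed

lemma char_ring_iff:
  "f \<in> char_ring \<Phi> \<longleftrightarrow> (\<forall>x. Poly_Mapping.lookup f x \<noteq> 0 \<longrightarrow> x \<in> \<Lambda>) \<and> (\<forall>x. Poly_Mapping.lookup f x \<in> \<int>)"
  by (auto simp: char_ring_def in_keys_iff)

lemma F_char_ring: assumes "w \<in> W" shows "F w \<in> char_ring \<Phi>"
proof -
  have "(Poly_Mapping.lookup (F w) k \<noteq> 0 \<longrightarrow> k \<in> \<Lambda>) \<and> Poly_Mapping.lookup (F w) k \<in> \<int>" for k
  proof (cases "k \<in> (\<lambda>y. y (vpi w)) ` W")
    case True
    then obtain y where y: "y \<in> W" "k = y (vpi w)" by blast
    show ?thesis unfolding y(2) using lookup_F(1)[OF assms y(1)] weight_weyl[OF y(1) vpi_weight] by simp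
  next
    case False
    then show ?thesis using lookup_F(2)[OF assms] by simp
  qed
  then show ?thesis by (simp only: char_ring_iff) blast
qed

lemma char_ring_times:
  assumes "f \<in> char_ring \<Phi>" "g \<in> char_ring \<Phi>" shows "f * g \<in> char_ring \<Phi>"
  unfolding char_ring_iff
proof (intro conjI allI impI)
  note f = assms(1)[unfolded char_ring_iff] and g = assms(2)[unfolded char_ring_iff]
  fix x
  show "Poly_Mapping.lookup (f * g) x \<in> \<int>"
    unfolding lookup_times_keys by (intro Ints_sum Ints_mult) (use f g in blast)+
  assume "Poly_Mapping.lookup (f * g) x \<noteq> 0"
  then obtain k where "Poly_Mapping.lookup f k * Poly_Mapping.lookup g (x - k) \<noteq> 0"
    unfolding lookup_times_keys by (meson sum.not_neutral_contains_not_neutral)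
  then have "k \<in> \<Lambda>" "x - k \<in> \<Lambda>" using f g by auto
  then show "x \<in> \<Lambda>" using weight_add by fastforce
qed

lemma lookup_weyl_act:
  assumes "w \<in> W"
  shows "Poly_Mapping.lookup (weyl_act w f) x = Poly_Mapping.lookup f (inv w x)"
proof -
  have "w k = x \<longleftrightarrow> k = inv w x" for k
    using reflection_group_inv_comp(3,4)[OF assms] by metis
  then have "Poly_Mapping.lookup (weyl_act w f) x
    = (\<Sum>k\<in>Poly_Mapping.keys f. if k = inv w x then Poly_Mapping.lookup f (inv w x) else 0)"
    unfolding weyl_act_def lookup_sum by (intro sum.cong) (auto simp: lookup_single when_def)
  then show ?thesis by (simp add: in_keys_iff)
qed

lemma invariants_iff:
  "f \<in> char_ring_invariants \<Phi> \<longleftrightarrow> f \<in> char_ring \<Phi> \<and>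
    (\<forall>w\<in>W. \<forall>x. Poly_Mapping.lookup f (w x) = Poly_Mapping.lookup f x)"
proof -
  have "(\<forall>w\<in>W. weyl_act w f = f) \<longleftrightarrow> (\<forall>w\<in>W. \<forall>x. Poly_Mapping.lookup f (inv w x) = Poly_Mapping.lookup f x)"
    by (simp only: poly_mapping_eq_iff fun_eq_iff lookup_weyl_act cong: ball_cong)
  also have "\<dots> \<longleftrightarrow> (\<forall>w\<in>W. \<forall>x. Poly_Mapping.lookup f (w x) = Poly_Mapping.lookup f x)"
    using reflection_group_inv_comp(3,4)[of _ \<Phi>] by metis
  finally show ?thesis by (simp add: char_ring_invariants_def)
qed

text \<open>
  Coefficients of \<open>g f\<^sub>w\<close> at weights of maximal height: only the summand of \<open>g\<close> in
  the Weyl chamber of that weight contributes.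
\<close>

lemma lookup_leading:
  assumes w: "w \<in> W" and z: "z \<in> W" and mu: "dominant \<mu>"
    and g: "\<And>v x. v \<in> W \<Longrightarrow> Poly_Mapping.lookup g (v x) = Poly_Mapping.lookup g x"
    and n: "\<And>\<nu>. dominant \<nu> \<Longrightarrow> Poly_Mapping.lookup g \<nu> \<noteq> 0 \<Longrightarrow> height (\<nu> + vpi w) \<le> n"
  shows "n < height \<mu> \<Longrightarrow> Poly_Mapping.lookup (g * F w) (z \<mu>) = 0"
    and "height \<mu> = n \<Longrightarrow> Poly_Mapping.lookup (g * F w) (z \<mu>)
      = (if dominant (\<mu> - vpi w) then Poly_Mapping.lookup g (\<mu> - vpi w) * of_int (klc z w) else 0)"
proof -
  \<comment> \<open>A contributing y exhibits \<mu> as a conjugate of \<open>vpi w\<close> plus a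
    conjugate of a dominant \<nu> in the support of g. Comparing heights summand by summand gives
    the bound, and in case of equality both conjugations fix their weights.\<close>
  have claim: "height \<mu> \<le> n \<and> (height \<mu> = n \<longrightarrow> y (vpi w) = z (vpi w) \<and> dominant (\<mu> - vpi w))"
    if y: "y \<in> W" and ne: "Poly_Mapping.lookup g (z \<mu> - y (vpi w)) \<noteq> 0" for y
  proof -
    define \<kappa> where "\<kappa> = z \<mu> - y (vpi w)"
    obtain v where v: "v \<in> W" "dominant (v \<kappa>)" using exists_dominant_conj by blast
    define \<nu> where "\<nu> = v \<kappa>"
    let ?a = "inv z \<circ> y" and ?b = "inv z \<circ> inv v"
    have ab: "?a \<in> W" "?b \<in> W" using weyl_comp weyl_inv z y v(1) by blast+
    have k: "\<kappa> = inv v \<nu>" unfolding \<nu>_def using reflection_group_inv_comp(3)[OF v(1)] by simp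
    have "z \<mu> = y (vpi w) + inv v \<nu>" using k unfolding \<kappa>_def by (metis add.commute diff_add_cancel)
    then have "inv z (z \<mu>) = inv z (y (vpi w) + inv v \<nu>)" by simp
    then have mu_eq: "\<mu> = ?a (vpi w) + ?b \<nu>"
      using linear_add[OF weyl_linear[OF weyl_inv[OF z]]] reflection_group_inv_comp(3)[OF z] by simp
    have nu: "dominant \<nu>" "Poly_Mapping.lookup g \<nu> \<noteq> 0"
      using v(2) ne g[OF v(1)] unfolding \<nu>_def \<kappa>_def by simp_all
    have h: "height \<mu> = height (?a (vpi w)) + height (?b \<nu>)" by (subst mu_eq) (rule height_add)
    have ha: "height (?a (vpi w)) \<le> height (vpi w)" by (rule height_weyl_dominant(1)[OF vpi_dominant ab(1)])
    have hb: "height (?b \<nu>) \<le> height \<nu>" by (rule height_weyl_dominant(1)[OF nu(1) ab(2)])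
    have hn: "height \<nu> + height (vpi w) \<le> n" using n[OF nu] by (simp only: height_add)
    show ?thesis
    proof (intro conjI impI)
      show "height \<mu> \<le> n" using h ha hb hn by linarith
      assume "height \<mu> = n"
      then have "height (?a (vpi w)) = height (vpi w)" "height (?b \<nu>) = height \<nu>" using h ha hb hn by linarith+
      then have e: "?a (vpi w) = vpi w" "?b \<nu> = \<nu>"
        using height_weyl_dominant(2)[OF vpi_dominant ab(1)] height_weyl_dominant(2)[OF nu(1) ab(2)] by blast+
      have "z (inv z (y (vpi w))) = z (vpi w)" using e(1) by simp
      then show "y (vpi w) = z (vpi w)" by (simp only: reflection_group_inv_comp(4)[OF z])
      have "\<mu> - vpi w = \<nu>" using mu_eq e by (metis add_diff_cancel_left')
      then show "dominant (\<mu> - vpi w)" using nu by simp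
    qed
  qed
  show "Poly_Mapping.lookup (g * F w) (z \<mu>) = 0" if "n < height \<mu>"
  proof -
    have "Poly_Mapping.lookup g (z \<mu> - y (vpi w)) = 0" if "y \<in> W" for y
      using claim[OF that] \<open>n < height \<mu>\<close> by (metis not_le)
    then show ?thesis using lookup_times_F[OF w] by simp
  qed
  show "Poly_Mapping.lookup (g * F w) (z \<mu>)
      = (if dominant (\<mu> - vpi w) then Poly_Mapping.lookup g (\<mu> - vpi w) * of_int (klc z w) else 0)"
    if "height \<mu> = n"
  proof -
    have 1: "Poly_Mapping.lookup (g * F w) (z \<mu>) = of_int (klc z w) * Poly_Mapping.lookup g (z \<mu> - z (vpi w))"
      by (rule lookup_times_F_coset[OF w z]) (use claim that in metis)
    have 2: "Poly_Mapping.lookup g (z \<mu> - z (vpi w)) = Poly_Mapping.lookup g (\<mu> - vpi w)"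
      using g[OF z, of "\<mu> - vpi w"] linear_diff[OF weyl_linear[OF z]] by simp
    show ?thesis using claim[OF z] that unfolding 1 2 by auto
  qed
qed

section \<open>Linear independence\<close>

text \<open>Among the dominant \<nu> in the supports of the c_w choose a pair (w, \<nu>) with \<nu>
  + \<open>vpi w\<close> of maximal height and then with w of maximal length. At the image of \<nu>
  + \<open>vpi w\<close> under w the relation has the coefficient of c_w at \<nu>, which is
  nonzero.\<close>

lemma kl_basis_independent:
  assumes c: "\<And>w. w \<in> W \<Longrightarrow> c w \<in> char_ring_invariants \<Phi>" and s: "(\<Sum>w\<in>W. c w * F w) = 0" and w0: "w0 \<in> W"
  shows "c w0 = 0"
proof (rule ccontr)
  assume "c w0 \<noteq> 0"
  have inv: "Poly_Mapping.lookup (c w) (v x) = Poly_Mapping.lookup (c w) x" if "w \<in> W" "v \<in> W" for w v x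
    using c that by (simp add: invariants_iff)
  define X where "X = {(w, \<nu>). w \<in> W \<and> dominant \<nu> \<and> Poly_Mapping.lookup (c w) \<nu> \<noteq> 0}"
  have "X \<subseteq> (SIGMA w:W. Poly_Mapping.keys (c w))" by (auto simp: X_def in_keys_iff)
  moreover have "finite (SIGMA w:W. Poly_Mapping.keys (c w))" using finite_weyl by (rule finite_SigmaI) simp
  ultimately have finX: "finite X" by (rule finite_subset)
  obtain k where "Poly_Mapping.lookup (c w0) k \<noteq> 0"
    using \<open>c w0 \<noteq> 0\<close> by (metis poly_mapping_eqI lookup_zero)
  moreover obtain v where "v \<in> W" "dominant (v k)" using exists_dominant_conj by blast
  ultimately have "(w0, v k) \<in> X" using w0 inv by (simp add: X_def)
  define H where "H = (\<lambda>(w, \<nu>). height (\<nu> + vpi w))"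
  define n where "n = Max (H ` X)"
  have fin: "finite (H ` X)" "H ` X \<noteq> {}" using finX \<open>(w0, v k) \<in> X\<close> by blast+
  have nmax: "height (\<nu> + vpi w) \<le> n" if "w \<in> W" "dominant \<nu>" "Poly_Mapping.lookup (c w) \<nu> \<noteq> 0" for w \<nu>
  proof -
    have "(w, \<nu>) \<in> X" using that by (simp add: X_def)
    then have "H (w, \<nu>) \<le> n" unfolding n_def using fin(1) by (intro Max_ge) blast+
    then show ?thesis by (simp add: H_def)
  qed
  define Y where "Y = {p \<in> X. H p = n}"
  define L where "L = (\<lambda>p::('a \<Rightarrow> 'a) \<times> 'a. len \<Delta> (fst p)) ` Y"
  have "n \<in> H ` X" unfolding n_def by (rule Max_in[OF fin])
  then have finL: "finite L" "L \<noteq> {}" unfolding L_def Y_def using finX by auto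
  obtain p where p: "p \<in> Y" "Max L = len \<Delta> (fst p)" using Max_in[OF finL] unfolding L_def by blast
  obtain w \<nu> where pw: "p = (w, \<nu>)" by (cases p)
  have w: "w \<in> W" and nu: "dominant \<nu>" "Poly_Mapping.lookup (c w) \<nu> \<noteq> 0" and hn: "height (\<nu> + vpi w) = n"
    using p(1) unfolding pw Y_def X_def H_def by auto
  have lmax: "len \<Delta> w' \<le> len \<Delta> w" if "w' \<in> W" "dominant \<nu>'" "Poly_Mapping.lookup (c w') \<nu>' \<noteq> 0" "height (\<nu>' + vpi w') = n" for w' \<nu>'
  proof -
    have "(w', \<nu>') \<in> Y" using that by (simp add: Y_def X_def H_def)
    then have "len \<Delta> w' \<in> L" unfolding L_def by force
    then show ?thesis using Max_ge[OF finL(1)] p(2) pw by simp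
  qed
  define \<mu> where "\<mu> = \<nu> + vpi w"
  have mu: "dominant \<mu>" using nu(1) vpi_dominant[of w] by (simp add: \<mu>_def dominant_def coroot_pairing_linear)
  have t: "Poly_Mapping.lookup (c w' * F w') (w \<mu>) = (if w' = w then Poly_Mapping.lookup (c w) \<nu> else 0)"
    if w': "w' \<in> W" for w'
  proof -
    have lead: "Poly_Mapping.lookup (c w' * F w') (w \<mu>)
      = (if dominant (\<mu> - vpi w') then Poly_Mapping.lookup (c w') (\<mu> - vpi w') * of_int (klc w w') else 0)"
      by (rule lookup_leading(2)[OF w' w mu, where n = n])
         (use inv[OF w'] nmax[OF w'] hn in \<open>simp_all add: \<mu>_def\<close>)
    show ?thesis
    proof (cases "w' = w")
      case True
      have "\<mu> - vpi w = \<nu>" by (simp add: \<mu>_def)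
      then show ?thesis using lead nu(1) klc_self[OF w] unfolding True by simp
    next
      case False
      have "Poly_Mapping.lookup (c w') (\<mu> - vpi w') * of_int (klc w w') = 0" if d: "dominant (\<mu> - vpi w')"
      proof (rule ccontr)
        assume "Poly_Mapping.lookup (c w') (\<mu> - vpi w') * of_int (klc w w') \<noteq> 0"
        then have a: "Poly_Mapping.lookup (c w') (\<mu> - vpi w') \<noteq> 0" and "klc w w' \<noteq> 0" by auto
        \<comment> \<open>A contribution of w' needs w below w' in the Bruhat order, so w' would be
          longer, against the choice of w.\<close>
        then have "len \<Delta> w < len \<Delta> w'" using klc_nonzero[OF w'] bruhat_len False by metis
        moreover have "height (\<mu> - vpi w' + vpi w') = n" using hn by (simp add: \<mu>_def)
        ultimately show False using lmax[OF w' d a] by simp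
      qed
      then show ?thesis using lead False by simp
    qed
  qed
  have "0 = (\<Sum>w'\<in>W. Poly_Mapping.lookup (c w' * F w') (w \<mu>))"
    using arg_cong[OF s, of "\<lambda>f. Poly_Mapping.lookup f (w \<mu>)"] by (simp add: lookup_sum)
  also have "\<dots> = (\<Sum>w'\<in>W. if w' = w then Poly_Mapping.lookup (c w) \<nu> else 0)"
    by (rule sum.cong[OF refl t])
  also have "\<dots> = Poly_Mapping.lookup (c w) \<nu>" using w finite_weyl by simp
  finally show False using nu(2) by simp
qed

section \<open>Spanning\<close>

definition orbit_sum :: "'a \<Rightarrow> ('a \<Rightarrow>\<^sub>0 rat)" where
  "orbit_sum \<nu> = (\<Sum>k\<in>(\<lambda>w. w \<nu>) ` W. Poly_Mapping.single k 1)"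

lemma lookup_orbit_sum: "Poly_Mapping.lookup (orbit_sum \<nu>) x = (if x \<in> (\<lambda>w. w \<nu>) ` W then 1 else 0)"
proof -
  have "Poly_Mapping.lookup (orbit_sum \<nu>) x = (\<Sum>k\<in>(\<lambda>w. w \<nu>) ` W. if k = x then 1 else 0)"
    unfolding orbit_sum_def lookup_sum by (rule sum.cong) (auto simp: lookup_single when_def)
  then show ?thesis using finite_weyl by simp
qed

lemma orbit_weyl: assumes "v \<in> W" shows "v x \<in> (\<lambda>w. w \<nu>) ` W \<longleftrightarrow> x \<in> (\<lambda>w. w \<nu>) ` W"
proof
  assume "x \<in> (\<lambda>w. w \<nu>) ` W"
  then obtain w where w: "w \<in> W" "x = w \<nu>" by blast
  then have "v x = (v \<circ> w) \<nu>" by simp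
  moreover have "v \<circ> w \<in> W" using weyl_comp assms w by blast
  ultimately show "v x \<in> (\<lambda>w. w \<nu>) ` W" by (intro image_eqI[of _ _ "v \<circ> w"])
next
  assume "v x \<in> (\<lambda>w. w \<nu>) ` W"
  then obtain w where w: "w \<in> W" "v x = w \<nu>" by blast
  then have "x = (inv v \<circ> w) \<nu>" using reflection_group_inv_comp(3)[OF assms] by (metis comp_apply)
  moreover have "inv v \<circ> w \<in> W" using weyl_comp weyl_inv assms w by blast
  ultimately show "x \<in> (\<lambda>w. w \<nu>) ` W" by (intro image_eqI[of _ _ "inv v \<circ> w"])
qed

lemma orbit_sum_invariant: assumes "\<nu> \<in> \<Lambda>" shows "orbit_sum \<nu> \<in> char_ring_invariants \<Phi>"
proof -
  have "x \<in> \<Lambda>" if "x \<in> (\<lambda>w. w \<nu>) ` W" for x using that weight_weyl assms by blast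
  then show ?thesis by (simp add: invariants_iff char_ring_iff lookup_orbit_sum orbit_weyl)
qed

definition kl_span :: "('a \<Rightarrow>\<^sub>0 rat) set" where
  "kl_span = {\<Sum>w\<in>W. c w * F w | c. c ` W \<subseteq> char_ring_invariants \<Phi>}"

lemma kl_spanI: "(\<And>w. w \<in> W \<Longrightarrow> c w \<in> char_ring_invariants \<Phi>) \<Longrightarrow> (\<Sum>w\<in>W. c w * F w) \<in> kl_span"
  unfolding kl_span_def by blast

lemma invariants_zero: "0 \<in> char_ring_invariants \<Phi>"
  and invariants_scale: "f \<in> char_ring_invariants \<Phi> \<Longrightarrow> a \<in> \<int> \<Longrightarrow> Poly_Mapping.single 0 a * f \<in> char_ring_invariants \<Phi>"
  by (auto simp: invariants_iff char_ring_iff lookup_single_times)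

lemma invariants_add: "f \<in> char_ring_invariants \<Phi> \<Longrightarrow> g \<in> char_ring_invariants \<Phi> \<Longrightarrow> f + g \<in> char_ring_invariants \<Phi>"
  by (auto simp: invariants_iff char_ring_iff lookup_add) (metis add.right_neutral)

lemma kl_span_add: assumes "f \<in> kl_span" "g \<in> kl_span" shows "f + g \<in> kl_span"
proof -
  obtain c where c: "f = (\<Sum>w\<in>W. c w * F w)" "c ` W \<subseteq> char_ring_invariants \<Phi>"
    using assms(1) unfolding kl_span_def by blast
  obtain d where d: "g = (\<Sum>w\<in>W. d w * F w)" "d ` W \<subseteq> char_ring_invariants \<Phi>"
    using assms(2) unfolding kl_span_def by blast
  have "f + g = (\<Sum>w\<in>W. (c w + d w) * F w)" by (simp add: c d distrib_right sum.distrib)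
  then show ?thesis using kl_spanI[of "\<lambda>w. c w + d w"] c(2) d(2) invariants_add by (simp add: image_subset_iff)
qed

lemma kl_span_scale: assumes "f \<in> kl_span" "a \<in> \<int>" shows "Poly_Mapping.single 0 a * f \<in> kl_span"
proof -
  obtain c where c: "f = (\<Sum>w\<in>W. c w * F w)" "c ` W \<subseteq> char_ring_invariants \<Phi>"
    using assms(1) unfolding kl_span_def by blast
  have "Poly_Mapping.single 0 a * f = (\<Sum>w\<in>W. (Poly_Mapping.single 0 a * c w) * F w)"
    by (simp add: c sum_distrib_left mult.assoc)
  then show ?thesis using kl_spanI[of "\<lambda>w. Poly_Mapping.single 0 a * c w"] c(2) assms(2) invariants_scale
    by (simp add: image_subset_iff)
qed

lemma kl_span_sum: "finite A \<Longrightarrow> (\<And>i. i \<in> A \<Longrightarrow> f i \<in> kl_span) \<Longrightarrow> (\<Sum>i\<in>A. f i) \<in> kl_span"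
proof (induction A rule: finite_induct)
  case empty
  show ?case using kl_spanI[of "\<lambda>_. 0"] invariants_zero by simp
next
  case (insert x A)
  then show ?case using kl_span_add by simp
qed

lemma kl_span_diff: assumes "f \<in> kl_span" "g \<in> kl_span" shows "f - g \<in> kl_span"
proof -
  have "Poly_Mapping.single 0 (- 1) * g = - g"
    by (rule poly_mapping_eqI) (simp add: lookup_single_times)
  then show ?thesis using kl_span_add[OF assms(1) kl_span_scale[OF assms(2), of "- 1"]] by simp
qed

lemma kl_span_times: assumes "g \<in> char_ring_invariants \<Phi>" "w \<in> W" shows "g * F w \<in> kl_span"
proof -
  have "(\<Sum>v\<in>W. (if v = w then g else 0) * F v) = (\<Sum>v\<in>W. if v = w then g * F w else 0)"
    by (rule sum.cong) auto
  also have "\<dots> = g * F w" using assms(2) finite_weyl by simp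
  finally show ?thesis using kl_spanI[of "\<lambda>v. if v = w then g else 0"] assms(1) invariants_zero by simp
qed

lemma single_scale: "Poly_Mapping.single k a = Poly_Mapping.single 0 a * Poly_Mapping.single k (1::rat)"
  by (simp add: mult_single)

text \<open>Take the longest z that carries the dominant conjugate \<mu> to x: composing with a
  simple reflection that fixes \<mu> cannot lengthen it, so that reflection is a descent. For an
  integral \<mu> this makes \<mu> - \<open>vpi z\<close> dominant.\<close>

lemma exists_dominant_maximal:
  obtains z \<mu> where "z \<in> W" "dominant \<mu>" "x = z \<mu>" "\<And>\<alpha>. \<alpha> \<in> \<Delta> \<Longrightarrow> coroot_pairing \<mu> \<alpha> = 0 \<Longrightarrow> \<alpha> \<in> descents \<Delta> z"
proof -
  obtain v where v: "v \<in> W" "dominant (v x)" using exists_dominant_conj by blast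
  define \<mu> where "\<mu> = v x"
  define Z where "Z = {z \<in> W. z \<mu> = x}"
  have "inv v \<in> Z" using v weyl_inv reflection_group_inv_comp(3)[OF v(1)] by (simp add: Z_def \<mu>_def)
  moreover have "finite Z" using finite_weyl by (simp add: Z_def)
  ultimately have fin: "finite (len \<Delta> ` Z)" "len \<Delta> ` Z \<noteq> {}" by blast+
  obtain z where z: "z \<in> Z" "Max (len \<Delta> ` Z) = len \<Delta> z" using Max_in[OF fin] by blast
  have zW: "z \<in> W" and zx: "z \<mu> = x" using z(1) by (simp_all add: Z_def)
  have "\<alpha> \<in> descents \<Delta> z" if a: "\<alpha> \<in> \<Delta>" "coroot_pairing \<mu> \<alpha> = 0" for \<alpha>
  proof -
    have zs: "z \<circ> reflect \<alpha> \<in> W" using zW a by blast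
    have "(z \<circ> reflect \<alpha>) \<mu> = x" using zx a by (simp add: reflect_eq)
    then have "z \<circ> reflect \<alpha> \<in> Z" using zs unfolding Z_def by blast
    then have "len \<Delta> (z \<circ> reflect \<alpha>) \<le> len \<Delta> z" using Max_ge[OF fin(1)] z(2) by simp
    then show ?thesis using len_right_cases[OF zW a(1)] a(1) by (simp add: descents_def)
  qed
  then show ?thesis using that zW zx v(2) unfolding \<mu>_def by metis
qed

text \<open>Solve for exp(z \<mu>) in the product of an orbit sum with f_z, where it has coefficient
  1. Every other weight of the product, in the normal form of
  \<open>exists_dominant_maximal\<close>, is smaller for the height and then the length, so the
  induction covers it.\<close>

lemma single_in_kl_span:
  assumes "z \<in> W" "dominant \<mu>" "\<mu> \<in> \<Lambda>"
    and "\<And>\<alpha>. \<alpha> \<in> \<Delta> \<Longrightarrow> coroot_pairing \<mu> \<alpha> = 0 \<Longrightarrow> \<alpha> \<in> descents \<Delta> z"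
  shows "Poly_Mapping.single (z \<mu>) 1 \<in> kl_span"
  using assms
\<comment> \<open>The height of a dominant weight is a nonnegative integer, so the conversion to a
  natural number loses nothing.\<close>
proof (induction "(nat \<lfloor>height \<mu>\<rfloor>, len \<Delta> z)" arbitrary: z \<mu> rule: wf_induct_rule[OF wf_lex_prod[OF wf_less_than wf_less_than]])
  case less: 1
  note IH = less.hyps[rule_format]
  note z = less.prems(1) and mu = less.prems(2,3) and desc = less.prems(4)
  define \<nu> where "\<nu> = \<mu> - vpi z"
  have nuw: "\<nu> \<in> \<Lambda>" unfolding \<nu>_def by (rule weight_diff[OF mu(2) vpi_weight])
  have nud: "dominant \<nu>" unfolding dominant_def
  proof
    fix \<alpha> assume a: "\<alpha> \<in> \<Delta>"
    have p: "0 \<le> coroot_pairing \<mu> \<alpha>" using mu(1) a by (simp add: dominant_def)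
    show "0 \<le> coroot_pairing \<nu> \<alpha>"
    proof (cases "\<alpha> \<in> descents \<Delta> z")
      case True
      then show ?thesis using p a by (simp add: \<nu>_def coroot_pairing_linear vpi_pairing)
    next
      case False
      \<comment> \<open>Outside the descents the pairing is a nonzero nonnegative integer, hence at
        least 1, which is what \<open>vpi z\<close> subtracts.\<close>
      then have "coroot_pairing \<mu> \<alpha> \<noteq> 0" using desc a by blast
      moreover obtain i where i: "coroot_pairing \<mu> \<alpha> = of_int i"
        using weight_pairing[OF mu(2) simple_root[OF a]] by (auto elim: Ints_cases)
      ultimately have "1 \<le> i" using p by simp
      then show ?thesis using False a i by (simp add: \<nu>_def coroot_pairing_linear vpi_pairing)
    qed
  qed
  have mu_eq: "\<nu> + vpi z = \<mu>" by (simp add: \<nu>_def)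
  define h where "h = orbit_sum \<nu> * F z"
  have hspan: "h \<in> kl_span" unfolding h_def by (rule kl_span_times[OF orbit_sum_invariant[OF nuw] z])
  have hring: "h \<in> char_ring \<Phi>" unfolding h_def
    using orbit_sum_invariant[OF nuw] F_char_ring[OF z] char_ring_times by (simp add: invariants_iff)
  \<comment> \<open>An orbit has only one dominant member, so \<open>lookup_leading\<close> applies
    with the height of \<mu> as the bound n.\<close>
  have orb: "\<nu>' = \<nu>" if "dominant \<nu>'" "Poly_Mapping.lookup (orbit_sum \<nu>) \<nu>' \<noteq> 0" for \<nu>'
    using that dominant_conj_unique[OF nud] by (auto simp: lookup_orbit_sum split: if_splits)
  have lead: "height \<mu> < height \<mu>' \<Longrightarrow> Poly_Mapping.lookup h (x \<mu>') = 0"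
    "height \<mu>' = height \<mu> \<Longrightarrow> Poly_Mapping.lookup h (x \<mu>') = (if dominant (\<mu>' - vpi z)
      then Poly_Mapping.lookup (orbit_sum \<nu>) (\<mu>' - vpi z) * of_int (klc x z) else 0)"
    if "x \<in> W" "dominant \<mu>'" for x \<mu>'
    unfolding h_def
    by (rule lookup_leading[OF z that]; use orb mu_eq in \<open>auto simp: lookup_orbit_sum orbit_weyl\<close>)+
  have top: "Poly_Mapping.lookup h (z \<mu>) = 1"
  proof -
    have "\<nu> \<in> (\<lambda>w. w \<nu>) ` W" using weyl_id by (metis id_apply imageI)
    then show ?thesis using lead(2)[OF z mu(1)] nud klc_self[OF z] unfolding \<nu>_def[symmetric]
      by (simp add: lookup_orbit_sum)
  qed
  have rest: "Poly_Mapping.single k (1::rat) \<in> kl_span" if k: "k \<in> Poly_Mapping.keys h - {z \<mu>}" for k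
  proof -
    obtain x \<mu>' where x: "x \<in> W" "dominant \<mu>'" "k = x \<mu>'"
      and d: "\<And>\<alpha>. \<alpha> \<in> \<Delta> \<Longrightarrow> coroot_pairing \<mu>' \<alpha> = 0 \<Longrightarrow> \<alpha> \<in> descents \<Delta> x"
      using exists_dominant_maximal[of k] by metis
    have ne: "Poly_Mapping.lookup h (x \<mu>') \<noteq> 0" using k x(3) by (simp add: in_keys_iff)
    then have "x \<mu>' \<in> \<Lambda>" using hring by (simp add: char_ring_iff)
    then have "inv x (x \<mu>') \<in> \<Lambda>" by (rule weight_weyl[OF weyl_inv[OF x(1)]])
    then have mw: "\<mu>' \<in> \<Lambda>" by (simp only: reflection_group_inv_comp(3)[OF x(1)])
    have "nat \<lfloor>height \<mu>'\<rfloor> < nat \<lfloor>height \<mu>\<rfloor> \<or> nat \<lfloor>height \<mu>'\<rfloor> = nat \<lfloor>height \<mu>\<rfloor> \<and> len \<Delta> x < len \<Delta> z"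
    proof (cases "height \<mu>' = height \<mu>")
      case True
      have a: "dominant (\<mu>' - vpi z)" "Poly_Mapping.lookup (orbit_sum \<nu>) (\<mu>' - vpi z) \<noteq> 0" "klc x z \<noteq> 0"
        using ne lead(2)[OF x(1,2) True] by (auto split: if_splits)
      then have "\<mu>' - vpi z = \<nu>" using orb by blast
      then have "\<mu>' = \<mu>" using mu_eq by (metis diff_add_cancel)
      \<comment> \<open>The first alternative is ruled out because z \<mu> has been removed from the
        support.\<close>
      moreover have "x = z \<or> len \<Delta> x < len \<Delta> z" using bruhat_len[OF klc_nonzero[OF z a(3)]] .
      ultimately show ?thesis using k x(3) by blast
    next
      case False
      then have "height \<mu>' < height \<mu>" using ne lead(1)[OF x(1,2)] by fastforce
      moreover obtain i j where "height \<mu>' = of_int i" "height \<mu> = of_int j"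
        using height_weight[OF mw] height_weight[OF mu(2)] by (auto elim!: Ints_cases)
      ultimately show ?thesis using height_dominant_nonneg[OF x(2)] by simp
    qed
    then have "((nat \<lfloor>height \<mu>'\<rfloor>, len \<Delta> x), (nat \<lfloor>height \<mu>\<rfloor>, len \<Delta> z)) \<in> less_than <*lex*> less_than" by auto
    from IH[OF this x(1,2) mw d] show ?thesis unfolding x(3) by blast
  qed
  have "h = (\<Sum>k\<in>Poly_Mapping.keys h. Poly_Mapping.single k (Poly_Mapping.lookup h k))"
    by (rule poly_mapping_sum_single)
  also have "\<dots> = Poly_Mapping.single (z \<mu>) (Poly_Mapping.lookup h (z \<mu>))
    + (\<Sum>k\<in>Poly_Mapping.keys h - {z \<mu>}. Poly_Mapping.single k (Poly_Mapping.lookup h k))"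
    by (rule sum.remove) (simp_all add: in_keys_iff top)
  finally have "Poly_Mapping.single (z \<mu>) 1 = h - (\<Sum>k\<in>Poly_Mapping.keys h - {z \<mu>}. Poly_Mapping.single k (Poly_Mapping.lookup h k))"
    unfolding top by (metis add_diff_cancel_right')
  moreover have "(\<Sum>k\<in>Poly_Mapping.keys h - {z \<mu>}. Poly_Mapping.single k (Poly_Mapping.lookup h k)) \<in> kl_span"
  proof (rule kl_span_sum)
    fix k assume k: "k \<in> Poly_Mapping.keys h - {z \<mu>}"
    have "Poly_Mapping.lookup h k \<in> \<int>" using hring by (simp add: char_ring_iff)
    then show "Poly_Mapping.single k (Poly_Mapping.lookup h k) \<in> kl_span"
      using kl_span_scale[OF rest[OF k]] single_scale by metis
  qed simp
  ultimately show ?case using kl_span_diff[OF hspan] by simp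
qed

lemma char_ring_kl_span: assumes "f \<in> char_ring \<Phi>" shows "f \<in> kl_span"
proof -
  have "Poly_Mapping.single k (Poly_Mapping.lookup f k) \<in> kl_span" if k: "k \<in> Poly_Mapping.keys f" for k
  proof -
    have kw: "k \<in> \<Lambda>" and "Poly_Mapping.lookup f k \<in> \<int>" using assms k by (auto simp: char_ring_def)
    obtain x \<mu> where x: "x \<in> W" "dominant \<mu>" "k = x \<mu>"
      and d: "\<And>\<alpha>. \<alpha> \<in> \<Delta> \<Longrightarrow> coroot_pairing \<mu> \<alpha> = 0 \<Longrightarrow> \<alpha> \<in> descents \<Delta> x"
      using exists_dominant_maximal[of k] by metis
    have "inv x (x \<mu>) \<in> \<Lambda>" using kw x(3) weight_weyl[OF weyl_inv[OF x(1)]] by simp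
    then have "\<mu> \<in> \<Lambda>" by (simp only: reflection_group_inv_comp(3)[OF x(1)])
    from single_in_kl_span[OF x(1,2) this d] have "Poly_Mapping.single k 1 \<in> kl_span" unfolding x(3) by blast
    from kl_span_scale[OF this \<open>Poly_Mapping.lookup f k \<in> \<int>\<close>] show ?thesis by (simp only: single_scale[symmetric])
  qed
  then show ?thesis by (subst poly_mapping_sum_single) (rule kl_span_sum, simp_all)
qed

end

theorem corollary3p5:
  fixes \<Phi> \<Delta> :: "'a::euclidean_space set"
  assumes "irreducible_root_system \<Phi>"
    and "simple_roots \<Phi> \<Delta>"
  shows "is_module_basis (char_ring_invariants \<Phi>) (char_ring \<Phi>)
           (kl_basis_element \<Phi> \<Delta>) (weyl_group \<Phi>)"
proof -
  interpret based_root_system \<Phi> \<Delta>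
    by unfold_locales (use assms in \<open>simp_all add: irreducible_root_system_def\<close>)
  show ?thesis
    unfolding is_module_basis_def
  proof (intro conjI ballI allI impI)
    show "finite W" by (rule finite_weyl)
    show "kl_basis_element \<Phi> \<Delta> ` W \<subseteq> char_ring \<Phi>" using F_char_ring by blast
    show "\<exists>c. c ` W \<subseteq> char_ring_invariants \<Phi> \<and> m = (\<Sum>i\<in>W. c i * F i)" if "m \<in> char_ring \<Phi>" for m
      using char_ring_kl_span[OF that] unfolding kl_span_def by blast
    show "c w = 0" if "c ` W \<subseteq> char_ring_invariants \<Phi> \<and> (\<Sum>i\<in>W. c i * F i) = 0" "w \<in> W" for c w
      by (rule kl_basis_independent[of c]) (use that in blast)+
  qed
qed

end
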